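(* Let $\mathcal{A}$ be a Banach algebra with a (uniformly bounded) $d$-parameter automorphism group $\Psi$, and let $r>0$ and $1\le p\le\infty$. If $\{X_\sigma:\sigma\ge0\}$ is the approximation scheme of bandlimited elements of $\mathcal{A}$ and $\mathcal{E}^p_r(\mathcal{A})$ is the corresponding approximation space, then $$\Lambda^p_r(\mathcal{A})=\mathcal{E}^p_r(\mathcal{A}),$$ as sets and with equivalent norms.
   Context: Banach algebras are complex and unital; Banach spaces with equivalent norms are regarded as equal. A $d$-parameter automorphism group acting on a Banach algebra $\mathcal{A}$ is a family $\Psi=\{\psi_t\}_{t\in\mathbb{R}^d}$ of Banach algebra automorphisms of $\mathcal{A}$ with $\psi_s\psi_t=\psi_{s+t}$ for all $s,t\in\mathbb{R}^d$ (consisting of $*$-automorphisms if $\mathcal{A}$ is a $*$-algebra). It is always assumed uniformly bounded: $M_\Psi=\sup_{t\in\mathbb{R}^d}\|\psi_t\|_{\mathcal{A}\to\mathcal{A}}<\infty$. Strong continuity of $t\mapsto\psi_t(a)$ is not assumed. Besov spaces: put $\Delta_t^k=(\psi_t-\mathrm{id})^k$ and $\omega^k_h(a)=\sup_{|t|\le h}\|\Delta_t^k a\|_{\mathcal{A}}$ for $h>0$, where $|t|=\sum_j|t_j|$ (any other norm on $\mathbb{R}^d$ gives the same spaces with equivalent norms). For $1\le p\le\infty$, $r>0$ and $l=\lfloor r\rfloor+1$, $\Lambda^p_r(\mathcal{A})$ consists of all $a\in\mathcal{A}$ for which $\|a\|_{\Lambda^p_r(\mathcal{A})}=\|a\|_{\mathcal{A}}+\bigl(\int_0^\infty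 (h^{-r}\omega^l_h(a))^p\,\frac{dh}{h}\bigr)^{1/p}$ is finite (for $p=\infty$: $\|a\|_{\mathcal{A}}+\sup_{h>0}h^{-r}\omega^l_h(a)$, up to equivalence of norms). Bandlimited elements: for $t\ne0$ let $\delta_t(a)=\lim_{h\to0}\frac{\psi_{ht}(a)-a}{h}$, with domain the set of $a\in\mathcal{A}$ for which the limit exists in norm; with the standard basis $e_1,\dots,e_d$ of $\mathbb{R}^d$ and a multi-index $\alpha\in\mathbb{N}_0^d$ put $\delta^\alpha=\delta_{e_1}^{\alpha_1}\cdots\delta_{e_d}^{\alpha_d}$, $|\alpha|=\sum_j\alpha_j$. An element $a\in\mathcal{A}$ is $\sigma$-bandlimited ($\sigma>0$) if there is a constant $C$ (depending on $a$) such that, for every multi-index $\alpha$, $\delta^\alpha(a)$ is defined and $\|\delta^\alpha(a)\|_{\mathcal{A}}\le C(2\pi\sigma)^{|\alpha|}$. Put $X_0=\{0\}$ and $X_\sigma=\{a\in\mathcal{A}: a \text{ is } \sigma\text{-bandlimited}\}$ for $\sigma>0$. Approximation spaces: with $E_\sigma(a)=\inf_{x\in X_\sigma}\|a-x\|_{\mathcal{A}}$, the space $\mathcal{E}^p_r(\mathcal{A})$ consists of all $a\in\mathcal{A}$ with finite norm $\|a\|_{\mathcal{E}^p_r}=\bigl(\sum_{k=0}^\infty E_k(a)^p(k+1)^{rp}\frac1{k+1}\bigr)^{1/p}$ for $1\le p<\infty$, and $\sup_{k\ge0}E_k(a)(k+1)^r$ for $p=\infty$. *)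

theory Defs
  imports "HOL-Analysis.Analysis"
begin

section \<open>Complex unital Banach algebras and automorphism groups\<close>

text \<open>The library has no complex normed spaces, so the complex scalar multiplication is added to
  the real structure. The norm of the unit is not required to be 1.\<close>

class complex_banach_algebra = real_normed_algebra + ring_1 + banach +
  fixes scaleC :: "complex \<Rightarrow> 'a \<Rightarrow> 'a"
  assumes scaleC_add_right: "scaleC c (x + y) = scaleC c x + scaleC c y"
    and scaleC_add_left: "scaleC (c + c') x = scaleC c x + scaleC c' x"
    and scaleC_scaleC: "scaleC c (scaleC c' x) = scaleC (c * c') x"
    and scaleC_of_real: "scaleC (complex_of_real s) x = s *\<^sub>R x"
    and scaleC_mult_left: "scaleC c x * y = scaleC c (x * y)"
    and scaleC_mult_right: "x * scaleC c y = scaleC c (x * y)"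
    and norm_scaleC: "norm (scaleC c x) = cmod c * norm x"

instantiation complex :: complex_banach_algebra
begin
definition scaleC_complex :: "complex \<Rightarrow> complex \<Rightarrow> complex" where
  "scaleC_complex c x = c * x"
instance
  by standard (simp_all add: scaleC_complex_def algebra_simps scaleR_conv_of_real norm_mult)
end

definition banach_algebra_automorphism :: "('a::complex_banach_algebra \<Rightarrow> 'a) \<Rightarrow> bool" where
  "banach_algebra_automorphism f \<longleftrightarrow>
     bij f \<and> bounded_linear f \<and>
     (\<forall>c a. f (scaleC c a) = scaleC c (f a)) \<and>
     (\<forall>a b. f (a * b) = f a * f b)"

definition automorphism_group ::
  "(real ^ 'd::finite \<Rightarrow> 'a::complex_banach_algebra \<Rightarrow> 'a) \<Rightarrow> bool" where
  "automorphism_group \<psi> \<longleftrightarrow>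
     (\<forall>t. banach_algebra_automorphism (\<psi> t)) \<and>
     (\<forall>s t. \<psi> s \<circ> \<psi> t = \<psi> (s + t))"

definition uniformly_bounded_group ::
  "(real ^ 'd::finite \<Rightarrow> 'a::complex_banach_algebra \<Rightarrow> 'a) \<Rightarrow> bool" where
  "uniformly_bounded_group \<psi> \<longleftrightarrow> bdd_above (range (\<lambda>t. onorm (\<psi> t)))"

section \<open>Besov spaces\<close>

text \<open>Exponents in \<open>[1,\<infinity>]\<close> are extended nonnegative reals, and space norms take values in
  \<open>[0,\<infinity>]\<close>; a space consists of the elements of finite norm.\<close>

definition ennreal_root :: "real \<Rightarrow> ennreal \<Rightarrow> ennreal" where
  "ennreal_root q x = (if x = \<infinity> then \<infinity> else ennreal (enn2real x powr (1 / q)))"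

definition l1_norm :: "real ^ 'd::finite \<Rightarrow> real" where
  "l1_norm t = (\<Sum>j\<in>UNIV. \<bar>t $ j\<bar>)"

definition difference ::
  "(real ^ 'd::finite \<Rightarrow> 'a::complex_banach_algebra \<Rightarrow> 'a) \<Rightarrow> real ^ 'd \<Rightarrow> nat \<Rightarrow> 'a \<Rightarrow> 'a" where
  "difference \<psi> t k = (\<lambda>a. \<psi> t a - a) ^^ k"

text \<open>For a uniformly bounded group the set of norms is bounded, so the real supremum is the
  genuine one (for \<open>h > 0\<close>).\<close>

definition modulus_of_smoothness ::
  "(real ^ 'd::finite \<Rightarrow> 'a::complex_banach_algebra \<Rightarrow> 'a) \<Rightarrow> nat \<Rightarrow> real \<Rightarrow> 'a \<Rightarrow> real" where
  "modulus_of_smoothness \<psi> k h a = (SUP t\<in>{t. l1_norm t \<le> h}. norm (difference \<psi> t k a))"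

definition besov_norm ::
  "(real ^ 'd::finite \<Rightarrow> 'a::complex_banach_algebra \<Rightarrow> 'a) \<Rightarrow> ennreal \<Rightarrow> real \<Rightarrow> 'a \<Rightarrow> ennreal" where
  "besov_norm \<psi> p r a =
     (let \<omega> = (\<lambda>h. modulus_of_smoothness \<psi> (nat \<lfloor>r\<rfloor> + 1) h a);
          q = enn2real p
      in ennreal (norm a) +
         (if p = \<infinity> then (SUP h\<in>{0<..}. ennreal (h powr (- r) * \<omega> h))
          else ennreal_root q
                 (\<integral>\<^sup>+h\<in>{0<..}. ennreal ((h powr (- r) * \<omega> h) powr q / h) \<partial>lborel)))"

definition besov_space ::
  "(real ^ 'd::finite \<Rightarrow> 'a::complex_banach_algebra \<Rightarrow> 'a) \<Rightarrow> ennreal \<Rightarrow> real \<Rightarrow> 'a set" where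
  "besov_space \<psi> p r = {a. besov_norm \<psi> p r a < \<infinity>}"

section \<open>Bandlimited elements\<close>

text \<open>The unbounded operators \<open>\<delta>\<^sub>t\<close> and \<open>\<delta>\<^sup>\<alpha>\<close> are represented by their graphs: \<open>(a, b)\<close> belongs
  to the graph iff \<open>a\<close> lies in the domain and is mapped to \<open>b\<close>. Relational composition \<open>O\<close> and
  power \<open>^^\<close> then give composition of operators on the natural domain.\<close>

definition generator ::
  "(real ^ 'd::finite \<Rightarrow> 'a::complex_banach_algebra \<Rightarrow> 'a) \<Rightarrow> real ^ 'd \<Rightarrow> ('a \<times> 'a) set" where
  "generator \<psi> t = {(a, b). ((\<lambda>h::real. (\<psi> (h *\<^sub>R t) a - a) /\<^sub>R h) \<longlongrightarrow> b) (at 0)}"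

text \<open>The linear order on the index type supplies the numbering of the coordinates. In \<open>\<delta>\<^sup>\<alpha>\<close> the
  operator of the last coordinate is applied first.\<close>

definition multi_generator ::
  "(real ^ 'd::{finite,linorder} \<Rightarrow> 'a::complex_banach_algebra \<Rightarrow> 'a) \<Rightarrow>
     ('d \<Rightarrow> nat) \<Rightarrow> ('a \<times> 'a) set" where
  "multi_generator \<psi> \<alpha> =
     fold (\<lambda>j S. (generator \<psi> (axis j 1) ^^ \<alpha> j) O S) (sorted_list_of_set UNIV) Id"

definition bandlimited ::
  "(real ^ 'd::{finite,linorder} \<Rightarrow> 'a::complex_banach_algebra \<Rightarrow> 'a) \<Rightarrow> real \<Rightarrow> 'a \<Rightarrow> bool" where
  "bandlimited \<psi> \<sigma> a \<longleftrightarrow>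
     (\<exists>C::real. \<forall>\<alpha>. \<exists>b. (a, b) \<in> multi_generator \<psi> \<alpha> \<and>
        norm b \<le> C * (2 * pi * \<sigma>) ^ (\<Sum>j\<in>UNIV. \<alpha> j))"

definition bandlimited_scheme ::
  "(real ^ 'd::{finite,linorder} \<Rightarrow> 'a::complex_banach_algebra \<Rightarrow> 'a) \<Rightarrow> real \<Rightarrow> 'a set" where
  "bandlimited_scheme \<psi> \<sigma> = (if \<sigma> = 0 then {0} else {a. bandlimited \<psi> \<sigma> a})"

section \<open>Approximation spaces\<close>

definition approximation_error ::
  "(real \<Rightarrow> 'a::real_normed_vector set) \<Rightarrow> real \<Rightarrow> 'a \<Rightarrow> real" where
  "approximation_error X \<sigma> a = (INF x\<in>X \<sigma>. norm (a - x))"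

definition approximation_norm ::
  "(real \<Rightarrow> 'a::real_normed_vector set) \<Rightarrow> ennreal \<Rightarrow> real \<Rightarrow> 'a \<Rightarrow> ennreal" where
  "approximation_norm X p r a =
     (let E = (\<lambda>k::nat. approximation_error X (real k) a); q = enn2real p
      in if p = \<infinity> then (SUP k. ennreal (E k * real (k + 1) powr r))
         else ennreal_root q
                (\<Sum>k. ennreal (E k powr q * real (k + 1) powr (r * q) * (1 / real (k + 1)))))"

definition approximation_space ::
  "(real \<Rightarrow> 'a::real_normed_vector set) \<Rightarrow> ennreal \<Rightarrow> real \<Rightarrow> 'a set" where
  "approximation_space X p r = {a. approximation_norm X p r a < \<infinity>}"

definition equivalent_norms_on ::
  "'a set \<Rightarrow> ('a \<Rightarrow> ennreal) \<Rightarrow> ('a \<Rightarrow> ennreal) \<Rightarrow> bool" where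
  "equivalent_norms_on S N N' \<longleftrightarrow>
     (\<exists>c C::real. 0 < c \<and> 0 < C \<and>
        (\<forall>a\<in>S. ennreal c * N a \<le> N' a \<and> N' a \<le> ennreal C * N a))"

end

(* The Jackson estimate E_sigma(a) <= C omega^l_{1/sigma}(a) comes from averaging the translates
   psi_{t e_j} a, one coordinate at a time, against a power of the sinc kernel: its derivatives decay
   uniformly up to geometric factors, so the average is bandlimited, and no Fourier transform of
   vector-valued functions is needed. This requires a continuous orbit, which a vanishing modulus of
   smoothness already enforces because 2^k Delta_t^k = Delta_{2t}^k + O(Delta_t^{k+1}).

   The Bernstein inequality for bandlimited elements is obtained without complex analysis: by Taylor
   expansion the generator delta satisfies h delta = arsinh(S) with S = (psi_h - psi_{-h})/2, where
   powers of S are uniformly bounded on orbits and the Taylor coefficients of arsinh are absolutely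
   summable at 1. Hence omega^l_h is at most C (sigma h)^l on X_sigma.

   Both estimates give the norm equivalence: dyadic telescoping of near-best approximants bounds
   omega^l by a geometric convolution of the errors, which a discrete Hardy inequality controls
   because l > r. *)

theory Submission
  imports Defs
begin

text \<open>The constant in the definition of bandlimitedness depends on the element, so it must not
  survive in Bernstein's inequality. Truncating the arsinh series after \<open>N\<close> terms
  confines it to a remainder of order \<open>2^(-N)\<close>, which disappears as \<open>N\<close>
  grows, while the truncated sum is controlled by the norm of the element alone.

  Orbits may be discontinuous, so averages of translates are formed only for vectors in
  \<open>continuous_vectors\<close>. Finiteness of the Besov norm is what places an element there;
  when the Besov norm is infinite the direct bound is trivial. This is why the direct estimate comes
  with a finiteness assumption and the inverse one does not.

  In several variables the approximant must be bandlimited in all coordinates at once. Each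
  one-dimensional average therefore has to commute with the generators of the other coordinates, and
  the induction over coordinates carries a whole family of candidate derivatives, indexed by
  multi-indices, instead of a single approximant.\<close>

section \<open>The power series of the inverse hyperbolic sine\<close>

text \<open>Taylor coefficients of \<open>1 / sqrt (1 + x\<^sup>2)\<close>, the derivative of \<open>arsinh\<close>.\<close>

fun inv_sqrt_coeff :: "nat \<Rightarrow> real" where
  "inv_sqrt_coeff 0 = 1" | "inv_sqrt_coeff (Suc 0) = 0" | "inv_sqrt_coeff (Suc (Suc n)) = - (real n + 1) / (real n + 2) * inv_sqrt_coeff n"

definition arsinh_fps :: "real fps" where
  "arsinh_fps = fps_integral0 (Abs_fps inv_sqrt_coeff)"
definition sinh_fps :: "real fps" where
  "sinh_fps = fps_const (1/2) * (fps_exp 1 - fps_exp (-1))"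
definition cosh_fps :: "real fps" where
  "cosh_fps = fps_const (1/2) * (fps_exp 1 + fps_exp (-1))"

text \<open>The function \<open>y = (1 + x^2)^(-1/2)\<close> satisfies
  \<open>(1 + x^2) y' = - x y\<close>; coefficient by coefficient this is the two-step recursion of
  \<open>inv_sqrt_coeff\<close>.\<close>

lemma inv_sqrt_coeff_ode: "(1 + fps_X ^ 2) * fps_deriv (Abs_fps inv_sqrt_coeff) = - (fps_X * Abs_fps inv_sqrt_coeff)"
proof (rule fps_ext)
  fix n
  have "fps_nth ((1 + fps_X ^ 2) * fps_deriv (Abs_fps inv_sqrt_coeff)) n =
      real (n + 1) * inv_sqrt_coeff (n + 1) + (if n < 2 then 0 else real (n - 1) * inv_sqrt_coeff (n - 1))"
    unfolding distrib_right fps_add_nth fps_X_power_mult_nth by (auto simp: Suc_diff_Suc numeral_2_eq_2)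
  also have "\<dots> = (if n = 0 then 0 else - inv_sqrt_coeff (n - 1))"
  proof (cases n)
    case (Suc m)
    then show ?thesis
      by (cases m) (simp_all add: field_simps)
  qed simp
  finally show "fps_nth ((1 + fps_X ^ 2) * fps_deriv (Abs_fps inv_sqrt_coeff)) n = fps_nth (- (fps_X * Abs_fps inv_sqrt_coeff)) n"
    by simp
qed

text \<open>By the differential equation the left side has derivative 0, hence equals its constant
  coefficient.\<close>

lemma inv_sqrt_coeff_square: "(1 + fps_X ^ 2) * (Abs_fps inv_sqrt_coeff) ^ 2 = 1"
proof -
  let ?B = "Abs_fps inv_sqrt_coeff"
  have "fps_deriv ((1 + fps_X ^ 2) * ?B ^ 2) = 2 * fps_X * ?B ^ 2 + 2 * ?B * ((1 + fps_X ^ 2) * fps_deriv ?B)"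
    by (simp add: power2_eq_square algebra_simps)
  also have "\<dots> = 0" unfolding inv_sqrt_coeff_ode by (simp add: power2_eq_square algebra_simps)
  finally have "(1 + fps_X ^ 2) * ?B ^ 2 = fps_const (fps_nth ((1 + fps_X ^ 2) * ?B ^ 2) 0)"
    by (simp only: fps_deriv_eq_0_iff)
  also have "\<dots> = 1" by (simp add: power2_eq_square fps_mult_nth)
  finally show ?thesis .
qed

lemma sinh_fps_0 [simp]: "fps_nth sinh_fps 0 = 0" by (simp add: sinh_fps_def)
lemma deriv_sinh_fps: "fps_deriv sinh_fps = cosh_fps"
  by (simp add: sinh_fps_def cosh_fps_def fps_eq_iff)

lemma cosh_fps_square: "cosh_fps ^ 2 = 1 + sinh_fps ^ 2"
proof -
  have e: "fps_exp (1::real) * fps_exp (-1) = 1"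
    by (metis fps_exp_add_mult fps_exp_0 add.right_inverse)
  have c: "fps_const (1/2::real) * fps_const (1/2) * 4 = 1"
    by (simp add: fps_numeral_fps_const)
  have "cosh_fps ^ 2 - sinh_fps ^ 2 = fps_const (1/2) * fps_const (1/2) * 4 * (fps_exp 1 * fps_exp (-1))"
    by (simp add: cosh_fps_def sinh_fps_def power2_eq_square algebra_simps del: fps_const_mult)
  then show ?thesis using e c by (simp del: fps_const_mult add: algebra_simps)
qed

text \<open>The derivative of the composition is \<open>?u\<close>, and \<open>?u ^ 2 = 1\<close>
  because \<open>cosh^2 = 1 + sinh^2\<close>. Power series over the reals form an integral domain,
  so \<open>?u\<close> is 1 or -1, and its constant coefficient decides.\<close>

lemma arsinh_fps_compose_sinh_fps: "fps_compose arsinh_fps sinh_fps = fps_X"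
proof -
  let ?B = "Abs_fps inv_sqrt_coeff"
  let ?u = "fps_compose ?B sinh_fps * cosh_fps"
  have "fps_compose ((1 + fps_X ^ 2) * ?B ^ 2) sinh_fps = (1 + sinh_fps ^ 2) * fps_compose ?B sinh_fps ^ 2"
    by (simp add: fps_compose_mult_distrib fps_compose_add_distrib fps_compose_power[symmetric])
  then have "?u ^ 2 = 1" unfolding inv_sqrt_coeff_square by (simp add: power_mult_distrib cosh_fps_square mult.commute)
  then have "?u = 1 \<or> ?u = -1" by (simp add: power2_eq_1_iff)
  moreover have "fps_nth ?u 0 = 1" by (simp add: cosh_fps_def)
  then have "?u \<noteq> -1" by (metis fps_neg_nth fps_one_nth neg_equal_iff_equal one_neq_neg_one)
  ultimately have "?u = 1" by simp
  then have "fps_deriv (fps_compose arsinh_fps sinh_fps) = fps_deriv fps_X"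
    by (simp add: fps_compose_deriv deriv_sinh_fps arsinh_fps_def fps_deriv_fps_integral)
  then have "fps_compose arsinh_fps sinh_fps = fps_const (fps_nth (fps_compose arsinh_fps sinh_fps) 0 - fps_nth fps_X 0) + fps_X"
    by (simp only: fps_deriv_eq_iff)
  then show ?thesis by (simp add: arsinh_fps_def fps_integral_def)
qed

lemma abs_inv_sqrt_coeff_Suc_Suc: "\<bar>inv_sqrt_coeff (Suc (Suc n))\<bar> = (real n + 1) / (real n + 2) * \<bar>inv_sqrt_coeff n\<bar>"
  by (simp add: abs_mult)

lemma arsinh_fps_nth_Suc: "fps_nth arsinh_fps (Suc n) = inv_sqrt_coeff n / (real n + 1)"
  by (simp add: arsinh_fps_def fps_integral_def field_simps)

text \<open>Absolute summability at the boundary point 1: the terms are dominated by a telescoping sum.\<close>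

lemma sum_abs_arsinh_fps_le: "(\<Sum>i<N. \<bar>fps_nth arsinh_fps i\<bar>) \<le> 2"
proof -
  have t: "\<bar>fps_nth arsinh_fps (Suc n)\<bar> \<le> 2 * (\<bar>inv_sqrt_coeff n\<bar> - \<bar>inv_sqrt_coeff (Suc (Suc n))\<bar>)" for n
  proof -
    have "\<bar>inv_sqrt_coeff n\<bar> - \<bar>inv_sqrt_coeff (Suc (Suc n))\<bar> = \<bar>inv_sqrt_coeff n\<bar> * (1 - (real n + 1) / (real n + 2))"
      unfolding abs_inv_sqrt_coeff_Suc_Suc by (simp add: algebra_simps)
    also have "\<dots> = \<bar>inv_sqrt_coeff n\<bar> / (real n + 2)" by (simp add: field_simps)
    finally have e: "\<bar>inv_sqrt_coeff n\<bar> - \<bar>inv_sqrt_coeff (Suc (Suc n))\<bar> = \<bar>inv_sqrt_coeff n\<bar> / (real n + 2)" .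
    have "\<bar>inv_sqrt_coeff n\<bar> / (real n + 1) \<le> \<bar>inv_sqrt_coeff n\<bar> / ((real n + 2) / 2)"
      by (intro divide_left_mono) auto
    then show ?thesis unfolding e arsinh_fps_nth_Suc by (simp add: mult.commute)
  qed
  \<comment> \<open>The telescoping has step two, so two consecutive coefficients remain at the
    upper end; the lower end contributes \<open>1 + 0\<close>.\<close>
  have "(\<Sum>i<N. \<bar>fps_nth arsinh_fps (Suc i)\<bar>) \<le> 2 * (1 - \<bar>inv_sqrt_coeff N\<bar> - \<bar>inv_sqrt_coeff (Suc N)\<bar>)" for N
  proof (induction N)
    case (Suc N) then show ?case using t[of N] by (simp del: inv_sqrt_coeff.simps(3))
  qed simp
  then have s: "(\<Sum>i<N. \<bar>fps_nth arsinh_fps (Suc i)\<bar>) \<le> 2" for N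
    by (smt (verit) abs_ge_zero)
  show ?thesis
  proof (cases N)
    case (Suc m)
    then show ?thesis using s[of m]
      by (simp add: sum.lessThan_Suc_shift arsinh_fps_def fps_integral_def del: sum.lessThan_Suc)
  qed simp
qed

section \<open>Sign and binomial expansion of powers of sinh\<close>

lemma fps_nonneg_power:
  fixes f :: "real fps"
  assumes "\<And>n. fps_nth f n \<ge> 0" shows "fps_nth (f ^ i) n \<ge> 0"
proof (induction i arbitrary: n)
  case 0 then show ?case by (simp add: fps_one_nth)
next
  case (Suc i) then show ?case by (auto simp: fps_mult_nth intro!: sum_nonneg mult_nonneg_nonneg assms)
qed

text \<open>Powers inherit the sign, so for a series in \<open>sinh ^ i\<close> at a positive point
  the sum of absolute values is the value itself.\<close>

lemma sinh_fps_nonneg: "fps_nth sinh_fps n \<ge> 0"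
  by (cases "even n") (simp_all add: sinh_fps_def)

text \<open>The coefficient of \<open>exp ((i - 2 * k) * v)\<close> in the binomial expansion of
  \<open>sinh v ^ i\<close>. With translates in place of exponentials, the same weights give the
  \<open>i\<close>-th power of the symmetric difference of the group.\<close>

definition sinh_weight :: "nat \<Rightarrow> nat \<Rightarrow> real" where
  "sinh_weight i k = real (i choose k) * (-1) ^ k / 2 ^ i"

text \<open>The factor \<open>2 ^ i\<close> cancels the row sum of the binomial coefficients. This
  is why the powers of the symmetric difference are bounded on an orbit independently of
  \<open>i\<close>.\<close>

lemma sum_abs_sinh_weight: "(\<Sum>k\<le>i. \<bar>sinh_weight i k\<bar>) = 1"
proof -
  have "(\<Sum>k\<le>i. \<bar>sinh_weight i k\<bar>) = (\<Sum>k\<le>i. real (i choose k)) / 2 ^ i"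
    by (simp add: sinh_weight_def abs_mult sum_divide_distrib)
  also have "(\<Sum>k\<le>i. real (i choose k)) = 2 ^ i"
    by (metis choose_row_sum of_nat_numeral of_nat_power of_nat_sum)
  finally show ?thesis by simp
qed

lemma sinh_fps_power: "sinh_fps ^ i = (\<Sum>k\<le>i. fps_const (sinh_weight i k) * fps_exp (real i - 2 * real k))"
proof -
  have e: "fps_exp (a::real) ^ n = fps_exp (real n * a)" for a n
    by (simp add: fps_exp_power_mult mult.commute)
  have "sinh_fps ^ i = fps_const (1/2) ^ i * (- fps_exp (-1) + fps_exp 1) ^ i"
    by (simp add: sinh_fps_def power_mult_distrib)
  also have "(- fps_exp (-1) + fps_exp 1) ^ i = (\<Sum>k\<le>i. of_nat (i choose k) * (- fps_exp (-1)) ^ k * fps_exp (1::real) ^ (i - k))"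
    by (rule binomial_ring)
  also have "fps_const (1/2) ^ i * \<dots> = (\<Sum>k\<le>i. fps_const (sinh_weight i k) * fps_exp (real i - 2 * real k))"
    unfolding sum_distrib_left
  proof (rule sum.cong)
    fix k assume "k \<in> {..i}"
    then have k: "k \<le> i" by simp
    have m: "(- fps_exp (-1::real)) ^ k = fps_const ((-1)^k) * fps_exp (- real k)"
      by (subst power_minus) (simp add: e fps_const_power[symmetric] del: fps_const_power)
    have x: "fps_exp (- real k) * fps_exp (1::real) ^ (i - k) = fps_exp (real i - 2 * real k)"
      using k by (simp add: e fps_exp_add_mult[symmetric] of_nat_diff)
    have c: "fps_const (sinh_weight i k) = fps_const (1/2) ^ i * of_nat (i choose k) * fps_const ((-1)^k)"
      by (simp add: sinh_weight_def fps_of_nat[symmetric] power_divide)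
    show "fps_const (1/2) ^ i * (of_nat (i choose k) * (- fps_exp (-1)) ^ k * fps_exp 1 ^ (i - k)) =
      fps_const (sinh_weight i k) * fps_exp (real i - 2 * real k)"
      unfolding m c x[symmetric] by (simp only: mult_ac)
  qed simp
  finally show ?thesis .
qed

lemma sinh_fps_power_nth:
  "fps_nth (sinh_fps ^ i) n = (\<Sum>k\<le>i. sinh_weight i k * (real i - 2 * real k) ^ n / fact n)"
  unfolding sinh_fps_power by (simp add: fps_sum_nth)

text \<open>At \<open>v = 1/2\<close> this evaluates the series that dominates the truncation error
  in Bernstein's inequality. The expansion into finitely many exponentials gives convergence at
  every \<open>v\<close>.\<close>

lemma sinh_fps_power_sums: "(\<lambda>n. fps_nth (sinh_fps ^ i) n * v ^ n) sums (sinh v ^ i)"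
proof -
  have e: "(\<lambda>n. sinh_weight i k * (real i - 2 * real k) ^ n / fact n * v ^ n) sums (sinh_weight i k * exp ((real i - 2 * real k) * v))" for k
    using sums_mult[OF exp_converges[of "(real i - 2 * real k) * v"], of "sinh_weight i k"]
    by (simp add: power_mult_distrib divide_inverse mult_ac)
  have "(\<lambda>n. fps_nth (sinh_fps ^ i) n * v ^ n) sums (\<Sum>k\<le>i. sinh_weight i k * exp ((real i - 2 * real k) * v))"
    unfolding sinh_fps_power_nth sum_distrib_right by (rule sums_sum) (rule e)
  also have "(\<Sum>k\<le>i. sinh_weight i k * exp ((real i - 2 * real k) * v)) = sinh v ^ i"
  proof -
    have "sinh v ^ i = (- exp (-v) + exp v) ^ i / 2 ^ i"
      by (simp add: sinh_def power_divide)
    also have "\<dots> = (\<Sum>k\<le>i. of_nat (i choose k) * (- exp (-v)) ^ k * exp v ^ (i - k)) / 2 ^ i"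
      by (subst binomial_ring) simp
    also have "\<dots> = (\<Sum>k\<le>i. sinh_weight i k * exp ((real i - 2 * real k) * v))"
      unfolding sum_divide_distrib
    proof (rule sum.cong)
      fix k assume "k \<in> {..i}"
      then have k: "k \<le> i" by simp
      have "(- exp (-v)) ^ k * exp v ^ (i - k) = (-1)^k * (exp (- v) ^ k * exp v ^ (i - k))"
        by (subst power_minus) simp
      also have "exp (- v) ^ k * exp v ^ (i - k) = exp ((real i - 2 * real k) * v)"
        using k by (simp add: exp_of_nat_mult[symmetric] exp_add[symmetric] of_nat_diff algebra_simps)
      finally show "of_nat (i choose k) * (- exp (-v)) ^ k * exp v ^ (i - k) / 2 ^ i = sinh_weight i k * exp ((real i - 2 * real k) * v)"
        by (simp add: sinh_weight_def mult.assoc)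
    qed simp
    finally show ?thesis by simp
  qed
  finally show ?thesis .
qed

section \<open>Kernels of exponential type\<close>

text \<open>The \<open>n\<close>-th derivative of \<open>sin t / t\<close>, which is the integral of
  \<open>cos (t * \<xi>)\<close> over \<open>\<xi>\<close> in \<open>[0, 1]\<close>. The phase
  \<open>n * pi / 2\<close> encodes repeated differentiation of the cosine, and the integral form
  has no singularity at 0.\<close>

definition sinc_family :: "nat \<Rightarrow> real \<Rightarrow> real" where
  "sinc_family n t = integral {0..1} (\<lambda>\<xi>. \<xi> ^ n * cos (t * \<xi> + n * pi / 2))"

lemma sin_quarter: "sin (x + real (Suc n) * pi / 2) = cos (x + real n * pi / 2)"
proof -
  have "x + real (Suc n) * pi / 2 = (x + real n * pi / 2) + pi / 2" by (simp add: field_simps)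
  then show ?thesis by (simp only: sin_add) simp
qed

lemma cos_quarter: "cos (x + real (Suc n) * pi / 2) = - sin (x + real n * pi / 2)"
proof -
  have "x + real (Suc n) * pi / 2 = (x + real n * pi / 2) + pi / 2" by (simp add: field_simps)
  then show ?thesis by (simp only: cos_add) simp
qed

lemma sinc_family_deriv: "(sinc_family n has_real_derivative sinc_family (Suc n) t) (at t)"
proof -
  have "((\<lambda>t. integral (cbox 0 1) (\<lambda>\<xi>. \<xi> ^ n * cos (t * \<xi> + n * pi / 2))) has_field_derivative
    integral (cbox 0 1) (\<lambda>\<xi>. \<xi> ^ n * (- sin (t * \<xi> + n * pi / 2) * \<xi>))) (at t within UNIV)"
  proof (rule leibniz_rule_field_derivative)
    fix x \<xi> :: real
    show "((\<lambda>x. \<xi> ^ n * cos (x * \<xi> + n * pi / 2)) has_field_derivative \<xi> ^ n * (- sin (x * \<xi> + n * pi / 2) * \<xi>)) (at x within UNIV)"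
      by (auto intro!: derivative_eq_intros)
  next
    fix x :: real
    show "(\<lambda>\<xi>. \<xi> ^ n * cos (x * \<xi> + n * pi / 2)) integrable_on cbox 0 1"
      by (intro integrable_continuous continuous_intros)
  next
    show "continuous_on (UNIV \<times> cbox 0 1) (\<lambda>(x, \<xi>). \<xi> ^ n * (- sin (x * \<xi> + real n * pi / 2) * \<xi>))"
      by (auto simp: case_prod_unfold intro!: continuous_intros)
  qed auto
  moreover have "\<xi> ^ Suc n * cos (t * \<xi> + real (Suc n) * pi / 2) = \<xi> ^ n * (- sin (t * \<xi> + n * pi / 2) * \<xi>)" for \<xi>
    unfolding cos_quarter by simp
  ultimately show ?thesis unfolding sinc_family_def[abs_def] by simp
qed

lemma abs_sinc_family_le: "\<bar>sinc_family n t\<bar> \<le> 1"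
proof -
  have "norm (integral {0..1} (\<lambda>\<xi>. \<xi> ^ n * cos (t * \<xi> + n * pi / 2))) \<le> integral {0..1::real} (\<lambda>\<xi>. 1::real)"
  proof (rule integral_norm_bound_integral)
    fix \<xi> :: real assume x: "\<xi> \<in> {0..1}"
    have "\<bar>\<xi> ^ n\<bar> * \<bar>cos (t * \<xi> + n * pi / 2)\<bar> \<le> 1 * 1"
      using x by (intro mult_mono) (auto simp: power_le_one)
    then show "norm (\<xi> ^ n * cos (t * \<xi> + n * pi / 2)) \<le> 1" by (simp add: abs_mult)
  qed (auto intro!: integrable_continuous_real continuous_intros)
  then show ?thesis by (simp add: sinc_family_def)
qed

text \<open>Integration by parts: the integrand is the derivative of
  \<open>\<xi>^(n+1) * sin (...)\<close>, whose value at \<open>\<xi> = 0\<close> vanishes. It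
  trades a factor \<open>t\<close> for a factor \<open>n + 1\<close>, the source of the decay at
  infinity.\<close>

lemma sinc_family_recurrence: "t * sinc_family (Suc n) t + real (Suc n) * sinc_family n t = sin (t + real (Suc n) * pi / 2)"
proof -
  let ?F = "\<lambda>\<xi>. \<xi> ^ Suc n * sin (t * \<xi> + real (Suc n) * pi / 2)"
  have "((\<lambda>\<xi>. t * (\<xi> ^ Suc n * cos (t * \<xi> + real (Suc n) * pi / 2)) + real (Suc n) * (\<xi> ^ n * cos (t * \<xi> + n * pi / 2))) has_integral ?F 1 - ?F 0) {0..1}"
  proof (rule fundamental_theorem_of_calculus)
    fix \<xi> :: real
    have s: "real (Suc n) * (\<xi> ^ n * cos (t * \<xi> + n * pi / 2)) = real (Suc n) * \<xi> ^ n * sin (t * \<xi> + real (Suc n) * pi / 2)"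
      unfolding sin_quarter by simp
    show "(?F has_vector_derivative (t * (\<xi> ^ Suc n * cos (t * \<xi> + real (Suc n) * pi / 2)) + real (Suc n) * (\<xi> ^ n * cos (t * \<xi> + n * pi / 2)))) (at \<xi> within {0..1})"
        unfolding s has_real_derivative_iff_has_vector_derivative[symmetric]
      by (rule derivative_eq_intros refl | simp)+
  qed simp
  then have "integral {0..1} (\<lambda>\<xi>. t * (\<xi> ^ Suc n * cos (t * \<xi> + real (Suc n) * pi / 2)) + real (Suc n) * (\<xi> ^ n * cos (t * \<xi> + n * pi / 2))) = sin (t + real (Suc n) * pi / 2)"
    by (simp add: integral_unique)
  moreover have "integral {0..1} (\<lambda>\<xi>. t * (\<xi> ^ Suc n * cos (t * \<xi> + real (Suc n) * pi / 2)) + real (Suc n) * (\<xi> ^ n * cos (t * \<xi> + n * pi / 2))) = t * sinc_family (Suc n) t + real (Suc n) * sinc_family n t"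
    unfolding sinc_family_def
    by (subst integral_add) (auto intro!: integrable_continuous_real continuous_intros simp del: power_Suc of_nat_Suc)
  ultimately show ?thesis by simp
qed

lemma sinc_family_0: "t * sinc_family 0 t = sin t"
proof -
  have "((\<lambda>\<xi>. t * cos (t * \<xi>)) has_integral sin (t * 1) - sin (t * 0)) {0..1}"
    by (rule fundamental_theorem_of_calculus)
      (auto simp: has_real_derivative_iff_has_vector_derivative[symmetric] intro!: derivative_eq_intros)
  then show ?thesis by (simp add: sinc_family_def integral_unique flip: integral_mult_right)
qed

text \<open>The recurrence bounds \<open>\<bar>t * sinc_family n t\<bar>\<close> by
  \<open>1 + n\<close>. The linear growth is absorbed into \<open>2 ^ n\<close>, since
  bandlimitedness asks for bounds geometric in the order of differentiation.\<close>

lemma sinc_family_decay: "\<bar>sinc_family n t\<bar> \<le> 2 * 2 ^ n * inverse (1 + \<bar>t\<bar>)"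
proof -
  have "\<bar>t * sinc_family n t\<bar> \<le> 1 + real n"
  proof (cases n)
    case (Suc m)
    have "\<bar>t * sinc_family (Suc m) t\<bar> = \<bar>sin (t + real (Suc m) * pi / 2) - real (Suc m) * sinc_family m t\<bar>"
      by (simp only: sinc_family_recurrence[symmetric] add_diff_cancel_right')
    also have "\<dots> \<le> \<bar>sin (t + real (Suc m) * pi / 2)\<bar> + real (Suc m) * \<bar>sinc_family m t\<bar>"
      by (metis abs_mult abs_of_nat abs_triangle_ineq4)
    also have "\<dots> \<le> 1 + real (Suc m) * 1"
      by (intro add_mono mult_left_mono abs_sinc_family_le) auto
    finally show ?thesis using Suc by simp
  qed (simp add: sinc_family_0)
  then have "\<bar>sinc_family n t\<bar> * (1 + \<bar>t\<bar>) \<le> 2 + real n"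
    using abs_sinc_family_le[of n t] by (simp add: abs_mult algebra_simps)
  also have "2 + real n \<le> 2 * 2 ^ n"
    by (induction n) auto
  finally show ?thesis by (simp add: field_simps)
qed

text \<open>\<open>f\<close> lists a function together with all its derivatives. The geometric
  growth in \<open>n\<close> is a real-variable substitute for exponential type
  \<open>\<tau>\<close>; \<open>m\<close> is the order of polynomial decay.\<close>

definition kernel_class :: "real \<Rightarrow> real \<Rightarrow> nat \<Rightarrow> (nat \<Rightarrow> real \<Rightarrow> real) \<Rightarrow> bool" where
  "kernel_class C \<tau> m f \<longleftrightarrow> (\<forall>n t. (f n has_real_derivative f (Suc n) t) (at t)) \<and>
     (\<forall>n t. \<bar>f n t\<bar> \<le> C * \<tau> ^ n * inverse (1 + \<bar>t\<bar>) ^ m)"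

lemma kernel_class_sinc: "kernel_class 2 2 1 sinc_family"
  by (simp add: kernel_class_def sinc_family_deriv sinc_family_decay)

definition leibniz :: "(nat \<Rightarrow> real \<Rightarrow> real) \<Rightarrow> (nat \<Rightarrow> real \<Rightarrow> real) \<Rightarrow> nat \<Rightarrow> real \<Rightarrow> real" where
  "leibniz f g n t = (\<Sum>i\<le>n. real (n choose i) * f i t * g (n - i) t)"

lemma leibniz_Suc: "leibniz f g (Suc n) t = leibniz (\<lambda>i. f (Suc i)) g n t + leibniz f (\<lambda>i. g (Suc i)) n t"
proof -
  have "(\<Sum>i\<le>Suc n. real (n choose i) * f i t * g (Suc n - i) t) = (\<Sum>i\<le>n. real (n choose i) * f i t * g (Suc (n - i)) t)"
    by (simp add: Suc_diff_le)
  moreover have "(\<Sum>i\<le>Suc n. real (n choose i) * f i t * g (Suc n - i) t) =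
     f 0 t * g (Suc n) t + (\<Sum>i\<le>n. real (n choose Suc i) * f (Suc i) t * g (n - i) t)"
    by (subst sum.atMost_Suc_shift) simp
  ultimately show ?thesis
    unfolding leibniz_def by (subst sum.atMost_Suc_shift) (simp add: algebra_simps sum.distrib)
qed

lemma leibniz_deriv:
  assumes "\<And>n t. (f n has_real_derivative f (Suc n) t) (at t)" "\<And>n t. (g n has_real_derivative g (Suc n) t) (at t)"
  shows "(leibniz f g n has_real_derivative leibniz f g (Suc n) t) (at t)"
proof -
  have "((\<lambda>t. \<Sum>i\<le>n. real (n choose i) * f i t * g (n - i) t) has_real_derivative
     (\<Sum>i\<le>n. real (n choose i) * f (Suc i) t * g (n - i) t + real (n choose i) * f i t * g (Suc (n - i)) t)) (at t)"
    by (auto intro!: derivative_eq_intros assms simp: algebra_simps)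
  then show ?thesis
    unfolding leibniz_Suc by (simp add: leibniz_def[abs_def] sum.distrib)
qed

text \<open>The binomial theorem adds up the types while the decay orders add as well: multiplying
  kernels buys decay at the price of a larger, still finite type.\<close>

lemma kernel_class_leibniz:
  assumes f: "kernel_class C \<tau> m f" and g: "kernel_class C' \<tau>' m' g"
  shows "kernel_class (C * C') (\<tau> + \<tau>') (m + m') (leibniz f g)"
  unfolding kernel_class_def
proof (intro conjI allI)
  fix n t
  show "(leibniz f g n has_real_derivative leibniz f g (Suc n) t) (at t)"
    using f g by (intro leibniz_deriv) (auto simp: kernel_class_def)
  let ?w = "inverse (1 + \<bar>t\<bar>)"
  have "\<bar>leibniz f g n t\<bar> \<le> (\<Sum>i\<le>n. real (n choose i) * \<bar>f i t\<bar> * \<bar>g (n - i) t\<bar>)"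
    unfolding leibniz_def by (rule order_trans[OF sum_abs]) (simp add: abs_mult)
  also have "\<dots> \<le> (\<Sum>i\<le>n. real (n choose i) * (C * \<tau> ^ i * ?w ^ m) * (C' * \<tau>' ^ (n - i) * ?w ^ m'))"
  proof (intro sum_mono mult_mono)
    fix i
    show a: "\<bar>f i t\<bar> \<le> C * \<tau> ^ i * ?w ^ m" and "\<bar>g (n - i) t\<bar> \<le> C' * \<tau>' ^ (n - i) * ?w ^ m'"
      using f g by (auto simp: kernel_class_def)
    show "0 \<le> real (n choose i) * (C * \<tau> ^ i * ?w ^ m)"
      using order_trans[OF abs_ge_zero a] by simp
  qed auto
  also have "\<dots> = C * C' * (\<tau> + \<tau>') ^ n * ?w ^ (m + m')"
    by (simp add: binomial_ring sum_distrib_left sum_distrib_right power_add mult_ac)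
  finally show "\<bar>leibniz f g n t\<bar> \<le> C * C' * (\<tau> + \<tau>') ^ n * ?w ^ (m + m')" .
qed

section \<open>Integrability and normalisation of kernels\<close>

lemma integrable_inverse_one_plus_square: "(\<lambda>t::real. inverse (1 + t\<^sup>2)) integrable_on UNIV"
proof -
  let ?f = "\<lambda>k t::real. if t \<in> {- real k..real k} then inverse (1 + t\<^sup>2) else 0"
  have i: "((\<lambda>t. inverse (1 + t\<^sup>2)) has_integral (2 * arctan k)) {- real k..real k}" for k :: nat
  proof -
    have "((\<lambda>t. inverse (1 + t\<^sup>2)) has_integral (arctan (real k) - arctan (- real k))) {- real k..real k}"
      by (rule fundamental_theorem_of_calculus)
        (auto simp: has_real_derivative_iff_has_vector_derivative[symmetric] intro!: derivative_eq_intros)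
    then show ?thesis by (simp add: arctan_minus)
  qed
  have u: "(?f k has_integral (2 * arctan k)) UNIV" for k
    using i[of k] by (subst has_integral_restrict_UNIV)
  have "(\<lambda>t::real. inverse (1 + t\<^sup>2)) integrable_on UNIV \<and> (\<lambda>k. integral UNIV (?f k)) \<longlonglongrightarrow> integral UNIV (\<lambda>t::real. inverse (1 + t\<^sup>2))"
  proof (rule monotone_convergence_increasing)
    show "?f k integrable_on UNIV" for k using u by blast
    show "?f k t \<le> ?f (Suc k) t" for k t by (auto intro: add_nonneg_nonneg)
    show "(\<lambda>k. ?f k t) \<longlonglongrightarrow> inverse (1 + t\<^sup>2)" for t
    proof (rule tendsto_eventually)
      obtain N :: nat where "\<bar>t\<bar> \<le> real N" using real_arch_simple by blast
      then show "\<forall>\<^sub>F k in sequentially. ?f k t = inverse (1 + t\<^sup>2)"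
        unfolding eventually_sequentially by (intro exI[of _ N]) auto
    qed
    show "bounded (range (\<lambda>k. integral UNIV (?f k)))"
      unfolding bounded_iff
    proof (intro exI[of _ pi] ballI)
      fix x assume "x \<in> range (\<lambda>k. integral UNIV (?f k))"
      then obtain k :: nat where "x = 2 * arctan k" using integral_unique[OF u] by auto
      then show "norm x \<le> pi" using arctan_bounded[of k] by auto
    qed
  qed
  then show ?thesis by simp
qed

text \<open>Two powers of decay are spent on integrability over the line; the other \<open>m\<close>
  pay for the growth \<open>(1 + \<bar>t\<bar>) ^ m\<close> caused by dilating a modulus of
  smoothness.\<close>

lemma kernel_class_integrable:
  assumes "kernel_class C \<tau> (m + 2) f"
  shows "(\<lambda>t. (1 + \<bar>t\<bar>) ^ m * \<bar>f n t\<bar>) integrable_on UNIV"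
    and "(\<lambda>t::real. inverse (1 + \<bar>t\<bar>) ^ (m + 2)) integrable_on UNIV"
proof -
  have w: "inverse (1 + \<bar>t\<bar>) ^ (m + 2) \<le> inverse (1 + t\<^sup>2)" "(1 + \<bar>t\<bar>) ^ m * inverse (1 + \<bar>t\<bar>) ^ (m + 2) \<le> inverse (1 + t\<^sup>2)" for t :: real
  proof -
    have "1 + t\<^sup>2 \<le> (1 + \<bar>t\<bar>)\<^sup>2" by (simp add: power2_eq_square algebra_simps)
    then have sq: "inverse (1 + \<bar>t\<bar>) ^ 2 \<le> inverse (1 + t\<^sup>2)"
      by (simp add: power_inverse add_pos_nonneg le_imp_inverse_le)
    have "inverse (1 + \<bar>t\<bar>) ^ (m + 2) \<le> inverse (1 + \<bar>t\<bar>) ^ 2"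
      by (intro power_decreasing) (auto simp: inverse_le_1_iff)
    then show "inverse (1 + \<bar>t\<bar>) ^ (m + 2) \<le> inverse (1 + t\<^sup>2)" using sq by linarith
    have "(1 + \<bar>t\<bar>) ^ m * inverse (1 + \<bar>t\<bar>) ^ m = 1"
      by (simp add: power_mult_distrib[symmetric])
    then have "(1 + \<bar>t\<bar>) ^ m * inverse (1 + \<bar>t\<bar>) ^ (m + 2) = inverse (1 + \<bar>t\<bar>) ^ 2"
      unfolding power_add by (metis mult.assoc mult_1)
    then show "(1 + \<bar>t\<bar>) ^ m * inverse (1 + \<bar>t\<bar>) ^ (m + 2) \<le> inverse (1 + t\<^sup>2)" using sq by linarith
  qed
  have cont: "continuous_on S (f n)" for S
    using assms by (intro DERIV_continuous_on[of S "f n" "f (Suc n)"]) (auto simp: kernel_class_def intro: has_field_derivative_at_within)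
  have "0 \<le> \<bar>f n 0\<bar>" by simp
  also have "\<bar>f n 0\<bar> \<le> C * \<tau> ^ n" using conjunct2[OF assms(1)[unfolded kernel_class_def], rule_format, of n 0] by simp
  finally have Ct: "0 \<le> C * \<tau> ^ n" .
  show "(\<lambda>t::real. inverse (1 + \<bar>t\<bar>) ^ (m + 2)) integrable_on UNIV"
  proof (rule integrable_on_all_intervals_UNIV[OF _ _ integrable_inverse_one_plus_square])
    show "(\<lambda>t::real. inverse (1 + \<bar>t\<bar>) ^ (m + 2)) integrable_on cbox a b" for a b
      by (intro integrable_continuous continuous_intros) auto
    show "norm (inverse (1 + \<bar>t\<bar>) ^ (m + 2)) \<le> inverse (1 + t\<^sup>2)" for t :: real
      using w(1)[of t] by simp
  qed
  show "(\<lambda>t. (1 + \<bar>t\<bar>) ^ m * \<bar>f n t\<bar>) integrable_on UNIV"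
  proof (rule integrable_on_all_intervals_UNIV)
    show "(\<lambda>t. (1 + \<bar>t\<bar>) ^ m * \<bar>f n t\<bar>) integrable_on cbox a b" for a b
      by (intro integrable_continuous continuous_intros cont)
    show "norm ((1 + \<bar>t\<bar>) ^ m * \<bar>f n t\<bar>) \<le> C * \<tau> ^ n * inverse (1 + t\<^sup>2)" for t
    proof -
      have "(1 + \<bar>t\<bar>) ^ m * \<bar>f n t\<bar> \<le> (1 + \<bar>t\<bar>) ^ m * (C * \<tau> ^ n * inverse (1 + \<bar>t\<bar>) ^ (m + 2))"
        using assms by (intro mult_left_mono) (auto simp: kernel_class_def)
      also have "\<dots> = C * \<tau> ^ n * ((1 + \<bar>t\<bar>) ^ m * inverse (1 + \<bar>t\<bar>) ^ (m + 2))" by (simp only: mult_ac)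
      also have "\<dots> \<le> C * \<tau> ^ n * inverse (1 + t\<^sup>2)" by (intro mult_left_mono w Ct)
      finally show ?thesis by simp
    qed
    show "(\<lambda>t. C * \<tau> ^ n * inverse (1 + t\<^sup>2)) integrable_on UNIV"
      using integrable_on_cmult_left[OF integrable_inverse_one_plus_square] by simp
  qed
qed

lemma kernel_class_mono:
  assumes "kernel_class C \<tau> m f" "m' \<le> m"
  shows "kernel_class C \<tau> m' f"
  unfolding kernel_class_def
proof (intro conjI allI)
  fix n t
  show "(f n has_real_derivative f (Suc n) t) (at t)" using assms by (simp add: kernel_class_def)
  have "0 \<le> \<bar>f n 0\<bar>" by simp
  also have "\<bar>f n 0\<bar> \<le> C * \<tau> ^ n" using conjunct2[OF assms(1)[unfolded kernel_class_def], rule_format, of n 0] by simp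
  finally have Ct: "0 \<le> C * \<tau> ^ n" .
  have "\<bar>f n t\<bar> \<le> C * \<tau> ^ n * inverse (1 + \<bar>t\<bar>) ^ m" using assms by (simp add: kernel_class_def)
  also have "\<dots> \<le> C * \<tau> ^ n * inverse (1 + \<bar>t\<bar>) ^ m'"
    using Ct assms(2) by (intro mult_left_mono power_decreasing) (auto simp: inverse_le_1_iff)
  finally show "\<bar>f n t\<bar> \<le> C * \<tau> ^ n * inverse (1 + \<bar>t\<bar>) ^ m'" .
qed

lemma kernel_class_cmult:
  assumes "kernel_class C \<tau> m f" "c \<ge> 0"
  shows "kernel_class (c * C) \<tau> m (\<lambda>n t. c * f n t)"
  unfolding kernel_class_def
proof (intro conjI allI)
  fix n t
  show "((\<lambda>t. c * f n t) has_real_derivative c * f (Suc n) t) (at t)"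
    using assms by (intro DERIV_cmult) (simp add: kernel_class_def)
  show "\<bar>c * f n t\<bar> \<le> c * C * \<tau> ^ n * inverse (1 + \<bar>t\<bar>) ^ m"
    using assms mult_left_mono[of "\<bar>f n t\<bar>" "C * \<tau> ^ n * inverse (1 + \<bar>t\<bar>) ^ m" c]
    by (simp add: kernel_class_def abs_mult mult.assoc)
qed

text \<open>A lower bound near the origin keeps the integral of the kernel away from 0, so that it
  can be normalised.\<close>

lemma sinc_family_0_ge:
  assumes "\<bar>t\<bar> \<le> 1" shows "sinc_family 0 t \<ge> 1 / 2"
proof -
  have "integral {0..1::real} (\<lambda>\<xi>. 1/2) \<le> integral {0..1} (\<lambda>\<xi>. cos (t * \<xi>))"
  proof (rule integral_le)
    fix \<xi> :: real assume x: "\<xi> \<in> {0..1}"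
    have "\<bar>t * \<xi>\<bar> \<le> 1" using x assms by (simp add: abs_mult mult_le_one)
    also have "1 \<le> pi / 3" using pi_gt3 by simp
    finally have "cos (pi / 3) \<le> cos \<bar>t * \<xi>\<bar>"
      using pi_gt_zero by (intro cos_monotone_0_pi_le) auto
    then show "1 / 2 \<le> cos (t * \<xi>)" by (simp add: cos_60)
  qed (auto intro!: integrable_continuous_real continuous_intros)
  then show ?thesis by (simp add: sinc_family_def)
qed

text \<open>A high power of the sinc function has the required decay, and its derivatives form a
  kernel class by repeated use of the Leibniz rule. Dividing by the integral preserves the
  class.\<close>

lemma kernel_exists:
  obtains C \<tau> f where "C \<ge> 0" "\<tau> > 0" "kernel_class C \<tau> (m + 2) f" "integral UNIV (f 0) = 1"
proof -
  have "\<exists>C\<ge>0. \<exists>\<tau>>0. \<exists>f. kernel_class C \<tau> (Suc N) f \<and> f 0 = (\<lambda>t. sinc_family 0 t ^ Suc N)" for N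
  proof (induction N)
    case 0
    show ?case using kernel_class_sinc
      by (intro exI[of _ 2] conjI exI[of _ sinc_family]) auto
  next
    case (Suc N)
    then obtain C \<tau> f where *: "C \<ge> 0" "\<tau> > 0" "kernel_class C \<tau> (Suc N) f" "f 0 = (\<lambda>t. sinc_family 0 t ^ Suc N)"
      by blast
    have "kernel_class (2 * C) (2 + \<tau>) (1 + Suc N) (leibniz sinc_family f)"
      by (rule kernel_class_leibniz[OF kernel_class_sinc *(3)])
    moreover have "leibniz sinc_family f 0 = (\<lambda>t. sinc_family 0 t ^ Suc (Suc N))"
      using * by (auto simp: leibniz_def)
    moreover have "2 * C \<ge> 0" "2 + \<tau> > 0" using * by auto
    ultimately show ?case by (metis plus_1_eq_Suc)
  qed
  \<comment> \<open>The resulting exponent \<open>2 * m + 4\<close> is even, which makes the kernel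
    nonnegative, and it is at least the required \<open>m + 2\<close>.\<close>
  from this[of "2 * m + 3"] obtain C \<tau> f where *: "C \<ge> 0" "\<tau> > 0" "kernel_class C \<tau> (Suc (2 * m + 3)) f" "f 0 = (\<lambda>t. sinc_family 0 t ^ Suc (2 * m + 3))"
    by blast
  have k: "kernel_class C \<tau> (m + 2) f" by (rule kernel_class_mono[OF *(3)]) simp
  have pos: "f 0 t \<ge> 0" for t unfolding * by (simp add: zero_le_even_power)
  have k0: "kernel_class C \<tau> (0 + 2) f" by (rule kernel_class_mono[OF *(3)]) simp
  have int: "f 0 integrable_on UNIV"
    using kernel_class_integrable(1)[OF k0, of 0] pos by simp
  define I where "I = integral UNIV (f 0)"
  have "0 < integral {-1..1::real} (\<lambda>t. (1/2) ^ Suc (2 * m + 3) :: real)" by simp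
  also have "\<dots> \<le> integral {-1..1} (f 0)"
  proof (rule integral_le)
    show "f 0 integrable_on {-1..1}" by (rule integrable_on_subinterval[OF int]) auto
    show "(1/2) ^ Suc (2 * m + 3) \<le> f 0 t" if "t \<in> {-1..1}" for t
      unfolding *(4) using that by (intro power_mono sinc_family_0_ge) auto
  qed (auto intro!: integrable_continuous_real continuous_intros)
  also have "\<dots> \<le> I" unfolding I_def
    by (rule integral_subset_le) (auto intro: integrable_on_subinterval[OF int] int pos)
  finally have I: "I > 0" .
  show thesis
  proof (rule that[of "inverse I * C" \<tau> "\<lambda>n t. inverse I * f n t"])
    show "kernel_class (inverse I * C) \<tau> (m + 2) (\<lambda>n t. inverse I * f n t)"
      using I by (intro kernel_class_cmult k) auto
    show "integral UNIV (\<lambda>t. inverse I * f 0 t) = 1" using I by (simp add: I_def)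
  qed (use I * in auto)
qed

section \<open>Tools for translating and differentiating a kernel\<close>

lemma integral_translate_UNIV:
  fixes f :: "real \<Rightarrow> 'a::banach"
  assumes "f integrable_on UNIV"
  shows "(\<lambda>t. f (t + c)) integrable_on UNIV" "integral UNIV (\<lambda>t. f (t + c)) = integral UNIV f"
proof -
  have "((\<lambda>t. f (t + c)) has_integral (integral UNIV f)) UNIV"
    unfolding has_integral'[of _ _ UNIV]
  proof (intro allI impI)
    fix e :: real assume "e > 0"
    then obtain B where B: "B > 0" "\<And>a b. ball 0 B \<subseteq> cbox a b \<Longrightarrow> \<exists>z. ((\<lambda>x. if x \<in> UNIV then f x else 0) has_integral z) (cbox a b) \<and> norm (z - integral UNIV f) < e"
      using integrable_integral[OF assms] unfolding has_integral'[of f _ UNIV] by meson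
    show "\<exists>B>0. \<forall>a b. ball 0 B \<subseteq> cbox a b \<longrightarrow> (\<exists>z. ((\<lambda>x. if x \<in> UNIV then f (x + c) else 0) has_integral z) (cbox a b) \<and> norm (z - integral UNIV f) < e)"
    \<comment> \<open>An interval containing the ball of radius \<open>B + \<bar>c\<bar>\<close>
      still contains the ball of radius \<open>B\<close> after a shift by \<open>c\<close>.\<close>
    proof (intro exI[of _ "B + \<bar>c\<bar>"] conjI allI impI)
      fix a b :: real assume sub: "ball 0 (B + \<bar>c\<bar>) \<subseteq> cbox a b"
      have "ball (0::real) B \<subseteq> cbox (a + c) (b + c)"
      proof
        fix x :: real assume "x \<in> ball 0 B"
        then have "x - c \<in> ball 0 (B + \<bar>c\<bar>)" by (auto simp: dist_norm)
        then have "x - c \<in> cbox a b" using sub by blast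
        then show "x \<in> cbox (a + c) (b + c)" by auto
      qed
      from B(2)[OF this] obtain z where "(f has_integral z) (cbox (a + c) (b + c))" "norm (z - integral UNIV f) < e"
        by auto
      then show "\<exists>z. ((\<lambda>x. if x \<in> UNIV then f (x + c) else 0) has_integral z) (cbox a b) \<and> norm (z - integral UNIV f) < e"
        using has_integral_shift_cbox[of f z "a + c" "b + c" c] by auto
    qed (use B in auto)
  qed
  then show "(\<lambda>t. f (t + c)) integrable_on UNIV" "integral UNIV (\<lambda>t. f (t + c)) = integral UNIV f"
    by (auto simp: integrable_on_def integral_unique)
qed

text \<open>A shift by at most 1 changes \<open>1 + \<bar>t\<bar>\<close> by a factor of at most 2.
  The weight thus dominates the kernel derivatives at all points near \<open>t\<close>.\<close>

lemma inverse_weight_translate: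
  fixes t u :: real
  assumes "\<bar>u\<bar> \<le> 1"
  shows "inverse (1 + \<bar>t + u\<bar>) ^ m \<le> 2 ^ m * inverse (1 + \<bar>t\<bar>) ^ m"
proof -
  have "inverse (1 + \<bar>t + u\<bar>) \<le> inverse ((1 + \<bar>t\<bar>) / 2)"
    using assms by (intro le_imp_inverse_le) (auto simp: abs_if split: if_splits)
  then have "inverse (1 + \<bar>t + u\<bar>) \<le> 2 * inverse (1 + \<bar>t\<bar>)" by (simp add: field_simps)
  then have "inverse (1 + \<bar>t + u\<bar>) ^ m \<le> (2 * inverse (1 + \<bar>t\<bar>)) ^ m" by (intro power_mono) auto
  then show ?thesis by (simp add: power_mult_distrib)
qed

text \<open>The mean value inequality is applied twice. The explicit bound gives a rate of
  convergence for difference quotients of the kernel, so differentiation under the vector-valued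
  integral reduces to a norm estimate.\<close>

lemma second_order_remainder:
  fixes f f' f'' :: "real \<Rightarrow> real"
  assumes "\<And>t. (f has_real_derivative f' t) (at t)" "\<And>t. (f' has_real_derivative f'' t) (at t)"
    and B: "\<And>u. \<bar>u\<bar> \<le> \<bar>s\<bar> \<Longrightarrow> \<bar>f'' (t + u)\<bar> \<le> B"
  shows "\<bar>f (t + s) - f t - s * f' t\<bar> \<le> s\<^sup>2 * B"
proof -
  have B0: "0 \<le> B" using B[of 0] by simp
  have 1: "\<bar>f' (t + u) - f' t\<bar> \<le> B * \<bar>s\<bar>" if "\<bar>u\<bar> \<le> \<bar>s\<bar>" for u
  proof -
    have "norm (f' (t + u) - f' t) \<le> B * norm (t + u - t)"
    proof (rule field_differentiable_bound[of "{t - \<bar>s\<bar>..t + \<bar>s\<bar>}" f' f''])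
      show "norm (f'' z) \<le> B" if "z \<in> {t - \<bar>s\<bar>..t + \<bar>s\<bar>}" for z
        using B[of "z - t"] that by (auto simp: abs_le_iff)
    qed (use that in \<open>auto intro: assms has_field_derivative_at_within\<close>)
    also have "\<dots> \<le> B * \<bar>s\<bar>" using that B0 by (intro mult_left_mono) auto
    finally show ?thesis by simp
  qed
  have "norm ((f (t + s) - (t + s) * f' t) - (f t - t * f' t)) \<le> (B * \<bar>s\<bar>) * norm (t + s - t)"
  proof (rule field_differentiable_bound[of "{t - \<bar>s\<bar>..t + \<bar>s\<bar>}" "\<lambda>x. f x - x * f' t" "\<lambda>x. f' x - f' t"])
    show "((\<lambda>x. f x - x * f' t) has_field_derivative f' z - f' t) (at z within {t - \<bar>s\<bar>..t + \<bar>s\<bar>})" for z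
      using DERIV_diff[OF has_field_derivative_at_within[OF assms(1)[of z]] DERIV_cmult_right[OF DERIV_ident, of "f' t"]] by simp
    show "norm (f' z - f' t) \<le> B * \<bar>s\<bar>" if "z \<in> {t - \<bar>s\<bar>..t + \<bar>s\<bar>}" for z
      using 1[of "z - t"] that by (auto simp: abs_le_iff)
  qed auto
  then show ?thesis by (simp add: algebra_simps power2_eq_square abs_mult_self_eq)
qed

section \<open>Sums and integrals of weighted power type\<close>

text \<open>Convexity of the \<open>q\<close>-th power with weights \<open>\<theta>\<close> and
  \<open>1 - \<theta>\<close>, after writing \<open>y = (1 - \<theta>) * ?z\<close>. If one of the
  points is 0, the inequality \<open>c powr q \<le> c\<close> on \<open>[0, 1]\<close> takes the
  place of convexity.\<close>

lemma powr_convex_combination: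
  fixes x y q \<theta> :: real
  assumes "1 \<le> q" "0 \<le> x" "0 \<le> y" "0 < \<theta>" "\<theta> < 1"
  shows "(\<theta> * x + y) powr q \<le> \<theta> * x powr q + (1 - \<theta>) powr (1 - q) * y powr q"
proof -
  let ?z = "y / (1 - \<theta>)"
  have z: "(1 - \<theta>) * ?z powr q = (1 - \<theta>) powr (1 - q) * y powr q"
    using assms by (simp add: powr_divide powr_diff)
  have "(\<theta> * x + (1 - \<theta>) * ?z) powr q \<le> \<theta> * x powr q + (1 - \<theta>) * ?z powr q"
  proof (cases "x = 0 \<or> y = 0")
    case False
    then show ?thesis
      using convex_onD[OF powr_convex[OF assms(1)], of "1 - \<theta>" x ?z] assms by simp
  next
    case True
    have le: "c powr q \<le> c" if "0 \<le> c" "c \<le> 1" for c :: real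
      using assms(1) that powr_mono'[of 1 q c] by (cases "c = 0") auto
    show ?thesis
    proof (cases "x = 0")
      case True
      have "((1 - \<theta>) * ?z) powr q = (1 - \<theta>) powr q * ?z powr q" by (rule powr_mult)
      also have "\<dots> \<le> (1 - \<theta>) * ?z powr q" using assms by (intro mult_right_mono le) auto
      finally show ?thesis using True by simp
    next
      case False
      then have y: "y = 0" using True by simp
      have "(\<theta> * x) powr q = \<theta> powr q * x powr q" by (rule powr_mult)
      also have "\<dots> \<le> \<theta> * x powr q" using assms by (intro mult_right_mono le) auto
      finally show ?thesis using y by simp
    qed
  qed
  then show ?thesis using assms unfolding z by simp
qed

text \<open>A discrete Hardy inequality: summing the convexity estimate of the recursion
  \<open>A\<^sub>n\<^sub>+\<^sub>1 = \<theta> A\<^sub>n + B\<^sub>n\<^sub>+\<^sub>1\<close> absorbs the \<open>A\<close>-sum on the right, so no Hoelder is needed.\<close>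

lemma hardy_geometric:
  fixes B :: "nat \<Rightarrow> real"
  assumes q: "1 \<le> q" and \<theta>: "0 < \<theta>" "\<theta> < 1" and B: "\<And>n. 0 \<le> B n"
  shows "(\<Sum>n<N. (\<Sum>i\<le>n. \<theta> ^ (n - i) * B i) powr q) \<le>
    (1 - \<theta>) powr (1 - q) / (1 - \<theta>) * (\<Sum>n<N. B n powr q)"
proof -
  define A where "A n = (\<Sum>i\<le>n. \<theta> ^ (n - i) * B i)" for n
  define \<kappa> where "\<kappa> = (1 - \<theta>) powr (1 - q)"
  have A0: "A n \<ge> 0" for n unfolding A_def using \<theta> B by (intro sum_nonneg) auto
  have A_Suc: "A (Suc n) = \<theta> * A n + B (Suc n)" for n
    unfolding A_def by (simp add: sum_distrib_left Suc_diff_le mult.assoc)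
  have \<kappa>: "\<kappa> \<ge> 1"
  proof -
    have "(1 - \<theta>) powr 0 \<le> (1 - \<theta>) powr (1 - q)" using \<theta> q by (intro powr_mono') auto
    then show ?thesis using \<theta> by (simp add: \<kappa>_def)
  qed
  have step: "(\<Sum>n<Suc N. A n powr q) \<le> \<kappa> * (\<Sum>n<Suc N. B n powr q) + \<theta> * (\<Sum>n<N. A n powr q)" for N
  proof (induction N)
    case 0
    then show ?case using mult_right_mono[OF \<kappa>, of "B 0 powr q"] by (simp add: A_def)
  next
    case (Suc N)
    have "A (Suc N) powr q \<le> \<theta> * A N powr q + \<kappa> * B (Suc N) powr q"
      unfolding A_Suc \<kappa>_def using q \<theta> A0 B by (intro powr_convex_combination) auto
    then show ?case using Suc by (simp add: algebra_simps)
  qed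
  have "(\<Sum>n<N. A n powr q) * (1 - \<theta>) \<le> \<kappa> * (\<Sum>n<N. B n powr q)"
  proof (cases N)
    case (Suc m)
    have "\<theta> * (\<Sum>n<m. A n powr q) \<le> \<theta> * (\<Sum>n<N. A n powr q)"
      using \<theta> by (intro mult_left_mono) (auto simp: Suc)
    then show ?thesis using step[of m] Suc by (simp add: algebra_simps)
  qed simp
  then show ?thesis unfolding A_def[symmetric] \<kappa>_def[symmetric] using \<theta> by (simp add: field_simps)
qed

text \<open>Cauchy condensation: the block from \<open>2 ^ N\<close> to \<open>2 ^ Suc N\<close> has
  \<open>2 ^ N\<close> indices, and on it the errors are at least \<open>E (2 ^ Suc N)\<close> by
  monotonicity.\<close>

lemma dyadic_condensation:
  fixes E :: "nat \<Rightarrow> real"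
  assumes E: "\<And>n. 0 \<le> E n" "\<And>m n. m \<le> n \<Longrightarrow> E n \<le> E m" and q: "0 \<le> q" and r: "0 \<le> r"
  shows "(\<Sum>n=1..N. (2 powr (real n * r) * E (2 ^ n)) powr q) \<le>
    2 * 2 powr (r * q) * (\<Sum>k=1..<2 ^ N. E k powr q * real (k + 1) powr (r * q) * (1 / real (k + 1)))"
proof (induction N)
  case (Suc N)
  let ?t = "\<lambda>k. E k powr q * real (k + 1) powr (r * q) * (1 / real (k + 1))"
  \<comment> \<open>The dyadic term is written as a constant sum over its block. The
    \<open>2 ^ N\<close> summands \<open>1 / 2 ^ Suc N\<close> add up to \<open>1 / 2\<close>, hence
    the factor 2; the factor \<open>2 powr (r * q)\<close> lowers the exponent from
    \<open>Suc N\<close> to \<open>N\<close>.\<close>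
  have "(2 powr (real (Suc N) * r) * E (2 ^ Suc N)) powr q = 2 * 2 powr (r * q) * (\<Sum>k\<in>{2^N..<(2::nat) ^ Suc N}. E (2 ^ Suc N) powr q * 2 powr (real N * r * q) * (1 / 2 ^ Suc N))"
  proof -
    have "(2 powr (real (Suc N) * r) * E (2 ^ Suc N)) powr q = 2 powr (real (Suc N) * r * q) * E (2 ^ Suc N) powr q"
      using E by (simp add: powr_mult powr_powr)
    also have "2 powr (real (Suc N) * r * q) = 2 powr (r * q) * 2 powr (real N * r * q)"
      by (simp add: powr_add[symmetric] algebra_simps)
    finally show ?thesis by simp
  qed
  also have "\<dots> \<le> 2 * 2 powr (r * q) * (\<Sum>k=2^N..<2 ^ Suc N. ?t k)"
  proof (intro mult_left_mono sum_mono mult_mono)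
    fix k :: nat assume k: "k \<in> {2^N..<2 ^ Suc N}"
    show "E (2 ^ Suc N) powr q \<le> E k powr q" using k q E by (intro powr_mono2) auto
    have "2 powr (real N * r * q) = (2 ^ N) powr (r * q)"
      by (simp add: powr_powr[symmetric] powr_realpow mult.assoc)
    also have "\<dots> \<le> real (k + 1) powr (r * q)"
    proof (rule powr_mono2)
      have "real (2 ^ N) \<le> real (k + 1)" using k by (subst of_nat_le_iff) auto
      then show "2 ^ N \<le> real (k + 1)" by simp
    qed (use q r in auto)
    finally show "2 powr (real N * r * q) \<le> real (k + 1) powr (r * q)" .
    have "k + 1 \<le> 2 ^ Suc N" using k by auto
    then have "real (k + 1) \<le> real (2 ^ Suc N)" by (subst of_nat_le_iff)
    then have "real (k + 1) \<le> 2 ^ Suc N" by simp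
    then show "1 / 2 ^ Suc N \<le> 1 / real (k + 1)" by (intro divide_left_mono) auto
  qed auto
  finally have "(2 powr (real (Suc N) * r) * E (2 ^ Suc N)) powr q \<le> 2 * 2 powr (r * q) * (\<Sum>k=2^N..<2 ^ Suc N. ?t k)" .
  moreover have "(\<Sum>k=1..<2 ^ Suc N. ?t k) = (\<Sum>k=1..<2 ^ N. ?t k) + (\<Sum>k=2 ^ N..<2 ^ Suc N. ?t k)"
    by (rule sum.atLeastLessThan_concat[symmetric]) auto
  ultimately show ?case using Suc by (simp add: algebra_simps del: power_Suc of_nat_add)
qed simp

section \<open>Roots of extended nonnegative reals\<close>

lemma ennreal_root_mono: "0 < q \<Longrightarrow> x \<le> y \<Longrightarrow> ennreal_root q x \<le> ennreal_root q y"
  unfolding ennreal_root_def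
  by (auto simp: top_unique less_top intro!: ennreal_leI powr_mono2 enn2real_mono)

lemma ennreal_root_ennreal: "0 \<le> x \<Longrightarrow> ennreal_root q (ennreal x) = ennreal (x powr (1 / q))"
  by (simp add: ennreal_root_def)

lemma ennreal_root_powr: "0 < q \<Longrightarrow> 0 \<le> x \<Longrightarrow> ennreal_root q (ennreal (x powr q)) = ennreal x"
  by (simp add: ennreal_root_ennreal powr_powr)

lemma ennreal_root_top [simp]: "ennreal_root q top = top"
  by (simp add: ennreal_root_def)

lemma ennreal_root_cmult:
  assumes "0 < c"
  shows "ennreal_root q (ennreal c * x) = ennreal (c powr (1 / q)) * ennreal_root q x"
proof (cases x rule: ennreal_cases)
  case (real y)
  then have "ennreal_root q (ennreal c * x) = ennreal_root q (ennreal (c * y))"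
    using assms by (simp add: ennreal_mult)
  also have "\<dots> = ennreal ((c * y) powr (1 / q))" using assms real by (intro ennreal_root_ennreal) simp
  also have "\<dots> = ennreal (c powr (1 / q)) * ennreal (y powr (1 / q))"
    unfolding powr_mult by (rule ennreal_mult) auto
  finally show ?thesis using real by (simp add: ennreal_root_ennreal)
next
  case top
  then show ?thesis using assms by (simp add: ennreal_mult_top)
qed

text \<open>A crude substitute for Minkowski's inequality: the sum is at most twice the maximum, and
  \<open>2 powr (1 / q) \<le> 2\<close>. Only equivalence of norms is at stake, so the constant is
  harmless.\<close>

lemma ennreal_root_add:
  assumes "1 \<le> q"
  shows "ennreal_root q (x + y) \<le> 2 * (ennreal_root q x + ennreal_root q y)"
proof -
  have "ennreal_root q (x + y) \<le> ennreal_root q (ennreal 2 * max x y)"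
  proof (rule ennreal_root_mono)
    have "x + y \<le> max x y + max x y" by (intro add_mono) auto
    then show "x + y \<le> ennreal 2 * max x y" by (simp add: mult_2)
  qed (use assms in auto)
  also have "\<dots> = ennreal (2 powr (1 / q)) * ennreal_root q (max x y)" by (rule ennreal_root_cmult) simp
  also have "\<dots> \<le> 2 * (ennreal_root q x + ennreal_root q y)"
  proof (rule mult_mono)
    have "(2::real) powr (1 / q) \<le> 2 powr 1" using assms by (intro powr_mono) auto
    then show "ennreal (2 powr (1 / q)) \<le> 2" using ennreal_leI by force
    show "ennreal_root q (max x y) \<le> ennreal_root q x + ennreal_root q y"
      by (auto simp: max_def)
  qed auto
  finally show ?thesis .
qed

lemma ennreal_nth_le_suminf: "(f :: nat \<Rightarrow> ennreal) n \<le> (\<Sum>n. f n)"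
  using sum_le_suminf[OF summableI, of "{n}" f] by simp

section \<open>Comparing integrals over \<open>h\<close> with dyadic and harmonic sums\<close>

lemma dyadic_above_one:
  fixes h :: real
  assumes "1 < h"
  obtains n where "h \<le> 2 ^ Suc n" "2 ^ n < h"
proof -
  define n where "n = (LEAST n. h \<le> 2 ^ Suc n)"
  obtain m where "h < 2 ^ m" using real_arch_pow[of 2 h] by auto
  then have "h \<le> 2 ^ Suc m" using assms by simp
  then have n1: "h \<le> 2 ^ Suc n" unfolding n_def by (rule LeastI)
  have n2: "2 ^ n < h"
  proof (cases n)
    case (Suc k)
    then have "\<not> h \<le> 2 ^ Suc k" using not_less_Least[of k "\<lambda>n. h \<le> 2 ^ Suc n"] by (simp add: n_def)
    then show ?thesis using Suc by simp
  qed (use assms in simp)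
  from n1 n2 show thesis by (rule that)
qed

lemma dyadic_below_one:
  fixes h :: real
  assumes "0 < h" "h \<le> 1"
  obtains n where "1 / 2 ^ Suc n < h" "h \<le> 1 / 2 ^ n"
proof -
  define n where "n = (LEAST n. 1 / 2 ^ Suc n < h)"
  obtain m where "(1 / 2) ^ m < h" using real_arch_pow_inv[of h "1/2"] assms by auto
  then have "1 / 2 ^ Suc m < h" using assms(1) by (simp add: power_divide field_simps)
  then have n1: "1 / 2 ^ Suc n < h" unfolding n_def by (rule LeastI)
  have n2: "h \<le> 1 / 2 ^ n"
  proof (cases n)
    case (Suc k)
    then have "\<not> 1 / 2 ^ Suc k < h" using not_less_Least[of k "\<lambda>n. 1 / 2 ^ Suc n < h"] by (simp add: n_def)
    then show ?thesis using Suc by simp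
  qed (use assms in simp)
  from n1 n2 show thesis by (rule that)
qed

text \<open>On each dyadic block the powers of \<open>h\<close> are taken at the left end and
  \<open>w\<close> at the right end. The length of the block equals its left end and cancels the
  factor \<open>1 / h\<close>. Beyond 1 only the uniform bound \<open>W\<close> is inserted, which
  leaves a geometric series.\<close>

lemma dyadic_nn_integral_upper:
  fixes w :: "real \<Rightarrow> real"
  assumes r: "0 < r" and q: "0 < q" and w: "\<And>h. 0 < h \<Longrightarrow> 0 \<le> w h" "\<And>h h'. 0 < h \<Longrightarrow> h \<le> h' \<Longrightarrow> w h \<le> w h'"
    "\<And>h. 0 < h \<Longrightarrow> w h \<le> W"
  shows "(\<integral>\<^sup>+h\<in>{0<..}. ennreal ((h powr (- r) * w h) powr q / h) \<partial>lborel) \<le>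
    (\<Sum>n. ennreal ((2 powr r * (2 powr (real n * r) * w (1 / 2 ^ n))) powr q)) +
    (\<Sum>n. ennreal ((2 powr (- (real n * r)) * W) powr q))"
proof -
  let ?I = "\<lambda>n::nat. {1 / 2 ^ Suc n<..1 / (2::real) ^ n}" and ?J = "\<lambda>n::nat. {2 ^ n<..(2::real) ^ Suc n}"
  let ?u = "\<lambda>n::nat. ((1 / 2 ^ Suc n) powr (- r) * w (1 / 2 ^ n)) powr q / (1 / 2 ^ Suc n)"
  let ?v = "\<lambda>n::nat. ((2 ^ n) powr (- r) * W) powr q / 2 ^ n"
  have W0: "0 \<le> W" using w(1,3)[of 1] by simp
  have bound: "(h powr (- r) * w h) powr q / h \<le> (a powr (- r) * b) powr q / a" if "0 < a" "a < h" "w h \<le> b" for a b h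
  proof -
    have w0: "0 \<le> w h" using w that by auto
    have "h powr (- r) \<le> a powr (- r)" using that r by (intro powr_mono2') auto
    then have "h powr (- r) * w h \<le> a powr (- r) * b" using that w0 by (intro mult_mono) auto
    then have "(h powr (- r) * w h) powr q \<le> (a powr (- r) * b) powr q"
      using q w0 by (intro powr_mono2) auto
    then show ?thesis using that by (intro frac_le) auto
  qed
  have "(\<integral>\<^sup>+h\<in>{0<..}. ennreal ((h powr (- r) * w h) powr q / h) \<partial>lborel) \<le>
     (\<integral>\<^sup>+h. (\<Sum>n. ennreal (?u n) * indicator (?I n) h) + (\<Sum>n. ennreal (?v n) * indicator (?J n) h) \<partial>lborel)"
  proof (rule nn_integral_mono)
    fix h :: real
    let ?L = "ennreal ((h powr (- r) * w h) powr q / h) * indicator {0<..} h"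
    consider "h \<le> 0" | "0 < h" "h \<le> 1" | "1 < h" by linarith
    then show "?L \<le> (\<Sum>n. ennreal (?u n) * indicator (?I n) h) + (\<Sum>n. ennreal (?v n) * indicator (?J n) h)"
    proof cases
      case 1 then show ?thesis by simp
    next
      case 2
      then obtain n where n1: "1 / 2 ^ Suc n < h" and n2: "h \<le> 1 / 2 ^ n" by (rule dyadic_below_one)
      have "?L \<le> ennreal (?u n) * indicator (?I n) h"
        using n1 n2 2 bound[OF _ n1, of "w (1 / 2 ^ n)"] w(2)[of h] by (auto intro!: ennreal_leI)
      also have "\<dots> \<le> (\<Sum>n. ennreal (?u n) * indicator (?I n) h)"
        by (rule ennreal_nth_le_suminf[of "\<lambda>n. ennreal (?u n) * indicator (?I n) h"])
      finally show ?thesis by (simp add: add_increasing2)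
    next
      case 3
      then obtain n where n1: "h \<le> 2 ^ Suc n" and n2: "2 ^ n < h" by (rule dyadic_above_one)
      have "?L \<le> ennreal (?v n) * indicator (?J n) h"
        using n1 n2 3 bound[OF _ n2, of W] w(3)[of h] by (auto intro!: ennreal_leI)
      also have "\<dots> \<le> (\<Sum>n. ennreal (?v n) * indicator (?J n) h)"
        by (rule ennreal_nth_le_suminf[of "\<lambda>n. ennreal (?v n) * indicator (?J n) h"])
      finally show ?thesis by (simp add: add_increasing)
    qed
  qed
  also have "\<dots> = (\<Sum>n. \<integral>\<^sup>+h. ennreal (?u n) * indicator (?I n) h \<partial>lborel) + (\<Sum>n. \<integral>\<^sup>+h. ennreal (?v n) * indicator (?J n) h \<partial>lborel)"
    by (subst nn_integral_add) (auto simp: nn_integral_suminf)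
  also have "(\<lambda>n. \<integral>\<^sup>+h. ennreal (?u n) * indicator (?I n) h \<partial>lborel) = (\<lambda>n. ennreal ((2 powr r * (2 powr (real n * r) * w (1 / 2 ^ n))) powr q))"
  proof
    fix n :: nat
    have e: "(1 / 2 ^ Suc n) powr (- r) = 2 powr r * 2 powr (real n * r)"
    proof -
      have "(1 / 2 ^ Suc n) powr (- r) = (2 powr (- real (Suc n))) powr (- r)"
        by (simp add: powr_minus powr_realpow divide_inverse del: power_Suc of_nat_Suc)
      also have "\<dots> = 2 powr (real (Suc n) * r)" unfolding powr_powr by (simp only: minus_mult_minus)
      finally show ?thesis by (simp add: powr_add[symmetric] algebra_simps)
    qed
    have "(\<integral>\<^sup>+h. ennreal (?u n) * indicator (?I n) h \<partial>lborel) = ennreal (?u n) * ennreal (1 / 2 ^ n - 1 / 2 ^ Suc n)"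
      by (subst nn_integral_cmult_indicator) (auto simp: field_simps)
    also have "\<dots> = ennreal (?u n * (1 / 2 ^ Suc n))" by (subst ennreal_mult[symmetric]) (auto simp: field_simps)
    also have "?u n * (1 / 2 ^ Suc n) = (2 powr r * (2 powr (real n * r) * w (1 / 2 ^ n))) powr q"
      unfolding e by (simp add: mult.assoc)
    finally show "(\<integral>\<^sup>+h. ennreal (?u n) * indicator (?I n) h \<partial>lborel) = ennreal ((2 powr r * (2 powr (real n * r) * w (1 / 2 ^ n))) powr q)" .
  qed
  also have "(\<lambda>n. \<integral>\<^sup>+h. ennreal (?v n) * indicator (?J n) h \<partial>lborel) = (\<lambda>n. ennreal ((2 powr (- (real n * r)) * W) powr q))"
  proof
    fix n :: nat
    have e: "(2 ^ n) powr (- r) = 2 powr (- (real n * r))"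
    proof -
      have "(2 ^ n) powr (- r) = (2 powr real n) powr (- r)" by (simp add: powr_realpow)
      then show ?thesis unfolding powr_powr by simp
    qed
    have "(\<integral>\<^sup>+h. ennreal (?v n) * indicator (?J n) h \<partial>lborel) = ennreal (?v n) * ennreal (2 ^ Suc n - 2 ^ n)"
      by (subst nn_integral_cmult_indicator) auto
    also have "\<dots> = ennreal (?v n * 2 ^ n)" by (subst ennreal_mult[symmetric]) auto
    also have "?v n * 2 ^ n = (2 powr (- (real n * r)) * W) powr q" unfolding e by simp
    finally show "(\<integral>\<^sup>+h. ennreal (?v n) * indicator (?J n) h \<partial>lborel) = ennreal ((2 powr (- (real n * r)) * W) powr q)" .
  qed
  finally show ?thesis .
qed

text \<open>On the interval from \<open>1 / (m + 2)\<close> to \<open>1 / (m + 1)\<close> the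
  minorant takes \<open>w\<close> at the left end and the powers of \<open>h\<close> at the right
  end. Its length times \<open>m + 1\<close> is \<open>1 / (m + 2)\<close>, the harmonic weight that
  also occurs in the approximation norm.\<close>

lemma harmonic_nn_integral_lower:
  fixes w :: "real \<Rightarrow> real"
  assumes r: "0 < r" and q: "0 < q" and w: "\<And>h. 0 < h \<Longrightarrow> 0 \<le> w h" "\<And>h h'. 0 < h \<Longrightarrow> h \<le> h' \<Longrightarrow> w h \<le> w h'"
  shows "(\<Sum>m. ennreal ((real (m + 1) powr r * w (1 / real (m + 2))) powr q / real (m + 2))) \<le>
    (\<integral>\<^sup>+h\<in>{0<..}. ennreal ((h powr (- r) * w h) powr q / h) \<partial>lborel)"
proof -
  let ?I = "\<lambda>m::nat. {1 / real (m + 2)<..1 / real (m + 1)}"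
  let ?u = "\<lambda>m::nat. (real (m + 1) powr r * w (1 / real (m + 2))) powr q * real (m + 1)"
  have disj: "disjoint_family ?I"
    unfolding disjoint_family_on_def
  proof (intro ballI impI)
    have aux: "?I m \<inter> ?I n = {}" if "m < n" for m n :: nat
    proof -
      have "1 / real (n + 1) \<le> 1 / real (m + 2)" using that by (intro divide_left_mono) auto
      then show ?thesis by auto
    qed
    fix m n :: nat assume "m \<noteq> n"
    then consider "m < n" | "n < m" by linarith
    then show "?I m \<inter> ?I n = {}" by cases (use aux in blast)+
  qed
  have "(\<Sum>m. ennreal ((real (m + 1) powr r * w (1 / real (m + 2))) powr q / real (m + 2))) =
      (\<Sum>m. \<integral>\<^sup>+h. ennreal (?u m) * indicator (?I m) h \<partial>lborel)"
  proof (rule suminf_cong)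
    fix m
    have l: "1 / real (m + 1) - 1 / real (m + 2) = 1 / (real (m + 1) * real (m + 2))" by (simp add: field_simps)
    have "(\<integral>\<^sup>+h. ennreal (?u m) * indicator (?I m) h \<partial>lborel) = ennreal (?u m) * ennreal (1 / real (m + 1) - 1 / real (m + 2))"
      by (subst nn_integral_cmult_indicator) (auto simp: field_simps)
    also have "\<dots> = ennreal (?u m * (1 / (real (m + 1) * real (m + 2))))"
      unfolding l by (subst ennreal_mult[symmetric]) auto
    also have "?u m * (1 / (real (m + 1) * real (m + 2))) = (real (m + 1) powr r * w (1 / real (m + 2))) powr q / real (m + 2)"
      by simp
    finally show "ennreal ((real (m + 1) powr r * w (1 / real (m + 2))) powr q / real (m + 2)) = (\<integral>\<^sup>+h. ennreal (?u m) * indicator (?I m) h \<partial>lborel)" ..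
  qed
  also have "\<dots> = (\<integral>\<^sup>+h. (\<Sum>m. ennreal (?u m) * indicator (?I m) h) \<partial>lborel)"
    by (rule nn_integral_suminf[symmetric]) auto
  also have "\<dots> \<le> (\<integral>\<^sup>+h\<in>{0<..}. ennreal ((h powr (- r) * w h) powr q / h) \<partial>lborel)"
  proof (rule nn_integral_mono)
    fix h :: real
    show "(\<Sum>m. ennreal (?u m) * indicator (?I m) h) \<le> ennreal ((h powr (- r) * w h) powr q / h) * indicator {0<..} h"
    proof (cases "\<exists>m. h \<in> ?I m")
      case True
      then obtain m where m: "h \<in> ?I m" ..
      have h: "0 < h" using m by (auto intro: order_le_less_trans[rotated])
      have h1: "real (m + 1) \<le> 1 / h" using m h by (simp add: field_simps)
      have "?u m \<le> ((1 / h) powr r * w h) powr q * (1 / h)"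
        using h1 m h r q w by (intro mult_mono powr_mono2) auto
      also have "\<dots> = (h powr (- r) * w h) powr q / h" using h by (simp add: powr_minus powr_divide divide_inverse inverse_powr)
      finally show ?thesis unfolding suminf_cmult_indicator[OF disj m] using h by (simp add: ennreal_leI)
    next
      case False
      then show ?thesis by simp
    qed
  qed
  finally show ?thesis .
qed

section \<open>Bounded groups and moduli of smoothness\<close>

lemma l1_norm_scaleR: "l1_norm (c *\<^sub>R t) = \<bar>c\<bar> * l1_norm t"
  by (simp add: l1_norm_def abs_mult sum_distrib_left)

lemma l1_norm_nonneg: "0 \<le> l1_norm t"
  by (simp add: l1_norm_def sum_nonneg)

lemma l1_norm_zero: "l1_norm 0 = 0"
  by (simp add: l1_norm_def)

lemma l1_norm_axis: "l1_norm (axis j 1) = 1"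
proof -
  have "l1_norm (axis j 1) = (\<Sum>i\<in>UNIV. if i = j then 1 else 0)"
    unfolding l1_norm_def by (rule sum.cong) (auto simp: axis_def)
  then show ?thesis by simp
qed

locale bounded_group =
  fixes \<psi> :: "real ^ 'd::{finite,linorder} \<Rightarrow> 'a::complex_banach_algebra \<Rightarrow> 'a" and M :: real
  assumes bounded_linear_psi: "bounded_linear (\<psi> t)"
    and psi_psi: "\<psi> s (\<psi> t a) = \<psi> (s + t) a"
    and psi_zero [simp]: "\<psi> 0 a = a"
    and norm_psi_le: "norm (\<psi> t a) \<le> M * norm a"
    and one_le_M: "1 \<le> M"
begin

lemma M_nonneg: "0 \<le> M" and M_pos: "0 < M"
  using one_le_M by auto

lemma psi_add: "\<psi> t (a + b) = \<psi> t a + \<psi> t b"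
  and psi_diff: "\<psi> t (a - b) = \<psi> t a - \<psi> t b"
  and psi_scaleR: "\<psi> t (c *\<^sub>R a) = c *\<^sub>R \<psi> t a"
  and psi_0_right [simp]: "\<psi> t 0 = 0"
  and psi_sum: "\<psi> t (\<Sum>i\<in>I. f i) = (\<Sum>i\<in>I. \<psi> t (f i))"
  using bounded_linear_psi[of t]
  by (simp_all add: linear_add linear_diff linear_scale linear_0 linear_sum bounded_linear.linear)

lemma psi_commute: "\<psi> s (\<psi> t a) = \<psi> t (\<psi> s a)"
  by (simp add: psi_psi add.commute)

lemma difference_0 [simp]: "difference \<psi> t 0 a = a"
  by (simp add: difference_def)

lemma difference_Suc: "difference \<psi> t (Suc k) a = \<psi> t (difference \<psi> t k a) - difference \<psi> t k a"
  by (simp add: difference_def)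

lemma difference_Suc': "difference \<psi> t (Suc k) a = difference \<psi> t k (\<psi> t a - a)"
  unfolding difference_def funpow_Suc_right comp_def by simp

lemma difference_psi: "difference \<psi> t k (\<psi> s a) = \<psi> s (difference \<psi> t k a)"
  by (induction k) (simp_all add: difference_Suc psi_diff psi_commute[of t])

lemma difference_add: "difference \<psi> t k (a + b) = difference \<psi> t k a + difference \<psi> t k b"
  by (induction k) (simp_all add: difference_Suc psi_add)

lemma difference_sum: "difference \<psi> t k (\<Sum>i\<in>I. f i) = (\<Sum>i\<in>I. difference \<psi> t k (f i))"
  by (induction k) (simp_all add: difference_Suc psi_sum sum_subtractf)

lemma norm_difference_le: "norm (difference \<psi> t k a) \<le> (M + 1) ^ k * norm a"
proof (induction k)
  case (Suc k)
  have "norm (difference \<psi> t (Suc k) a) \<le> norm (\<psi> t (difference \<psi> t k a)) + norm (difference \<psi> t k a)"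
    unfolding difference_Suc by (rule norm_triangle_ineq4)
  also have "\<dots> \<le> (M + 1) * norm (difference \<psi> t k a)"
    using norm_psi_le[of t "difference \<psi> t k a"] by (simp add: algebra_simps)
  also have "\<dots> \<le> (M + 1) * ((M + 1) ^ k * norm a)"
    using M_nonneg by (intro mult_left_mono Suc) auto
  finally show ?case by simp
qed simp

lemma difference_expand:
  "difference \<psi> t k a = (\<Sum>i\<le>k. ((-1) ^ (k - i) * real (k choose i)) *\<^sub>R \<psi> (real i *\<^sub>R t) a)"
proof (induction k arbitrary: a)
  case (Suc k)
  let ?c = "\<lambda>i. (-1) ^ (k - i) * real (k choose i)"
  have "difference \<psi> t (Suc k) a = (\<Sum>i\<le>k. ?c i *\<^sub>R \<psi> (real i *\<^sub>R t) (\<psi> t a)) - (\<Sum>i\<le>k. ?c i *\<^sub>R \<psi> (real i *\<^sub>R t) a)"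
    unfolding difference_Suc' Suc by (simp add: psi_diff scaleR_diff_right sum_subtractf)
  also have "(\<Sum>i\<le>k. ?c i *\<^sub>R \<psi> (real i *\<^sub>R t) (\<psi> t a)) = (\<Sum>i\<le>k. ?c i *\<^sub>R \<psi> (real (Suc i) *\<^sub>R t) a)"
    by (simp add: psi_psi algebra_simps)
  also have "(\<Sum>i\<le>k. ?c i *\<^sub>R \<psi> (real i *\<^sub>R t) a) = - (\<Sum>i\<le>Suc k. ((-1) ^ (Suc k - i) * real (k choose i)) *\<^sub>R \<psi> (real i *\<^sub>R t) a)"
    by (simp add: Suc_diff_le sum_negf)
  also have "(\<Sum>i\<le>Suc k. ((-1) ^ (Suc k - i) * real (k choose i)) *\<^sub>R \<psi> (real i *\<^sub>R t) a) =
     (-1) ^ Suc k *\<^sub>R a + (\<Sum>i\<le>k. ((-1) ^ (k - i) * real (k choose Suc i)) *\<^sub>R \<psi> (real (Suc i) *\<^sub>R t) a)"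
    by (subst sum.atMost_Suc_shift) simp
  also have "(\<Sum>i\<le>k. ?c i *\<^sub>R \<psi> (real (Suc i) *\<^sub>R t) a) -
      - ((-1) ^ Suc k *\<^sub>R a + (\<Sum>i\<le>k. ((-1) ^ (k - i) * real (k choose Suc i)) *\<^sub>R \<psi> (real (Suc i) *\<^sub>R t) a)) =
      (-1) ^ Suc k *\<^sub>R a + (\<Sum>i\<le>k. ((-1) ^ (k - i) * real (Suc k choose Suc i)) *\<^sub>R \<psi> (real (Suc i) *\<^sub>R t) a)"
    by (simp add: sum.distrib[symmetric] scaleR_add_left[symmetric] distrib_left del: of_nat_Suc)
  also have "\<dots> = (\<Sum>i\<le>Suc k. ((-1) ^ (Suc k - i) * real (Suc k choose i)) *\<^sub>R \<psi> (real i *\<^sub>R t) a)"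
    unfolding sum.atMost_Suc_shift[of _ k] by simp
  finally show ?case .
qed simp

text \<open>The factorisation of \<open>\<psi> (n t) - id\<close> into the sum of
  \<open>\<psi> (i t)\<close> over \<open>i < n\<close> and \<open>\<psi> t - id\<close> is applied
  \<open>l\<close> times; each application costs a factor \<open>n * M\<close>.\<close>

lemma norm_difference_multiple:
  "norm (difference \<psi> (real n *\<^sub>R t) l a) \<le> (real n * M) ^ l * norm (difference \<psi> t l a)"
proof (induction l arbitrary: a)
  case (Suc l)
  let ?b = "\<psi> t a - a"
  have tel: "\<psi> (real n *\<^sub>R t) a - a = (\<Sum>i<n. \<psi> (real i *\<^sub>R t) ?b)"
    by (induction n) (simp_all add: psi_diff psi_psi algebra_simps)
  have "norm (difference \<psi> (real n *\<^sub>R t) (Suc l) a) \<le> (real n * M) ^ l * norm (difference \<psi> t l (\<Sum>i<n. \<psi> (real i *\<^sub>R t) ?b))"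
    unfolding difference_Suc' tel by (rule Suc)
  also have "\<dots> \<le> (real n * M) ^ l * (\<Sum>i<n. M * norm (difference \<psi> t l ?b))"
    unfolding difference_sum difference_psi using M_nonneg by (intro mult_left_mono sum_norm_le norm_psi_le) auto
  finally show ?case
    by (simp add: difference_Suc'[symmetric] mult_ac)
qed simp

section \<open>Elementary properties of the moduli of smoothness\<close>

abbreviation "\<omega> \<equiv> modulus_of_smoothness \<psi>"

lemma bdd_modulus: "bdd_above ((\<lambda>t. norm (difference \<psi> t k a)) ` S)"
  by (rule bdd_aboveI2[of _ _ "(M + 1) ^ k * norm a"]) (rule norm_difference_le)

lemma norm_difference_le_modulus:
  "l1_norm t \<le> h \<Longrightarrow> norm (difference \<psi> t k a) \<le> \<omega> k h a"
  unfolding modulus_of_smoothness_def by (rule cSUP_upper[OF _ bdd_modulus]) simp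

lemma modulus_le:
  assumes "0 \<le> h" "\<And>t. l1_norm t \<le> h \<Longrightarrow> norm (difference \<psi> t k a) \<le> B"
  shows "\<omega> k h a \<le> B"
  unfolding modulus_of_smoothness_def
proof (rule cSUP_least)
  have "0 \<in> {t. l1_norm t \<le> h}" using assms(1) by (simp add: l1_norm_zero)
  then show "{t. l1_norm t \<le> h} \<noteq> {}" by blast
qed (use assms in auto)

lemma modulus_nonneg: "0 \<le> h \<Longrightarrow> 0 \<le> \<omega> k h a"
  using norm_difference_le_modulus[of 0 h k a] norm_ge_zero[of "difference \<psi> 0 k a"]
  by (simp add: l1_norm_zero del: norm_ge_zero)

lemma modulus_mono: "0 \<le> h \<Longrightarrow> h \<le> h' \<Longrightarrow> \<omega> k h a \<le> \<omega> k h' a"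
  by (rule modulus_le) (auto intro: norm_difference_le_modulus)

lemma modulus_le_norm: "0 \<le> h \<Longrightarrow> \<omega> k h a \<le> (M + 1) ^ k * norm a"
  by (rule modulus_le[OF _ norm_difference_le])

lemma modulus_add_le: "0 \<le> h \<Longrightarrow> \<omega> k h (a + b) \<le> \<omega> k h a + \<omega> k h b"
  by (rule modulus_le)
    (auto simp: difference_add intro!: order_trans[OF norm_triangle_ineq] add_mono norm_difference_le_modulus)

lemma modulus_multiple:
  assumes "0 \<le> h" "0 < n"
  shows "\<omega> k (real n * h) a \<le> (real n * M) ^ k * \<omega> k h a"
proof (rule modulus_le)
  fix t :: "real ^ 'd::{finite,linorder}" assume t: "l1_norm t \<le> real n * h"
  let ?s = "(1 / real n) *\<^sub>R t"
  have "l1_norm ?s \<le> h" using t assms by (simp add: l1_norm_scaleR field_simps)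
  then have "norm (difference \<psi> ?s k a) \<le> \<omega> k h a" by (rule norm_difference_le_modulus)
  then have "(real n * M) ^ k * norm (difference \<psi> ?s k a) \<le> (real n * M) ^ k * \<omega> k h a"
    using M_nonneg by (intro mult_left_mono) auto
  moreover have "norm (difference \<psi> (real n *\<^sub>R ?s) k a) \<le> (real n * M) ^ k * norm (difference \<psi> ?s k a)"
    by (rule norm_difference_multiple)
  ultimately show "norm (difference \<psi> t k a) \<le> (real n * M) ^ k * \<omega> k h a"
    using assms by simp
qed (use assms in auto)

text \<open>Rounding \<open>c\<close> up to an integer reduces this to integer multiples. The form
  \<open>1 + c\<close> stays valid as \<open>c\<close> tends to 0.\<close>

lemma modulus_dilate:
  assumes "0 \<le> h" "0 \<le> c"
  shows "\<omega> k (c * h) a \<le> M ^ k * (1 + c) ^ k * \<omega> k h a"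
proof -
  define n where "n = nat \<lfloor>c\<rfloor> + 1"
  have n: "c \<le> real n" "real n \<le> 1 + c" "0 < n" using assms(2) by (auto simp: n_def) linarith+
  have "\<omega> k (c * h) a \<le> \<omega> k (real n * h) a"
    using n assms by (intro modulus_mono mult_right_mono) auto
  also have "\<dots> \<le> (real n * M) ^ k * \<omega> k h a" using n assms by (intro modulus_multiple)
  also have "\<dots> \<le> ((1 + c) * M) ^ k * \<omega> k h a"
    using n assms M_nonneg by (intro mult_right_mono power_mono modulus_nonneg) auto
  finally show ?thesis by (simp add: power_mult_distrib mult_ac)
qed

section \<open>Vanishing moduli and continuity of orbits\<close>

lemma difference_double:
  obtains c where "0 \<le> c" "\<And>t a. norm ((2::real) ^ k *\<^sub>R difference \<psi> t k a) \<le>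
    norm (difference \<psi> (2 *\<^sub>R t) k a) + c * norm (difference \<psi> t (Suc k) a)"
proof -
  \<comment> \<open>\<open>R t\<close> is \<open>id + \<psi> t\<close>, the quotient of the
    differences with steps \<open>2 t\<close> and \<open>t\<close>. Writing it as twice the identity
    plus a first difference shows that its \<open>k\<close>-th power is \<open>2 ^ k\<close> up to
    terms containing that difference.\<close>
  define R where "R = (\<lambda>t b. 2 *\<^sub>R b + (\<psi> t b - b))"
  have R1: "\<exists>c\<ge>0. \<forall>t b. norm ((R t ^^ k) b - (2::real) ^ k *\<^sub>R b) \<le> c * norm (\<psi> t b - b)" for k
  proof (induction k)
    case (Suc k)
    then obtain c where c: "c \<ge> 0" "\<And>t b. norm ((R t ^^ k) b - (2::real) ^ k *\<^sub>R b) \<le> c * norm (\<psi> t b - b)"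
      by blast
    have nR: "norm (R t x) \<le> (1 + M) * norm x" for t x
    proof -
      have "R t x = x + \<psi> t x" by (simp add: R_def algebra_simps scaleR_2)
      then show ?thesis using norm_triangle_ineq[of x "\<psi> t x"] norm_psi_le[of t x]
        by (simp add: algebra_simps)
    qed
    have "norm ((R t ^^ Suc k) b - (2::real) ^ Suc k *\<^sub>R b) \<le> ((1 + M) * c + 2 ^ k) * norm (\<psi> t b - b)" for t b
    proof -
      have "(R t ^^ Suc k) b - (2::real) ^ Suc k *\<^sub>R b = R t ((R t ^^ k) b - (2::real) ^ k *\<^sub>R b) + (2::real) ^ k *\<^sub>R (\<psi> t b - b)"
        by (simp add: R_def psi_diff psi_scaleR scaleR_diff_right scaleR_2 scaleR_scaleR[symmetric] del: scaleR_scaleR)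
      also have "norm \<dots> \<le> (1 + M) * norm ((R t ^^ k) b - (2::real) ^ k *\<^sub>R b) + norm ((2::real) ^ k *\<^sub>R (\<psi> t b - b))"
        by (intro order_trans[OF norm_triangle_ineq] add_mono nR order_refl)
      also have "\<dots> \<le> (1 + M) * (c * norm (\<psi> t b - b)) + norm ((2::real) ^ k *\<^sub>R (\<psi> t b - b))"
        using M_nonneg by (intro add_mono mult_left_mono c) auto
      finally show ?thesis by (simp add: distrib_right)
    qed
    then show ?case using c M_nonneg by (intro exI[of _ "(1 + M) * c + 2 ^ k"]) auto
  qed (auto intro: exI[of _ 0])
  have d2: "difference \<psi> (2 *\<^sub>R t) k a = (R t ^^ k) (difference \<psi> t k a)" for t k a
  proof (induction k arbitrary: a)
    case (Suc k)
    have Rp: "(R t ^^ k) (\<psi> t x) = \<psi> t ((R t ^^ k) x)" for x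
      by (induction k) (simp_all add: R_def psi_add psi_diff psi_scaleR)
    have R_diff: "R t (x - y) = R t x - R t y" for x y
      by (simp add: R_def psi_diff algebra_simps)
    have Rd: "(R t ^^ k) (x - y) = (R t ^^ k) x - (R t ^^ k) y" for x y
      by (induction k) (simp_all add: R_diff)
    have tt: "\<psi> (2 *\<^sub>R t) x = \<psi> t (\<psi> t x)" for x by (simp add: psi_psi scaleR_2)
    show ?case
      unfolding difference_Suc Suc tt
      by (simp add: Rd Rp) (simp add: R_def psi_diff algebra_simps scaleR_2)
  qed simp
  from R1[of k] obtain c where c: "c \<ge> 0" "\<And>t b. norm ((R t ^^ k) b - (2::real) ^ k *\<^sub>R b) \<le> c * norm (\<psi> t b - b)"
    by blast
  show thesis
  proof (rule that[OF c(1)])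
    fix t a
    let ?b = "difference \<psi> t k a"
    have "norm ((2::real) ^ k *\<^sub>R ?b) \<le> norm ((R t ^^ k) ?b) + norm ((R t ^^ k) ?b - (2::real) ^ k *\<^sub>R ?b)"
      by (subst norm_minus_commute) (rule norm_triangle_sub)
    then show "norm ((2::real) ^ k *\<^sub>R ?b) \<le> norm (difference \<psi> (2 *\<^sub>R t) k a) + c * norm (difference \<psi> t (Suc k) a)"
      using c(2)[of t ?b] unfolding d2 difference_Suc by simp
  qed
qed

text \<open>Let \<open>L\<close> be the infimum of the modulus over positive \<open>h\<close>, which
  by monotonicity is its limit at 0. The doubling inequality turns in the limit into
  \<open>2 ^ k * L \<le> L\<close>, and \<open>k > 0\<close> forces \<open>L = 0\<close>.\<close>

lemma modulus_vanish_step: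
  assumes k: "0 < k" and v: "\<And>\<epsilon>. \<epsilon> > 0 \<Longrightarrow> \<exists>h>0. \<omega> (Suc k) h a \<le> \<epsilon>" and \<epsilon>: "\<epsilon> > 0"
  shows "\<exists>h>0. \<omega> k h a \<le> \<epsilon>"
proof -
  obtain c where c: "0 \<le> c" "\<And>t a. norm ((2::real) ^ k *\<^sub>R difference \<psi> t k a) \<le>
    norm (difference \<psi> (2 *\<^sub>R t) k a) + c * norm (difference \<psi> t (Suc k) a)"
    using difference_double[of k] by blast
  have st: "2 ^ k * \<omega> k h a \<le> \<omega> k (2 * h) a + c * \<omega> (Suc k) h a" if "h > 0" for h
  proof -
    have "\<omega> k h a \<le> (\<omega> k (2 * h) a + c * \<omega> (Suc k) h a) / 2 ^ k"
    proof (rule modulus_le)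
      fix t :: "real ^ 'd::{finite,linorder}" assume t: "l1_norm t \<le> h"
      have "2 ^ k * norm (difference \<psi> t k a) \<le> norm (difference \<psi> (2 *\<^sub>R t) k a) + c * norm (difference \<psi> t (Suc k) a)"
        using c(2)[of t a] by simp
      also have "\<dots> \<le> \<omega> k (2 * h) a + c * \<omega> (Suc k) h a"
        using t c(1) by (intro add_mono mult_left_mono norm_difference_le_modulus) (auto simp: l1_norm_scaleR)
      finally show "norm (difference \<psi> t k a) \<le> (\<omega> k (2 * h) a + c * \<omega> (Suc k) h a) / 2 ^ k"
        by (simp add: field_simps)
    qed (use that in auto)
    then show ?thesis by (simp add: field_simps)
  qed
  define L where "L = (INF h\<in>{0<..}. \<omega> k h a)"
  have bdd: "bdd_below ((\<lambda>h. \<omega> k h a) ` {0<..})"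
    by (rule bdd_belowI2[of _ 0]) (auto intro: modulus_nonneg)
  have L: "L \<le> \<omega> k h a" if "h > 0" for h
    unfolding L_def using that by (intro cINF_lower[OF bdd]) auto
  have near: "\<exists>h0>0. \<forall>h. 0 < h \<and> h \<le> h0 \<longrightarrow> \<omega> k h a < L + \<delta>" if "\<delta> > 0" for \<delta>
  proof -
    have "L < L + \<delta>" using that by simp
    then obtain h0 where "h0 > 0" "\<omega> k h0 a < L + \<delta>"
      unfolding L_def by (subst (asm) cINF_less_iff) (use bdd in auto)
    then show ?thesis using modulus_mono by (metis less_imp_le order_le_less_trans)
  qed
  have "L \<le> 0 + e" if "e > 0" for e
  proof -
    \<comment> \<open>Chosen so that the two errors, \<open>\<delta>\<close> from the modulus of
      order \<open>k\<close> and \<open>c * \<delta>\<close> from order \<open>Suc k\<close>, add up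
      to \<open>e\<close>.\<close>
    define \<delta> where "\<delta> = e / (1 + c)"
    have \<delta>: "\<delta> > 0" using that c by (simp add: \<delta>_def)
    obtain h0 where h0: "h0 > 0" "\<And>h. 0 < h \<Longrightarrow> h \<le> h0 \<Longrightarrow> \<omega> k h a < L + \<delta>" using near[OF \<delta>] by blast
    obtain h1 where h1: "h1 > 0" "\<omega> (Suc k) h1 a \<le> \<delta>" using v[OF \<delta>] by blast
    define h where "h = min (h0 / 2) h1"
    have h: "h > 0" "2 * h \<le> h0" "h \<le> h1" using h0 h1 by (auto simp: h_def)
    have "2 * L \<le> 2 ^ k * \<omega> k h a"
    proof -
      have "0 \<le> L" unfolding L_def by (rule cINF_greatest) (auto intro: modulus_nonneg)
      moreover have "(2::real) ^ 1 \<le> 2 ^ k" using k by (intro power_increasing) auto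
      ultimately show ?thesis using L[of h] h by (intro mult_mono) auto
    qed
    also have "\<dots> \<le> \<omega> k (2 * h) a + c * \<omega> (Suc k) h a" by (rule st) (use h in auto)
    also have "\<dots> \<le> (L + \<delta>) + c * \<delta>"
      using h0(2)[of "2 * h"] modulus_mono[of h h1 "Suc k" a] h h1 c by (intro add_mono mult_left_mono) auto
    also have "\<dots> = L + (1 + c) * \<delta>" by (simp add: algebra_simps)
    also have "(1 + c) * \<delta> = e" using c by (simp add: \<delta>_def)
    finally show ?thesis by simp
  qed
  then have "L \<le> 0" by (rule field_le_epsilon)
  with near[OF \<epsilon>] show ?thesis by (metis add_le_same_cancel2 less_imp_le order.trans order_refl)
qed

lemma modulus_vanish:
  assumes "\<And>\<epsilon>. \<epsilon> > 0 \<Longrightarrow> \<exists>h>0. \<omega> (Suc k) h a \<le> \<epsilon>" and "\<epsilon> > 0"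
  shows "\<exists>h>0. \<omega> 1 h a \<le> \<epsilon>"
  using assms
proof (induction k arbitrary: \<epsilon>)
  case (Suc k)
  show ?case
    by (rule Suc.IH[OF modulus_vanish_step[OF _ Suc.prems(1)] Suc.prems(2)]) auto
qed simp

text \<open>Continuity is asked for along the coordinate axes only, the directions in which averages
  are taken. Continuity at 0 spreads along the whole axis by the group law.\<close>

definition continuous_vectors :: "'a set" where
  "continuous_vectors = {a. \<forall>j. ((\<lambda>s. \<psi> (s *\<^sub>R axis j 1) a) \<longlongrightarrow> a) (at 0)}"

lemma continuous_vectorsI:
  assumes "\<And>\<epsilon>. \<epsilon> > 0 \<Longrightarrow> \<exists>h>0. \<omega> (Suc k) h a \<le> \<epsilon>"
  shows "a \<in> continuous_vectors"
  unfolding continuous_vectors_def mem_Collect_eq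
proof (intro allI tendstoI)
  fix j :: 'd and e :: real assume "e > 0"
  then obtain h where h: "h > 0" "\<omega> 1 h a \<le> e / 2" using modulus_vanish[OF assms, of "e / 2"] by auto
  show "\<forall>\<^sub>F s in at 0. dist (\<psi> (s *\<^sub>R axis j 1) a) a < e"
    unfolding eventually_at
  proof (intro exI[of _ h] conjI ballI impI h)
    fix s :: real assume "s \<noteq> 0 \<and> dist s 0 < h"
    then have "norm (difference \<psi> (s *\<^sub>R axis j 1) 1 a) \<le> \<omega> 1 h a"
      by (intro norm_difference_le_modulus) (simp add: l1_norm_scaleR l1_norm_axis)
    then show "dist (\<psi> (s *\<^sub>R axis j 1) a) a < e"
      using h \<open>e > 0\<close> by (simp add: dist_norm difference_def)
  qed
qed

section \<open>Bernstein's inequality\<close>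

lemma generator_has_vector_derivative:
  assumes "(a, b) \<in> generator \<psi> v"
  shows "((\<lambda>s. \<psi> (s *\<^sub>R v) a) has_vector_derivative \<psi> (s *\<^sub>R v) b) (at s)"
proof -
  have "((\<lambda>h::real. (\<psi> (h *\<^sub>R v) a - a) /\<^sub>R h) \<longlongrightarrow> b) (at 0)"
    using assms by (simp add: generator_def)
  then have "((\<lambda>h::real. \<psi> (s *\<^sub>R v) ((\<psi> (h *\<^sub>R v) a - a) /\<^sub>R h)) \<longlongrightarrow> \<psi> (s *\<^sub>R v) b) (at 0)"
    by (rule bounded_linear.tendsto[OF bounded_linear_psi])
  then have "((\<lambda>h::real. norm (\<psi> (s *\<^sub>R v) ((\<psi> (h *\<^sub>R v) a - a) /\<^sub>R h) - \<psi> (s *\<^sub>R v) b)) \<longlongrightarrow> 0) (at 0)"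
    by (intro tendsto_norm_zero LIM_zero)
  then have "((\<lambda>h. norm (\<psi> ((s + h) *\<^sub>R v) a - \<psi> (s *\<^sub>R v) a - h *\<^sub>R \<psi> (s *\<^sub>R v) b) / norm h) \<longlongrightarrow> 0) (at 0)"
  proof (rule Lim_transform_eventually)
    have "norm (\<psi> (s *\<^sub>R v) ((\<psi> (h *\<^sub>R v) a - a) /\<^sub>R h) - \<psi> (s *\<^sub>R v) b) =
        norm (\<psi> ((s + h) *\<^sub>R v) a - \<psi> (s *\<^sub>R v) a - h *\<^sub>R \<psi> (s *\<^sub>R v) b) / norm h" if "h \<noteq> 0" for h
    proof -
      have "\<psi> (s *\<^sub>R v) ((\<psi> (h *\<^sub>R v) a - a) /\<^sub>R h) - \<psi> (s *\<^sub>R v) b =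
          (\<psi> ((s + h) *\<^sub>R v) a - \<psi> (s *\<^sub>R v) a - h *\<^sub>R \<psi> (s *\<^sub>R v) b) /\<^sub>R h"
        using that by (simp add: psi_diff psi_scaleR psi_psi scaleR_add_left scaleR_diff_right)
      then show ?thesis by (simp add: divide_inverse mult.commute)
    qed
    then show "\<forall>\<^sub>F h in at 0. norm (\<psi> (s *\<^sub>R v) ((\<psi> (h *\<^sub>R v) a - a) /\<^sub>R h) - \<psi> (s *\<^sub>R v) b) =
        norm (\<psi> ((s + h) *\<^sub>R v) a - \<psi> (s *\<^sub>R v) a - h *\<^sub>R \<psi> (s *\<^sub>R v) b) / norm h"
      by (auto simp: eventually_at intro!: exI[of _ 1])
  qed
  then show ?thesis
    unfolding has_vector_derivative_def has_derivative_at
    by (auto intro: bounded_linear_scaleR_left)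
qed

lemma generator_unique: "(a, b) \<in> generator \<psi> v \<Longrightarrow> (a, c) \<in> generator \<psi> v \<Longrightarrow> b = c"
  unfolding generator_def by (auto intro: tendsto_unique[of "at (0::real)"])

lemma generator_add: "(a, b) \<in> generator \<psi> v \<Longrightarrow> (a', b') \<in> generator \<psi> v \<Longrightarrow> (a + a', b + b') \<in> generator \<psi> v"
  unfolding generator_def by (auto dest: tendsto_add simp: psi_add algebra_simps)

lemma generator_scaleR: "(a, b) \<in> generator \<psi> v \<Longrightarrow> (c *\<^sub>R a, c *\<^sub>R b) \<in> generator \<psi> v"
  unfolding generator_def
  by (auto dest: tendsto_scaleR[OF tendsto_const[of c]] simp: psi_scaleR algebra_simps)

lemma generator_psi: "(a, b) \<in> generator \<psi> v \<Longrightarrow> (\<psi> t a, \<psi> t b) \<in> generator \<psi> v"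
  unfolding generator_def
  by (auto dest: bounded_linear.tendsto[OF bounded_linear_psi[of t]] simp: psi_scaleR psi_diff psi_commute[of t])

lemma generator_uminus: "(a, b) \<in> generator \<psi> v \<Longrightarrow> (a, - b) \<in> generator \<psi> (- v)"
proof -
  assume "(a, b) \<in> generator \<psi> v"
  then have "((\<lambda>h::real. (\<psi> (h *\<^sub>R v) a - a) /\<^sub>R h) \<longlongrightarrow> b) (at (- 0))" by (simp add: generator_def)
  then have "((\<lambda>h::real. (\<psi> ((- h) *\<^sub>R v) a - a) /\<^sub>R (- h)) \<longlongrightarrow> b) (at 0)"
    unfolding filtermap_at_minus[symmetric] filterlim_filtermap .
  from tendsto_minus[OF this] show ?thesis by (simp add: generator_def)
qed

lemma norm_psi_diff_le_generator:
  assumes "(a, b) \<in> generator \<psi> v"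
  shows "norm (\<psi> (s *\<^sub>R v) a - a) \<le> M * \<bar>s\<bar> * norm b"
proof -
  have "norm (\<psi> (s *\<^sub>R v) a - \<psi> (0 *\<^sub>R v) a) \<le> (M * norm b) * norm (s - 0)"
  proof (rule differentiable_bound[of UNIV "\<lambda>s. \<psi> (s *\<^sub>R v) a" "\<lambda>s h. h *\<^sub>R \<psi> (s *\<^sub>R v) b"])
    fix x :: real
    show "((\<lambda>s. \<psi> (s *\<^sub>R v) a) has_derivative (\<lambda>h. h *\<^sub>R \<psi> (x *\<^sub>R v) b)) (at x within UNIV)"
      using generator_has_vector_derivative[OF assms, of x] by (simp add: has_vector_derivative_def)
    show "onorm (\<lambda>h. h *\<^sub>R \<psi> (x *\<^sub>R v) b) \<le> M * norm b"
      using norm_psi_le[of "x *\<^sub>R v" b] M_nonneg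
      by (intro onorm_le) (simp add: mult.commute mult_left_mono)
  qed auto
  then show ?thesis by (simp add: mult_ac)
qed

text \<open>Induction on \<open>N\<close> over all sequences: the derivative in \<open>s\<close> of
  the remainder of \<open>y\<close> is the remainder of the shifted sequence, whose constant is
  \<open>C * \<tau>\<close>. The mean value inequality against the scalar majorant
  \<open>?\<phi>\<close> integrates this bound.\<close>

lemma taylor_remainder:
  assumes "\<And>n. (y n, y (Suc n)) \<in> generator \<psi> v" "\<And>n. norm (y n) \<le> C * \<tau> ^ n" "0 \<le> s"
  shows "norm (\<psi> (s *\<^sub>R v) (y 0) - (\<Sum>n<N. (s ^ n / fact n) *\<^sub>R y n)) \<le> M * C * \<tau> ^ N * s ^ N / fact N"
  using assms
proof (induction N arbitrary: y C s)
  case 0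
  have "norm (\<psi> (s *\<^sub>R v) (y 0)) \<le> M * norm (y 0)" by (rule norm_psi_le)
  also have "\<dots> \<le> M * C" using 0(2)[of 0] M_nonneg by (intro mult_left_mono) auto
  finally show ?case by simp
next
  case (Suc N)
  have IH: "norm (\<psi> (s *\<^sub>R v) (y 1) - (\<Sum>n<N. (s ^ n / fact n) *\<^sub>R y (Suc n))) \<le> M * (C * \<tau>) * \<tau> ^ N * s ^ N / fact N" if "0 \<le> s" for s
    using Suc.IH[of "\<lambda>n. y (Suc n)" "C * \<tau>" s] Suc.prems(1) Suc.prems(2)[of "Suc _"] that by (simp add: mult_ac)
  let ?f = "\<lambda>s. \<psi> (s *\<^sub>R v) (y 0) - (\<Sum>n<Suc N. (s ^ n / fact n) *\<^sub>R y n)"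
  let ?\<phi> = "\<lambda>s. M * C * \<tau> ^ Suc N * s ^ Suc N / fact (Suc N)"
  have f': "(?f has_vector_derivative (\<psi> (s *\<^sub>R v) (y 1) - (\<Sum>n<N. (s ^ n / fact n) *\<^sub>R y (Suc n)))) (at s)" for s
  proof -
    have e: "(\<Sum>n<Suc N. (s ^ n / fact n) *\<^sub>R y n) = y 0 + (\<Sum>n<N. (s ^ Suc n / fact (Suc n)) *\<^sub>R y (Suc n))" for s
      by (subst sum.lessThan_Suc_shift) simp
    have p: "((\<lambda>s. (s ^ Suc n / fact (Suc n)) *\<^sub>R y (Suc n)) has_vector_derivative (s ^ n / fact n) *\<^sub>R y (Suc n)) (at s)" for n s
    proof -
      have "((\<lambda>s. s ^ Suc n / fact (Suc n)) has_real_derivative (s ^ n / fact n)) (at s)"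
        using DERIV_cdivide[OF DERIV_pow[of "Suc n" s], of "fact (Suc n)"]
        by (simp add: fact_Suc del: power_Suc of_nat_Suc)
      from has_vector_derivative_scaleR[OF this has_vector_derivative_const[of "y (Suc n)"]]
      show ?thesis by simp
    qed
    have "((\<lambda>s. y 0 + (\<Sum>n<N. (s ^ Suc n / fact (Suc n)) *\<^sub>R y (Suc n))) has_vector_derivative
        (0 + (\<Sum>n<N. (s ^ n / fact n) *\<^sub>R y (Suc n)))) (at s)"
      by (intro has_vector_derivative_add has_vector_derivative_sum has_vector_derivative_const p)
    from has_vector_derivative_diff[OF generator_has_vector_derivative[OF Suc.prems(1)[of 0], of s] this]
    show ?thesis unfolding e by simp
  qed
  have \<phi>': "(?\<phi> has_vector_derivative M * (C * \<tau>) * \<tau> ^ N * s ^ N / fact N) (at s)" for s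
    unfolding has_real_derivative_iff_has_vector_derivative[symmetric]
    using DERIV_cdivide[OF DERIV_cmult[OF DERIV_pow[of "Suc N" s], of "M * C * \<tau> ^ Suc N"], of "fact (Suc N)"]
    by (simp add: fact_Suc mult_ac del: of_nat_Suc)
  show ?case
  proof (cases "s = 0")
    case True
    then show ?thesis by (simp add: sum.lessThan_Suc_shift del: sum.lessThan_Suc)
  next
    case False
    with Suc.prems(3) have s: "0 < s" by simp
    have "norm (?f s - ?f 0) \<le> ?\<phi> s - ?\<phi> 0"
    proof (rule differentiable_bound_general[OF s])
      show "continuous_on {0..s} ?f"
        by (intro continuous_at_imp_continuous_on ballI has_vector_derivative_continuous[OF f'])
      show "continuous_on {0..s} ?\<phi>" by (intro continuous_intros) auto
    qed (use f' \<phi>' IH in auto)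
    moreover have "?f 0 = 0" by (simp add: sum.lessThan_Suc_shift del: sum.lessThan_Suc)
    ultimately show ?thesis by simp
  qed
qed

lemma taylor_sums_nonneg:
  assumes "\<And>n. (y n, y (Suc n)) \<in> generator \<psi> v" "\<And>n. norm (y n) \<le> C * \<tau> ^ n" "0 \<le> s"
  shows "(\<lambda>n. (s ^ n / fact n) *\<^sub>R y n) sums \<psi> (s *\<^sub>R v) (y 0)"
  unfolding sums_def
proof (rule LIM_zero_cancel, rule Lim_null_comparison)
  show "\<forall>\<^sub>F N in sequentially. norm ((\<Sum>n<N. (s ^ n / fact n) *\<^sub>R y n) - \<psi> (s *\<^sub>R v) (y 0)) \<le> M * C * ((\<tau> * s) ^ N / fact N)"
    using taylor_remainder[of y v C \<tau> s] assms
    by (simp add: norm_minus_commute power_mult_distrib mult_ac)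
  have "(\<lambda>N. (\<tau> * s) ^ N / fact N) \<longlonglongrightarrow> 0"
    by (rule summable_LIMSEQ_zero) (use summable_exp[of "\<tau> * s"] in \<open>simp add: divide_inverse mult.commute\<close>)
  then show "(\<lambda>N. M * C * ((\<tau> * s) ^ N / fact N)) \<longlonglongrightarrow> 0"
    by (rule tendsto_mult_right_zero)
qed

lemma taylor_sums:
  assumes y: "\<And>n. (y n, y (Suc n)) \<in> generator \<psi> v" "\<And>n. norm (y n) \<le> C * \<tau> ^ n"
  shows "(\<lambda>n. (s ^ n / fact n) *\<^sub>R y n) sums \<psi> (s *\<^sub>R v) (y 0)"
proof (cases "0 \<le> s")
  case True
  then show ?thesis using taylor_sums_nonneg[OF y] by simp
next
  case False
  \<comment> \<open>Negative times are reached by reversing the direction \<open>v\<close>, which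
    alternates the signs of the derivatives and leaves their norms unchanged.\<close>
  let ?z = "\<lambda>n. (-1) ^ n *\<^sub>R y n"
  have "(?z n, ?z (Suc n)) \<in> generator \<psi> (- v)" for n
    using generator_scaleR[OF generator_uminus[OF y(1)[of n]], of "(-1) ^ n"] by simp
  moreover have "norm (?z n) \<le> C * \<tau> ^ n" for n using y(2)[of n] by simp
  ultimately have "(\<lambda>n. ((- s) ^ n / fact n) *\<^sub>R ?z n) sums \<psi> ((- s) *\<^sub>R (- v)) (?z 0)"
    using False by (intro taylor_sums_nonneg) auto
  moreover have "((- s) ^ n / fact n) *\<^sub>R ?z n = (s ^ n / fact n) *\<^sub>R y n" for n
  proof -
    have "(- s) ^ n * (-1) ^ n = s ^ n" by (simp add: power_mult_distrib[symmetric])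
    then show ?thesis by (simp only: scaleR_scaleR times_divide_eq_left)
  qed
  ultimately show ?thesis by (simp only: scaleR_minus_left scaleR_minus_right minus_minus power_0 scaleR_one)
qed

text \<open>\<open>C\<close> is absent from the conclusion: it enters only through the truncation
  error, which tends to 0. The 8 is the 4 in the choice of \<open>h\<close> times the bound 2 for
  the sum of the arsinh coefficients.\<close>

theorem bernstein:
  assumes y: "\<And>n. (y n, y (Suc n)) \<in> generator \<psi> v" "\<And>n. norm (y n) \<le> C * \<tau> ^ n" and \<tau>: "\<tau> > 0"
  shows "norm (y 1) \<le> 8 * M * \<tau> * norm (y 0)"
proof -
  \<comment> \<open>With this step \<open>norm (y n) * h ^ n \<le> C / 4 ^ n\<close>, a decay that
    is later split into two factors \<open>1 / 2 ^ n\<close>.\<close>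
  define h where "h = 1 / (4 * \<tau>)"
  have h: "h > 0" "h * \<tau> = 1 / 4" using \<tau> by (auto simp: h_def)
  have C: "C \<ge> 0" using order_trans[OF norm_ge_zero y(2)[of 0]] by simp
  \<comment> \<open>\<open>Q i\<close> is the \<open>i\<close>-th power of the symmetric difference
    with step \<open>h\<close> applied to \<open>y 0\<close>, expanded into translates.\<close>
  define Q where "Q i = (\<Sum>k\<le>i. sinh_weight i k *\<^sub>R \<psi> (((real i - 2 * real k) * h) *\<^sub>R v) (y 0))" for i
  let ?c = "\<lambda>i n. fps_nth (sinh_fps ^ i) n" and ?L = "fps_nth arsinh_fps"
  have Q_sums: "(\<lambda>n. (?c i n * h ^ n) *\<^sub>R y n) sums Q i" for i
  proof -
    have "(\<lambda>n. sinh_weight i k *\<^sub>R ((((real i - 2 * real k) * h) ^ n / fact n) *\<^sub>R y n)) sums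
        (sinh_weight i k *\<^sub>R \<psi> (((real i - 2 * real k) * h) *\<^sub>R v) (y 0))" for k
      by (intro sums_scaleR_right taylor_sums[OF y])
    then have "(\<lambda>n. \<Sum>k\<le>i. sinh_weight i k *\<^sub>R ((((real i - 2 * real k) * h) ^ n / fact n) *\<^sub>R y n)) sums Q i"
      unfolding Q_def by (rule sums_sum)
    moreover have "(\<Sum>k\<le>i. sinh_weight i k *\<^sub>R ((((real i - 2 * real k) * h) ^ n / fact n) *\<^sub>R y n)) = (?c i n * h ^ n) *\<^sub>R y n" for n
      unfolding sinh_fps_power_nth sum_distrib_right scaleR_sum_left
      by (rule sum.cong) (simp_all add: power_mult_distrib mult_ac)
    ultimately show ?thesis by simp
  qed
  have Q_norm: "norm (Q i) \<le> M * norm (y 0)" for i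
  proof -
    have "norm (Q i) \<le> (\<Sum>k\<le>i. \<bar>sinh_weight i k\<bar> * (M * norm (y 0)))"
      unfolding Q_def by (intro sum_norm_le) (auto intro!: mult_left_mono norm_psi_le)
    also have "\<dots> = M * norm (y 0)" by (simp add: sum_distrib_right[symmetric] sum_abs_sinh_weight)
    finally show ?thesis .
  qed
  have c0: "?c i n \<ge> 0" for i n by (rule fps_nonneg_power[OF sinh_fps_nonneg])
  \<comment> \<open>This keeps all powers of \<open>sinh (1/2)\<close> at most 1, so summability of
    the arsinh coefficients at 1 bounds the remainder as well.\<close>
  have sinh_half: "0 \<le> sinh (1/2::real)" "sinh (1/2::real) \<le> 1"
  proof -
    have "exp (1/2::real) ^ 2 = exp 1" by (simp add: exp_of_nat_mult[symmetric])
    also have "\<dots> \<le> 2 ^ 2" using exp_le by simp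
    finally have "exp (1/2::real) \<le> 2" by (rule power2_le_imp_le) simp
    then show "sinh (1/2::real) \<le> 1" using exp_gt_zero[of "-(1/2)::real"] unfolding sinh_def
      by (simp del: exp_gt_zero)
  qed simp
  have key: "h * norm (y 1) \<le> 2 * (M * norm (y 0)) + 2 * C * (1/2) ^ N" if N: "N \<ge> 2" for N
  proof -
    \<comment> \<open>The coefficients of the identity series minus the first \<open>N\<close> terms
      of arsinh composed with sinh. They vanish below \<open>N\<close>, because
      \<open>sinh ^ i\<close> starts at order \<open>i\<close> and the full composition is
      \<open>fps_X\<close>.\<close>
    define d where "d n = (if n = 1 then 1 else 0) - (\<Sum>i<N. ?L i * ?c i n)" for n :: nat
    have d0: "d n = 0" if "n < N" for n
    proof -
      have "(\<Sum>i<N. ?L i * ?c i n) = (\<Sum>i=0..n. ?L i * ?c i n)"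
        using that by (intro sum.mono_neutral_right) (auto simp: startsby_zero_power_prefix)
      also have "\<dots> = fps_nth (fps_compose arsinh_fps sinh_fps) n" by (simp add: fps_compose_nth)
      finally show ?thesis unfolding arsinh_fps_compose_sinh_fps d_def by (simp add: fps_X_def)
    qed
    have d1: "\<bar>d n\<bar> \<le> (\<Sum>i<N. \<bar>?L i\<bar> * ?c i n)" if "n \<ge> N" for n
    proof -
      have "d n = - (\<Sum>i<N. ?L i * ?c i n)" using that N by (simp add: d_def)
      then show ?thesis using sum_abs[of "\<lambda>i. ?L i * ?c i n" "{..<N}"] c0 by (simp add: abs_mult)
    qed
    have s1: "(\<lambda>n. ((if n = 1 then 1 else 0) * h ^ n) *\<^sub>R y n) sums (h *\<^sub>R y 1)"
    proof -
      have "(\<lambda>n. ((if n = 1 then 1 else 0) * h ^ n) *\<^sub>R y n) = (\<lambda>n. if n = 1 then h ^ n *\<^sub>R y n else 0)"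
        by (rule ext) simp
      then show ?thesis using sums_single[of 1 "\<lambda>n. h ^ n *\<^sub>R y n"] by simp
    qed
    have s2: "(\<lambda>n. ((\<Sum>i<N. ?L i * ?c i n) * h ^ n) *\<^sub>R y n) sums (\<Sum>i<N. ?L i *\<^sub>R Q i)"
    proof -
      have "(\<lambda>n. \<Sum>i<N. ?L i *\<^sub>R ((?c i n * h ^ n) *\<^sub>R y n)) sums (\<Sum>i<N. ?L i *\<^sub>R Q i)"
        by (intro sums_sum sums_scaleR_right Q_sums)
      then show ?thesis by (simp add: sum_distrib_right scaleR_sum_left mult.assoc)
    qed
    have s3: "(\<lambda>n. (d n * h ^ n) *\<^sub>R y n) sums (h *\<^sub>R y 1 - (\<Sum>i<N. ?L i *\<^sub>R Q i))"
      using sums_diff[OF s1 s2] by (simp add: d_def left_diff_distrib scaleR_diff_left)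
    \<comment> \<open>For \<open>n \<ge> N\<close> one of the two factors \<open>(1/2) ^ n\<close>
      is at most \<open>(1/2) ^ N\<close>; the other one is the argument at which the powers of sinh
      are summed.\<close>
    define g where "g n = C * (1/2) ^ N * (\<Sum>i<N. \<bar>?L i\<bar> * (?c i n * (1/2) ^ n))" for n
    have g_sums: "g sums (C * (1/2) ^ N * (\<Sum>i<N. \<bar>?L i\<bar> * sinh (1/2) ^ i))"
      unfolding g_def by (intro sums_mult sums_sum sinh_fps_power_sums)
    have le: "norm ((d n * h ^ n) *\<^sub>R y n) \<le> g n" for n
    proof (cases "n < N")
      case True
      then show ?thesis using C c0 by (auto simp: d0 g_def intro!: mult_nonneg_nonneg sum_nonneg)
    next
      case False
      have "norm ((d n * h ^ n) *\<^sub>R y n) \<le> (\<Sum>i<N. \<bar>?L i\<bar> * ?c i n) * h ^ n * (C * \<tau> ^ n)"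
        using d1[of n] False h y(2)[of n] c0
        by (auto simp: abs_mult intro!: mult_mono mult_nonneg_nonneg sum_nonneg)
      also have "\<dots> = C * (1/4) ^ n * (\<Sum>i<N. \<bar>?L i\<bar> * ?c i n)"
        unfolding h(2)[symmetric] power_mult_distrib by (simp add: mult_ac)
      also have "(1/4) ^ n = (1/2::real) ^ n * (1/2) ^ n" by (simp add: power_mult_distrib[symmetric])
      also have "C * ((1/2::real) ^ n * (1/2) ^ n) * (\<Sum>i<N. \<bar>?L i\<bar> * ?c i n) \<le> C * ((1/2) ^ N * (1/2) ^ n) * (\<Sum>i<N. \<bar>?L i\<bar> * ?c i n)"
        using False C c0
        by (intro mult_right_mono mult_left_mono power_decreasing) (auto intro!: sum_nonneg)
      also have "\<dots> = g n" by (simp add: g_def sum_distrib_left mult_ac)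
      finally show ?thesis .
    qed
    have "norm (h *\<^sub>R y 1 - (\<Sum>i<N. ?L i *\<^sub>R Q i)) \<le> C * (1/2) ^ N * (\<Sum>i<N. \<bar>?L i\<bar> * sinh (1/2) ^ i)"
      using norm_suminf_le[OF le sums_summable[OF g_sums]] sums_unique[OF s3] sums_unique[OF g_sums] by simp
    also have "\<dots> \<le> C * (1/2) ^ N * (\<Sum>i<N. \<bar>?L i\<bar> * 1)"
      using C sinh_half by (intro mult_left_mono sum_mono power_le_one) auto
    also have "\<dots> \<le> C * (1/2) ^ N * 2"
      using C sum_abs_arsinh_fps_le[of N] by (intro mult_left_mono) auto
    finally have a: "norm (h *\<^sub>R y 1 - (\<Sum>i<N. ?L i *\<^sub>R Q i)) \<le> 2 * C * (1/2) ^ N" by simp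
    have "norm (\<Sum>i<N. ?L i *\<^sub>R Q i) \<le> (\<Sum>i<N. \<bar>?L i\<bar> * (M * norm (y 0)))"
      by (intro sum_norm_le) (auto intro!: mult_left_mono Q_norm)
    also have "\<dots> \<le> 2 * (M * norm (y 0))"
      unfolding sum_distrib_right[symmetric] using M_nonneg sum_abs_arsinh_fps_le[of N] by (intro mult_right_mono) auto
    finally have b: "norm (\<Sum>i<N. ?L i *\<^sub>R Q i) \<le> 2 * (M * norm (y 0))" .
    have "norm (h *\<^sub>R y 1) \<le> norm (h *\<^sub>R y 1 - (\<Sum>i<N. ?L i *\<^sub>R Q i)) + norm (\<Sum>i<N. ?L i *\<^sub>R Q i)"
      by (metis add.commute norm_triangle_sub)
    then show ?thesis using a b h(1) by simp
  qed
  have lim: "(\<lambda>N. 2 * (M * norm (y 0)) + 2 * C * (1/2) ^ N) \<longlonglongrightarrow> 2 * (M * norm (y 0)) + 2 * C * 0"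
    by (intro tendsto_intros LIMSEQ_power_zero) auto
  have "h * norm (y 1) \<le> 2 * (M * norm (y 0)) + 2 * C * 0"
    by (rule LIMSEQ_le_const[OF lim]) (use key in blast)
  then show ?thesis using \<tau> by (simp add: h_def field_simps)
qed

section \<open>Mixed generators and the scheme of bandlimited elements\<close>

definition invariant_subspace_rel :: "('a \<times> 'a) set \<Rightarrow> bool" where
  "invariant_subspace_rel R \<longleftrightarrow> (\<forall>x y x' y'. (x, y) \<in> R \<longrightarrow> (x', y') \<in> R \<longrightarrow> (x + x', y + y') \<in> R) \<and>
     (\<forall>c x y. (x, y) \<in> R \<longrightarrow> (c *\<^sub>R x, c *\<^sub>R y) \<in> R) \<and>
     (\<forall>t x y. (x, y) \<in> R \<longrightarrow> (\<psi> t x, \<psi> t y) \<in> R)"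

lemma invariant_subspace_rel_Id: "invariant_subspace_rel Id"
  by (auto simp: invariant_subspace_rel_def)

lemma invariant_subspace_rel_O:
  "invariant_subspace_rel R \<Longrightarrow> invariant_subspace_rel S \<Longrightarrow> invariant_subspace_rel (R O S)"
  unfolding invariant_subspace_rel_def relcomp_unfold by fastforce

lemma invariant_subspace_rel_relpow: "invariant_subspace_rel R \<Longrightarrow> invariant_subspace_rel (R ^^ n)"
  by (induction n) (simp_all add: invariant_subspace_rel_Id invariant_subspace_rel_O)

lemma invariant_subspace_rel_generator: "invariant_subspace_rel (generator \<psi> v)"
  unfolding invariant_subspace_rel_def by (auto intro: generator_add generator_scaleR generator_psi)

text \<open>Additivity, homogeneity and commutation with the group are inherited by relational
  composition. Thus they pass from a single generator to all mixed ones, with domains respected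
  throughout.\<close>

lemma invariant_subspace_rel_multi_generator: "invariant_subspace_rel (multi_generator \<psi> \<alpha>)"
proof -
  have "invariant_subspace_rel (fold (\<lambda>j S. (generator \<psi> (axis j 1) ^^ \<alpha> j) O S) xs S)" if "invariant_subspace_rel S" for xs S
    using that
    by (induction xs arbitrary: S)
      (simp_all add: invariant_subspace_rel_O invariant_subspace_rel_relpow invariant_subspace_rel_generator)
  then show ?thesis by (simp add: multi_generator_def invariant_subspace_rel_Id)
qed

text \<open>Extracts pure derivatives along one axis from the mixed ones, the input for the
  one-parameter Bernstein inequality.\<close>

lemma multi_generator_single:
  "multi_generator \<psi> (\<lambda>i. if i = j then n else 0) = generator \<psi> (axis j 1) ^^ n"
proof -
  have "fold (\<lambda>i S. (generator \<psi> (axis i 1) ^^ (if i = j then n else 0)) O S) xs S =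
      (if j \<in> set xs then (generator \<psi> (axis j 1) ^^ n) O S else S)" if "distinct xs" for xs S
    using that by (induction xs arbitrary: S) auto
  from this[of "sorted_list_of_set UNIV" Id] show ?thesis by (simp add: multi_generator_def)
qed

text \<open>\<open>multi_generator\<close> fixes an order of the coordinates. A family in which
  every index can be raised in every direction contains a path from 0 to \<open>\<alpha>\<close> in
  any such order.\<close>

lemma multi_generator_family:
  assumes "\<And>\<alpha> j. (D \<alpha>, D (\<alpha>(j := Suc (\<alpha> j)))) \<in> generator \<psi> (axis j 1)"
  shows "(D (\<lambda>_. 0), D \<alpha>) \<in> multi_generator \<psi> \<alpha>"
proof -
  have pow: "(D (\<beta>(j := 0)), D (\<beta>(j := n))) \<in> generator \<psi> (axis j 1) ^^ n" for \<beta> j n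
  proof (induction n)
    case (Suc n)
    moreover have "(D (\<beta>(j := n)), D (\<beta>(j := Suc n))) \<in> generator \<psi> (axis j 1)"
      using assms[of "\<beta>(j := n)" j] by simp
    ultimately show ?case unfolding relpow.simps by (rule relcompI)
  qed simp
  \<comment> \<open>Invariant of the fold: \<open>A\<close> holds the coordinates already processed.
    New factors are composed on the left, so it is the starting multi-index that gets zeroed while
    the end stays at \<open>\<alpha>\<close>.\<close>
  have "(D (\<lambda>i. if i \<in> A then 0 else \<alpha> i), D \<alpha>) \<in> S \<Longrightarrow> A \<inter> set xs = {} \<Longrightarrow> distinct xs \<Longrightarrow>
     (D (\<lambda>i. if i \<in> A \<union> set xs then 0 else \<alpha> i), D \<alpha>) \<in> fold (\<lambda>j S. (generator \<psi> (axis j 1) ^^ \<alpha> j) O S) xs S" for xs A S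
  proof (induction xs arbitrary: A S)
    case (Cons j xs)
    let ?\<beta> = "\<lambda>i. if i \<in> A then 0 else \<alpha> i"
    have e: "?\<beta>(j := 0) = (\<lambda>i. if i \<in> insert j A then 0 else \<alpha> i)" "?\<beta>(j := \<alpha> j) = ?\<beta>"
      using Cons.prems by (auto simp: fun_eq_iff)
    have "(D (\<lambda>i. if i \<in> insert j A then 0 else \<alpha> i), D ?\<beta>) \<in> generator \<psi> (axis j 1) ^^ \<alpha> j"
      using pow[of ?\<beta> j "\<alpha> j"] unfolding e .
    then have "(D (\<lambda>i. if i \<in> insert j A then 0 else \<alpha> i), D \<alpha>) \<in> (generator \<psi> (axis j 1) ^^ \<alpha> j) O S"
      using Cons.prems(1) by blast
    from Cons.IH[OF this] Cons.prems show ?case by simp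
  qed simp
  from this[of "{}" Id "sorted_list_of_set UNIV"] show ?thesis by (simp add: multi_generator_def)
qed

abbreviation "X \<equiv> bandlimited_scheme \<psi>"

lemma in_X_iff: "\<sigma> > 0 \<Longrightarrow> a \<in> X \<sigma> \<longleftrightarrow> bandlimited \<psi> \<sigma> a"
  by (simp add: bandlimited_scheme_def)

lemma bandlimitedE:
  assumes "bandlimited \<psi> \<sigma> a" "\<sigma> \<ge> 0"
  obtains C where "C \<ge> 0" "\<And>\<alpha>. \<exists>b. (a, b) \<in> multi_generator \<psi> \<alpha> \<and> norm b \<le> C * (2 * pi * \<sigma>) ^ (\<Sum>j\<in>UNIV. \<alpha> j)"
proof -
  obtain C where C: "\<And>\<alpha>. \<exists>b. (a, b) \<in> multi_generator \<psi> \<alpha> \<and> norm b \<le> C * (2 * pi * \<sigma>) ^ (\<Sum>j\<in>UNIV. \<alpha> j)"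
    using assms(1) unfolding bandlimited_def by blast
  obtain b :: 'a where "norm b \<le> C" using C[of "\<lambda>_. 0"] by auto
  then have "C \<ge> 0" using norm_ge_zero[of b] by linarith
  then show thesis using C that by blast
qed

lemma bandlimited_add:
  assumes "bandlimited \<psi> \<sigma> a" "bandlimited \<psi> \<sigma> a'"
  shows "bandlimited \<psi> \<sigma> (a + a')"
proof -
  obtain C C' where
    C: "\<And>\<alpha>. \<exists>b. (a, b) \<in> multi_generator \<psi> \<alpha> \<and> norm b \<le> C * (2 * pi * \<sigma>) ^ (\<Sum>j\<in>UNIV. \<alpha> j)" and
    C': "\<And>\<alpha>. \<exists>b. (a', b) \<in> multi_generator \<psi> \<alpha> \<and> norm b \<le> C' * (2 * pi * \<sigma>) ^ (\<Sum>j\<in>UNIV. \<alpha> j)"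
    using assms unfolding bandlimited_def by blast
  have "\<exists>b. (a + a', b) \<in> multi_generator \<psi> \<alpha> \<and> norm b \<le> (C + C') * (2 * pi * \<sigma>) ^ (\<Sum>j\<in>UNIV. \<alpha> j)" for \<alpha>
  proof -
    obtain b b' where b: "(a, b) \<in> multi_generator \<psi> \<alpha>" "norm b \<le> C * (2 * pi * \<sigma>) ^ (\<Sum>j\<in>UNIV. \<alpha> j)"
       "(a', b') \<in> multi_generator \<psi> \<alpha>" "norm b' \<le> C' * (2 * pi * \<sigma>) ^ (\<Sum>j\<in>UNIV. \<alpha> j)"
      using C C' by meson
    have "(a + a', b + b') \<in> multi_generator \<psi> \<alpha>"
      using invariant_subspace_rel_multi_generator[of \<alpha>] b unfolding invariant_subspace_rel_def by blast
    moreover have "norm (b + b') \<le> (C + C') * (2 * pi * \<sigma>) ^ (\<Sum>j\<in>UNIV. \<alpha> j)"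
      using norm_triangle_le[OF add_mono[OF b(2,4)]] by (simp add: distrib_right)
    ultimately show ?thesis by blast
  qed
  then show ?thesis unfolding bandlimited_def by blast
qed

lemma bandlimited_image:
  assumes "bandlimited \<psi> \<sigma> a" "0 \<le> L" "\<And>x. norm (T x) \<le> L * norm x"
    and T: "\<And>\<alpha> x y. (x, y) \<in> multi_generator \<psi> \<alpha> \<Longrightarrow> (T x, T y) \<in> multi_generator \<psi> \<alpha>"
  shows "bandlimited \<psi> \<sigma> (T a)"
proof -
  obtain C where
    C: "\<And>\<alpha>. \<exists>b. (a, b) \<in> multi_generator \<psi> \<alpha> \<and> norm b \<le> C * (2 * pi * \<sigma>) ^ (\<Sum>j\<in>UNIV. \<alpha> j)"
    using assms(1) unfolding bandlimited_def by blast
  have "\<exists>b. (T a, b) \<in> multi_generator \<psi> \<alpha> \<and> norm b \<le> (L * C) * (2 * pi * \<sigma>) ^ (\<Sum>j\<in>UNIV. \<alpha> j)" for \<alpha>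
  proof -
    obtain b where b: "(a, b) \<in> multi_generator \<psi> \<alpha>" "norm b \<le> C * (2 * pi * \<sigma>) ^ (\<Sum>j\<in>UNIV. \<alpha> j)"
      using C by meson
    have "norm (T b) \<le> (L * C) * (2 * pi * \<sigma>) ^ (\<Sum>j\<in>UNIV. \<alpha> j)"
      using order_trans[OF assms(3) mult_left_mono[OF b(2) assms(2)]] by (simp add: mult.assoc)
    then show ?thesis using T[OF b(1)] by blast
  qed
  then show ?thesis unfolding bandlimited_def by blast
qed

lemma bandlimited_scaleR: "bandlimited \<psi> \<sigma> a \<Longrightarrow> bandlimited \<psi> \<sigma> (c *\<^sub>R a)"
  using invariant_subspace_rel_multi_generator unfolding invariant_subspace_rel_def
  by (intro bandlimited_image[of \<sigma> a "\<bar>c\<bar>" "(*\<^sub>R) c"]) auto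

lemma bandlimited_psi: "bandlimited \<psi> \<sigma> a \<Longrightarrow> bandlimited \<psi> \<sigma> (\<psi> t a)"
  using invariant_subspace_rel_multi_generator unfolding invariant_subspace_rel_def
  by (intro bandlimited_image[of \<sigma> a M "\<psi> t"]) (auto simp: M_nonneg norm_psi_le)

lemma bandlimited_diff:
  assumes "bandlimited \<psi> \<sigma> a" "bandlimited \<psi> \<sigma> b"
  shows "bandlimited \<psi> \<sigma> (a - b)"
  using bandlimited_add[OF assms(1) bandlimited_scaleR[OF assms(2), of "-1"]] by simp

lemma bandlimited_mono:
  assumes "bandlimited \<psi> \<sigma> a" "0 \<le> \<sigma>" "\<sigma> \<le> \<sigma>'"
  shows "bandlimited \<psi> \<sigma>' a"
proof -
  obtain C where C: "C \<ge> 0" "\<And>\<alpha>. \<exists>b. (a, b) \<in> multi_generator \<psi> \<alpha> \<and> norm b \<le> C * (2 * pi * \<sigma>) ^ (\<Sum>j\<in>UNIV. \<alpha> j)"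
    using bandlimitedE[OF assms(1,2)] by blast
  have "C * (2 * pi * \<sigma>) ^ n \<le> C * (2 * pi * \<sigma>') ^ n" for n
    using C(1) assms by (intro mult_left_mono power_mono) auto
  then show ?thesis unfolding bandlimited_def using C(2) by (meson order_trans)
qed

lemma bandlimited_zero: "bandlimited \<psi> \<sigma> 0"
proof -
  have "(0, 0) \<in> generator \<psi> v" for v
    unfolding generator_def by simp
  then have "(0, 0) \<in> multi_generator \<psi> \<alpha>" for \<alpha>
    using multi_generator_family[of "\<lambda>_. 0" \<alpha>] by simp
  then show ?thesis unfolding bandlimited_def by (intro exI[of _ 0]) auto
qed

lemma zero_in_X: "0 \<in> X \<sigma>"
  by (simp add: bandlimited_scheme_def bandlimited_zero)

lemma X_mono: "0 \<le> \<sigma> \<Longrightarrow> \<sigma> \<le> \<sigma>' \<Longrightarrow> X \<sigma> \<subseteq> X \<sigma>'"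
  using bandlimited_mono bandlimited_zero by (auto simp: bandlimited_scheme_def split: if_splits)

lemma X_diff: "a \<in> X \<sigma> \<Longrightarrow> b \<in> X \<sigma> \<Longrightarrow> a - b \<in> X \<sigma>"
  using bandlimited_diff by (auto simp: bandlimited_scheme_def split: if_splits)

lemma X_psi: "a \<in> X \<sigma> \<Longrightarrow> \<psi> t a \<in> X \<sigma>"
  using bandlimited_psi by (auto simp: bandlimited_scheme_def split: if_splits)

section \<open>Bernstein estimates for differences\<close>

lemma relpow_generator_unique:
  "(a, b) \<in> generator \<psi> v ^^ n \<Longrightarrow> (a, c) \<in> generator \<psi> v ^^ n \<Longrightarrow> b = c"
proof (induction n arbitrary: b c)
  case (Suc n)
  then obtain b' c' where *: "(a, b') \<in> generator \<psi> v ^^ n" "(b', b) \<in> generator \<psi> v"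
    "(a, c') \<in> generator \<psi> v ^^ n" "(c', c) \<in> generator \<psi> v"
    by auto
  have "b' = c'" by (rule Suc.IH[OF *(1,3)])
  then show ?case using * generator_unique by blast
qed auto

text \<open>Bernstein bounds the first derivative along the axis by
  \<open>8 * M * (2 * pi * \<sigma>)\<close> times the norm, and the mean value inequality
  contributes the second \<open>M\<close> and \<open>\<bar>s\<bar>\<close>.\<close>

lemma bandlimited_psi_axis_diff:
  assumes "bandlimited \<psi> \<sigma> a" "\<sigma> > 0"
  shows "norm (\<psi> (s *\<^sub>R axis j 1) a - a) \<le> 16 * pi * M\<^sup>2 * \<sigma> * \<bar>s\<bar> * norm a"
proof -
  let ?v = "axis j 1 :: real ^ 'd::{finite,linorder}"
  obtain C where C: "C \<ge> 0" "\<And>\<alpha>. \<exists>b. (a, b) \<in> multi_generator \<psi> \<alpha> \<and> norm b \<le> C * (2 * pi * \<sigma>) ^ (\<Sum>j\<in>UNIV. \<alpha> j)"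
    using bandlimitedE[OF assms(1)] assms(2) by (metis less_imp_le)
  have "\<exists>b. (a, b) \<in> generator \<psi> ?v ^^ n \<and> norm b \<le> C * (2 * pi * \<sigma>) ^ n" for n
    using C(2)[of "\<lambda>i. if i = j then n else 0"] by (simp add: multi_generator_single)
  then obtain y where y: "\<And>n. (a, y n) \<in> generator \<psi> ?v ^^ n" "\<And>n. norm (y n) \<le> C * (2 * pi * \<sigma>) ^ n"
    by metis
  \<comment> \<open>The \<open>y n\<close> were chosen separately for each order; single-valuedness
    of the powers makes them successive derivatives.\<close>
  have g: "(y n, y (Suc n)) \<in> generator \<psi> ?v" for n
  proof -
    obtain z where "(a, z) \<in> generator \<psi> ?v ^^ n" "(z, y (Suc n)) \<in> generator \<psi> ?v"
      using y(1)[of "Suc n"] by auto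
    then show ?thesis using relpow_generator_unique y(1) by metis
  qed
  have y0: "y 0 = a" using y(1)[of 0] by simp
  have "norm (y 1) \<le> 8 * M * (2 * pi * \<sigma>) * norm a"
    using bernstein[OF g y(2)] assms(2) unfolding y0 by simp
  moreover have "norm (\<psi> (s *\<^sub>R ?v) a - a) \<le> M * \<bar>s\<bar> * norm (y 1)"
    using norm_psi_diff_le_generator[OF g[of 0]] unfolding y0 by simp
  ultimately have "norm (\<psi> (s *\<^sub>R ?v) a - a) \<le> M * \<bar>s\<bar> * (8 * M * (2 * pi * \<sigma>) * norm a)"
    using M_nonneg by (meson abs_ge_zero mult_left_mono mult_nonneg_nonneg order_trans)
  then show ?thesis by (simp add: power2_eq_square mult_ac)
qed

text \<open>The path from 0 to \<open>t\<close> runs parallel to the axes. Each leg is a translate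
  of a difference along one axis, and translating costs \<open>M\<close>.\<close>

lemma norm_psi_diff_le_axes:
  "norm (\<psi> t a - a) \<le> M * (\<Sum>j\<in>UNIV. norm (\<psi> (t $ j *\<^sub>R axis j 1) a - a))"
proof -
  have ind: "norm (\<psi> (\<Sum>j\<in>S. t $ j *\<^sub>R axis j 1) a - a) \<le> M * (\<Sum>j\<in>S. norm (\<psi> (t $ j *\<^sub>R axis j 1) a - a))" if "finite S" for S
    using that
  proof (induction S rule: finite_induct)
    case (insert j S)
    let ?x = "\<Sum>j\<in>S. t $ j *\<^sub>R (axis j 1 :: real ^ 'd::{finite,linorder})" and ?u = "t $ j *\<^sub>R (axis j 1 :: real ^ 'd::{finite,linorder})"
    have "\<psi> (?x + ?u) a - a = \<psi> ?x (\<psi> ?u a - a) + (\<psi> ?x a - a)"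
      by (simp add: psi_diff psi_psi)
    then have "norm (\<psi> (?x + ?u) a - a) \<le> norm (\<psi> ?x (\<psi> ?u a - a)) + norm (\<psi> ?x a - a)"
      by (simp only: norm_triangle_ineq)
    also have "\<dots> \<le> M * norm (\<psi> ?u a - a) + M * (\<Sum>j\<in>S. norm (\<psi> (t $ j *\<^sub>R axis j 1) a - a))"
      by (intro add_mono norm_psi_le insert.IH)
    finally show ?case using insert.hyps by (simp add: distrib_left add.commute)
  qed simp
  have "(\<Sum>j\<in>UNIV. t $ j *\<^sub>R axis j 1) = t"
    using basis_expansion[of t] by (simp add: scalar_mult_eq_scaleR)
  then show ?thesis using ind[OF finite[of UNIV]] by (simp only:)
qed

text \<open>The factor \<open>16 * pi * M ^ 2\<close> comes from a single axis, the third
  \<open>M\<close> from splitting a general translation into axis-parallel ones.\<close>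

definition bernstein_const :: real where "bernstein_const = 16 * pi * M ^ 3"

lemma bernstein_const_nonneg: "0 \<le> bernstein_const"
  using M_nonneg by (simp add: bernstein_const_def)

text \<open>The first-order estimate can be iterated because \<open>X \<sigma>\<close> is stable
  under translations and subtraction, hence under \<open>\<psi> t - id\<close>.\<close>

lemma X_difference:
  assumes "a \<in> X \<sigma>" "\<sigma> > 0"
  shows "norm (difference \<psi> t l a) \<le> (bernstein_const * \<sigma> * l1_norm t) ^ l * norm a"
  using assms
proof (induction l arbitrary: a)
  case (Suc l)
  have "norm (\<psi> t a - a) \<le> M * (\<Sum>j\<in>UNIV. norm (\<psi> (t $ j *\<^sub>R axis j 1) a - a))"
    by (rule norm_psi_diff_le_axes)
  also have "\<dots> \<le> M * (\<Sum>j\<in>UNIV. 16 * pi * M\<^sup>2 * \<sigma> * \<bar>t $ j\<bar> * norm a)"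
    using Suc.prems M_nonneg by (intro mult_left_mono sum_mono bandlimited_psi_axis_diff) (auto simp: in_X_iff)
  also have "\<dots> = bernstein_const * \<sigma> * l1_norm t * norm a"
    by (simp add: bernstein_const_def l1_norm_def sum_distrib_left sum_distrib_right power3_eq_cube power2_eq_square mult_ac)
  finally have 1: "norm (\<psi> t a - a) \<le> bernstein_const * \<sigma> * l1_norm t * norm a" .
  have "norm (difference \<psi> t (Suc l) a) \<le> (bernstein_const * \<sigma> * l1_norm t) ^ l * norm (\<psi> t a - a)"
    unfolding difference_Suc' using Suc.prems by (intro Suc.IH X_diff X_psi) auto
  also have "\<dots> \<le> (bernstein_const * \<sigma> * l1_norm t) ^ l * (bernstein_const * \<sigma> * l1_norm t * norm a)"
    using 1 Suc.prems by (intro mult_left_mono) (auto simp: bernstein_const_nonneg l1_norm_nonneg)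
  finally show ?case by (simp add: mult_ac)
qed simp

lemma X_modulus:
  assumes "a \<in> X \<sigma>" "\<sigma> > 0" "0 \<le> h"
  shows "\<omega> l h a \<le> (bernstein_const * \<sigma> * h) ^ l * norm a"
proof (rule modulus_le)
  fix t :: "real ^ 'd::{finite,linorder}" assume t: "l1_norm t \<le> h"
  have "norm (difference \<psi> t l a) \<le> (bernstein_const * \<sigma> * l1_norm t) ^ l * norm a"
    by (rule X_difference[OF assms(1,2)])
  also have "\<dots> \<le> (bernstein_const * \<sigma> * h) ^ l * norm a"
    using t assms by (intro mult_right_mono power_mono mult_left_mono)
      (auto simp: bernstein_const_nonneg l1_norm_nonneg)
  finally show "norm (difference \<psi> t l a) \<le> (bernstein_const * \<sigma> * h) ^ l * norm a" .
qed (use assms in auto)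

end

section \<open>Bandlimited approximants\<close>

text \<open>The decay \<open>l + 2\<close> of the kernel is matched to the order \<open>l\<close> of
  the differences: \<open>l\<close> powers compensate for dilating the modulus and two give
  integrability.\<close>

locale mollifier = bounded_group \<psi> M
  for \<psi> :: "real ^ 'd::{finite,linorder} \<Rightarrow> 'a::complex_banach_algebra \<Rightarrow> 'a" and M +
  fixes l :: nat and K \<tau> :: real and f :: "nat \<Rightarrow> real \<Rightarrow> real"
  assumes kernel: "kernel_class K \<tau> (l + 2) f" and kernel_int: "integral UNIV (f 0) = 1"
    and K_nonneg: "0 \<le> K" and \<tau>_pos: "0 < \<tau>" and l_pos: "0 < l"
begin

section \<open>Averages of translates along one axis\<close>

definition smooth :: "nat \<Rightarrow> real ^ 'd::{finite,linorder} \<Rightarrow> 'a \<Rightarrow> 'a" where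
  "smooth n v a = integral UNIV (\<lambda>t. f n t *\<^sub>R \<psi> (t *\<^sub>R v) a)"

definition weight :: "real \<Rightarrow> real" where "weight t = inverse (1 + \<bar>t\<bar>) ^ (l + 2)"

lemma weight_nonneg: "0 \<le> weight t" by (simp add: weight_def)

lemma f_deriv: "(f n has_real_derivative f (Suc n) t) (at t)"
  and f_bound: "\<bar>f n t\<bar> \<le> K * \<tau> ^ n * weight t"
  using kernel by (auto simp: kernel_class_def weight_def)

lemma weight_integrable: "weight integrable_on UNIV"
  using kernel_class_integrable(2)[OF kernel] by (simp add: weight_def[abs_def])

definition weight_integral :: real where "weight_integral = integral UNIV weight"

lemma weight_integral_nonneg: "0 \<le> weight_integral"
  unfolding weight_integral_def by (rule integral_nonneg[OF weight_integrable]) (rule weight_nonneg)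

lemma continuous_f: "continuous_on S (f n)"
  by (rule DERIV_continuous_on[of S "f n" "f (Suc n)"]) (auto intro: f_deriv has_field_derivative_at_within)

lemma continuous_psi_axis:
  assumes "a \<in> continuous_vectors"
  shows "continuous_on S (\<lambda>t. \<psi> (t *\<^sub>R (c *\<^sub>R axis j 1)) a)"
proof -
  have "isCont (\<lambda>s. \<psi> (s *\<^sub>R axis j 1) a) x" for x
  proof -
    have "((\<lambda>s. \<psi> (s *\<^sub>R axis j 1) a) \<longlongrightarrow> a) (at 0)"
      using assms by (simp add: continuous_vectors_def)
    then have "((\<lambda>s. \<psi> (x *\<^sub>R axis j 1) (\<psi> (s *\<^sub>R axis j 1) a)) \<longlongrightarrow> \<psi> (x *\<^sub>R axis j 1) a) (at 0)"
      by (rule bounded_linear.tendsto[OF bounded_linear_psi])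
    then have "((\<lambda>s. \<psi> ((x + s) *\<^sub>R axis j 1) a) \<longlongrightarrow> \<psi> (x *\<^sub>R axis j 1) a) (at 0)"
      by (simp add: psi_psi scaleR_add_left)
    then show ?thesis unfolding isCont_def by (rule LIM_offset_zero_cancel)
  qed
  then have "continuous_on UNIV (\<lambda>s. \<psi> (s *\<^sub>R axis j 1) a)" by (simp add: continuous_at_imp_continuous_on)
  then have "continuous_on S (\<lambda>t. \<psi> ((t * c) *\<^sub>R axis j 1) a)"
    by (rule continuous_on_compose2) (intro continuous_intros subset_UNIV)+
  then show ?thesis by simp
qed

text \<open>The kernel \<open>g\<close> is left general because it is instantiated both with the
  derivatives of \<open>f\<close> and with the remainder of a difference quotient.\<close>

lemma kernel_psi_integrable:
  assumes "a \<in> continuous_vectors" "continuous_on UNIV g" "\<And>t. \<bar>g t\<bar> \<le> B * weight t"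
  shows "(\<lambda>t. g t *\<^sub>R \<psi> (t *\<^sub>R (c *\<^sub>R axis j 1)) a) integrable_on UNIV"
    and "norm (integral UNIV (\<lambda>t. g t *\<^sub>R \<psi> (t *\<^sub>R (c *\<^sub>R axis j 1)) a)) \<le> B * weight_integral * (M * norm a)"
proof -
  have i: "(\<lambda>t. B * (M * norm a) * weight t) integrable_on UNIV"
    using integrable_on_cmult_left[OF weight_integrable] by simp
  have n: "norm (g t *\<^sub>R \<psi> (t *\<^sub>R (c *\<^sub>R axis j 1)) a) \<le> B * (M * norm a) * weight t" for t
  proof -
    have "\<bar>g t\<bar> * norm (\<psi> (t *\<^sub>R (c *\<^sub>R axis j 1)) a) \<le> (B * weight t) * (M * norm a)"
      using order_trans[OF abs_ge_zero assms(3)] by (intro mult_mono assms norm_psi_le) auto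
    then show ?thesis by (simp add: mult_ac)
  qed
  show 1: "(\<lambda>t. g t *\<^sub>R \<psi> (t *\<^sub>R (c *\<^sub>R axis j 1)) a) integrable_on UNIV"
    by (rule integrable_on_all_intervals_UNIV[OF _ n i])
      (intro integrable_continuous continuous_intros continuous_psi_axis assms continuous_on_subset[OF assms(2)] subset_UNIV)
  have "norm (integral UNIV (\<lambda>t. g t *\<^sub>R \<psi> (t *\<^sub>R (c *\<^sub>R axis j 1)) a)) \<le> integral UNIV (\<lambda>t. B * (M * norm a) * weight t)"
    by (rule integral_norm_bound_integral[OF 1 i n])
  then show "norm (integral UNIV (\<lambda>t. g t *\<^sub>R \<psi> (t *\<^sub>R (c *\<^sub>R axis j 1)) a)) \<le> B * weight_integral * (M * norm a)"
    by (simp add: weight_integral_def mult_ac)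
qed

context
  fixes c :: real and j :: "'d::{finite,linorder}" and v :: "real ^ 'd::{finite,linorder}" defines "v \<equiv> c *\<^sub>R axis j 1"
begin

lemma smooth_integrable: "a \<in> continuous_vectors \<Longrightarrow> (\<lambda>t. f n t *\<^sub>R \<psi> (t *\<^sub>R v) a) integrable_on UNIV"
  unfolding v_def by (rule kernel_psi_integrable(1)[OF _ continuous_f f_bound])

lemma norm_smooth_le: "a \<in> continuous_vectors \<Longrightarrow> norm (smooth n v a) \<le> K * \<tau> ^ n * weight_integral * (M * norm a)"
  unfolding smooth_def v_def by (rule kernel_psi_integrable(2)[OF _ continuous_f f_bound])

lemma smooth_diff:
  "a \<in> continuous_vectors \<Longrightarrow> b \<in> continuous_vectors \<Longrightarrow> smooth n v (a - b) = smooth n v a - smooth n v b"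
  unfolding smooth_def by (simp add: psi_diff scaleR_diff_right integral_diff smooth_integrable)

lemma smooth_scaleR: "smooth n v (r *\<^sub>R a) = r *\<^sub>R smooth n v a"
proof -
  have "smooth n v (r *\<^sub>R a) = integral UNIV (\<lambda>t. r *\<^sub>R (f n t *\<^sub>R \<psi> (t *\<^sub>R v) a))"
    unfolding smooth_def by (simp add: psi_scaleR mult.commute)
  then show ?thesis unfolding integral_cmul smooth_def .
qed

lemma psi_smooth: "a \<in> continuous_vectors \<Longrightarrow> \<psi> u (smooth n v a) = smooth n v (\<psi> u a)"
  unfolding smooth_def
  by (subst integral_linear[OF smooth_integrable bounded_linear_psi, symmetric])
    (simp_all add: comp_def psi_scaleR psi_commute)

text \<open>Translating the average is the same as shifting the kernel, so the derivative falls on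
  the kernel and no differentiability of \<open>a\<close> is involved. The second-order remainder
  yields an error of order \<open>\<bar>h\<bar>\<close>.\<close>

lemma smooth_derivative:
  assumes a: "a \<in> continuous_vectors" and c: "c > 0"
  shows "(smooth n v a, (- 1 / c) *\<^sub>R smooth (Suc n) v a) \<in> generator \<psi> (axis j 1)"
proof -
  define B where "B = K * \<tau> ^ Suc (Suc n) * 2 ^ (l + 2)"
  have B0: "0 \<le> B" using K_nonneg \<tau>_pos by (simp add: B_def)
  let ?q = "\<lambda>h. (\<psi> (h *\<^sub>R axis j 1) (smooth n v a) - smooth n v a) /\<^sub>R h - (- 1 / c) *\<^sub>R smooth (Suc n) v a"
  have key: "norm (?q h) \<le>
      \<bar>h\<bar> * (B / c\<^sup>2 * weight_integral * (M * norm a))" if h: "h \<noteq> 0" "\<bar>h\<bar> \<le> c" for h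
  proof -
    \<comment> \<open>Moving by \<open>h\<close> along the axis is moving by \<open>h / c\<close>
      along \<open>v\<close>; the substitution that transfers it to the kernel reverses the
      sign.\<close>
    let ?s = "- h / c"
    have s1: "\<bar>?s\<bar> \<le> 1" using h c by simp
    \<comment> \<open>The first-order Taylor remainder of the kernel divided by \<open>h\<close>:
      integrated against the orbit it gives the difference quotient minus the claimed
      derivative.\<close>
    let ?g = "\<lambda>t. (f n (t + ?s) - f n t - ?s * f (Suc n) t) / h"
    let ?I = "\<lambda>t. f n t *\<^sub>R \<psi> (t *\<^sub>R v) a"
    have sh: "\<psi> (h *\<^sub>R axis j 1) (smooth n v a) = integral UNIV (\<lambda>t. f n (t + ?s) *\<^sub>R \<psi> (t *\<^sub>R v) a)"
      and shi: "(\<lambda>t. f n (t + ?s) *\<^sub>R \<psi> (t *\<^sub>R v) a) integrable_on UNIV"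
    proof -
      let ?J = "\<lambda>t. f n t *\<^sub>R \<psi> (t *\<^sub>R v) (\<psi> (h *\<^sub>R axis j 1) a)"
      have J: "?J integrable_on UNIV"
        using integrable_linear[OF smooth_integrable[OF a, of n] bounded_linear_psi[of "h *\<^sub>R axis j 1"]]
        by (simp add: comp_def psi_scaleR psi_commute)
      have "?J (t + ?s) = f n (t + ?s) *\<^sub>R \<psi> (t *\<^sub>R v) a" for t
      proof -
        have "(t + ?s) *\<^sub>R v + h *\<^sub>R axis j 1 = t *\<^sub>R v" using c by (simp add: v_def algebra_simps)
        then show ?thesis by (simp add: psi_psi)
      qed
      then have e: "(\<lambda>t. ?J (t + ?s)) = (\<lambda>t. f n (t + ?s) *\<^sub>R \<psi> (t *\<^sub>R v) a)" by blast
      show "(\<lambda>t. f n (t + ?s) *\<^sub>R \<psi> (t *\<^sub>R v) a) integrable_on UNIV"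
        using integral_translate_UNIV(1)[OF J, of ?s] unfolding e .
      have "\<psi> (h *\<^sub>R axis j 1) (smooth n v a) = smooth n v (\<psi> (h *\<^sub>R axis j 1) a)" by (rule psi_smooth[OF a])
      also have "\<dots> = integral UNIV ?J" by (simp only: smooth_def)
      also have "\<dots> = integral UNIV (\<lambda>t. f n (t + ?s) *\<^sub>R \<psi> (t *\<^sub>R v) a)"
        using integral_translate_UNIV(2)[OF J, of ?s] unfolding e by (rule sym)
      finally show "\<psi> (h *\<^sub>R axis j 1) (smooth n v a) = integral UNIV (\<lambda>t. f n (t + ?s) *\<^sub>R \<psi> (t *\<^sub>R v) a)" .
    qed
    have "?q h =
      integral UNIV (\<lambda>t. ?g t *\<^sub>R \<psi> (t *\<^sub>R v) a)"
    proof -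
      have "((\<lambda>t. (f n (t + ?s) *\<^sub>R \<psi> (t *\<^sub>R v) a - f n t *\<^sub>R \<psi> (t *\<^sub>R v) a) /\<^sub>R h - (- 1 / c) *\<^sub>R (f (Suc n) t *\<^sub>R \<psi> (t *\<^sub>R v) a))
        has_integral (?q h)) UNIV"
        unfolding sh unfolding smooth_def
        by (intro has_integral_diff has_integral_cmul integrable_integral shi smooth_integrable a)
      moreover have "(f n (t + ?s) *\<^sub>R \<psi> (t *\<^sub>R v) a - f n t *\<^sub>R \<psi> (t *\<^sub>R v) a) /\<^sub>R h - (- 1 / c) *\<^sub>R (f (Suc n) t *\<^sub>R \<psi> (t *\<^sub>R v) a) = ?g t *\<^sub>R \<psi> (t *\<^sub>R v) a" for t
      proof -
        have "?g t = inverse h * f n (t + ?s) - inverse h * f n t - (- 1 / c) * f (Suc n) t"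
          using h c by (simp add: field_simps)
        then show ?thesis by (simp only: scaleR_diff_left scaleR_diff_right scaleR_scaleR)
      qed
      ultimately show ?thesis by (simp add: integral_unique)
    qed
    also have "norm \<dots> \<le> (\<bar>h\<bar> * (B / c\<^sup>2)) * weight_integral * (M * norm a)"
      unfolding v_def
    proof (rule kernel_psi_integrable(2)[OF a])
      show "continuous_on UNIV ?g"
        using h by (intro continuous_intros continuous_f continuous_on_compose2[OF continuous_f[of UNIV n]]) auto
      fix t
      have "\<bar>f n (t + ?s) - f n t - ?s * f (Suc n) t\<bar> \<le> ?s\<^sup>2 * (B * weight t)"
      proof (rule second_order_remainder[OF f_deriv f_deriv])
        fix u assume "\<bar>u\<bar> \<le> \<bar>?s\<bar>"
        then have u: "\<bar>u\<bar> \<le> 1" using s1 by linarith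
        have "\<bar>f (Suc (Suc n)) (t + u)\<bar> \<le> K * \<tau> ^ Suc (Suc n) * weight (t + u)" by (rule f_bound)
        also have "\<dots> \<le> K * \<tau> ^ Suc (Suc n) * (2 ^ (l + 2) * weight t)"
          unfolding weight_def using K_nonneg \<tau>_pos by (intro mult_left_mono inverse_weight_translate u) auto
        finally show "\<bar>f (Suc (Suc n)) (t + u)\<bar> \<le> B * weight t" by (simp add: B_def mult_ac)
      qed
      then have "\<bar>?g t\<bar> \<le> ?s\<^sup>2 * (B * weight t) / \<bar>h\<bar>" by (simp add: divide_right_mono del: minus_divide_left)
      also have "\<dots> = \<bar>h\<bar> * (B / c\<^sup>2) * weight t"
        using h c by (simp add: power2_eq_square field_simps abs_if)
      finally show "\<bar>?g t\<bar> \<le> \<bar>h\<bar> * (B / c\<^sup>2) * weight t" .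
    qed
    finally show ?thesis by (simp add: mult_ac)
  qed
  have "((\<lambda>h. (\<psi> (h *\<^sub>R axis j 1) (smooth n v a) - smooth n v a) /\<^sub>R h) \<longlongrightarrow> (- 1 / c) *\<^sub>R smooth (Suc n) v a) (at 0)"
  proof (rule LIM_zero_cancel, rule Lim_null_comparison)
    show "\<forall>\<^sub>F h in at 0. norm (?q h) \<le>
      \<bar>h\<bar> * (B / c\<^sup>2 * weight_integral * (M * norm a))"
      unfolding eventually_at using c key by (intro exI[of _ c]) auto
    have "((\<lambda>h::real. \<bar>h\<bar> * (B / c\<^sup>2 * weight_integral * (M * norm a))) \<longlongrightarrow> \<bar>0\<bar> * (B / c\<^sup>2 * weight_integral * (M * norm a))) (at 0)"
      by (intro tendsto_intros)
    then show "((\<lambda>h::real. \<bar>h\<bar> * (B / c\<^sup>2 * weight_integral * (M * norm a))) \<longlongrightarrow> 0) (at 0)" by simp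
  qed
  then show ?thesis by (simp add: generator_def)
qed

end

section \<open>Combined averages with an error of order \<open>l\<close>\<close>

lemma continuous_vectors_diff:
  "a \<in> continuous_vectors \<Longrightarrow> b \<in> continuous_vectors \<Longrightarrow> a - b \<in> continuous_vectors"
  unfolding continuous_vectors_def by (auto simp: psi_diff intro!: tendsto_diff)

lemma continuous_vectors_scaleR:
  "a \<in> continuous_vectors \<Longrightarrow> r *\<^sub>R a \<in> continuous_vectors"
  unfolding continuous_vectors_def by (auto simp: psi_scaleR intro!: tendsto_scaleR)

lemma continuous_vectors_psi:
  "a \<in> continuous_vectors \<Longrightarrow> \<psi> t a \<in> continuous_vectors"
  unfolding continuous_vectors_def
  by (auto simp: psi_commute[of _ t] intro!: bounded_linear.tendsto[OF bounded_linear_psi])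

lemma generator_sum:
  assumes "\<And>i. i \<in> I \<Longrightarrow> (x i, y i) \<in> generator \<psi> v"
  shows "(\<Sum>i\<in>I. x i, \<Sum>i\<in>I. y i) \<in> generator \<psi> v"
proof -
  have "((\<lambda>h. \<Sum>i\<in>I. (\<psi> (h *\<^sub>R v) (x i) - x i) /\<^sub>R h) \<longlongrightarrow> (\<Sum>i\<in>I. y i)) (at 0)"
    using assms by (intro tendsto_sum) (auto simp: generator_def)
  then show ?thesis by (simp add: generator_def psi_sum sum_subtractf scaleR_sum_right scaleR_diff_right)
qed

definition mollify_coeff :: "nat \<Rightarrow> real" where "mollify_coeff i = - ((-1) ^ i * real (l choose i))"

text \<open>The binomial coefficients turn \<open>a - mollify 0 c j a\<close> into an average of \<open>l\<close>-th differences of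
  \<open>a\<close>; the index \<open>n\<close> counts derivatives in direction \<open>j\<close>, each of which brings out a factor
  \<open>- 1 / (i c)\<close> by moving onto the kernel of width \<open>i c\<close>.\<close>

definition mollify :: "nat \<Rightarrow> real \<Rightarrow> 'd::{finite,linorder} \<Rightarrow> 'a \<Rightarrow> 'a" where
  "mollify n c j a = (\<Sum>i=1..l. (mollify_coeff i * (- 1 / (real i * c)) ^ n) *\<^sub>R smooth n ((real i * c) *\<^sub>R axis j 1) a)"

definition mollify_bound :: real where "mollify_bound = 2 ^ l * (K * weight_integral * M)"

lemma mollify_bound_nonneg: "0 \<le> mollify_bound"
  using K_nonneg weight_integral_nonneg M_nonneg by (simp add: mollify_bound_def)

lemma norm_mollify_le:
  assumes "a \<in> continuous_vectors" "c > 0"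
  shows "norm (mollify n c j a) \<le> mollify_bound * (\<tau> / c) ^ n * norm a"
proof -
  have "norm (mollify n c j a) \<le> (\<Sum>i=1..l. real (l choose i) * ((\<tau> / c) ^ n * (K * weight_integral * M) * norm a))"
    unfolding mollify_def
  proof (rule sum_norm_le)
    fix i assume i: "i \<in> {1..l}"
    have "norm ((mollify_coeff i * (- 1 / (real i * c)) ^ n) *\<^sub>R smooth n ((real i * c) *\<^sub>R axis j 1) a)
        = real (l choose i) * ((1 / (real i * c)) ^ n * norm (smooth n ((real i * c) *\<^sub>R axis j 1) a))"
      using assms by (simp add: mollify_coeff_def abs_mult power_abs)
    also have "\<dots> \<le> real (l choose i) * ((1 / c) ^ n * (K * \<tau> ^ n * weight_integral * (M * norm a)))"
      using i assms norm_smooth_le[OF assms(1), of n "real i * c" j]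
      by (intro mult_left_mono mult_mono power_mono) (auto simp: field_simps)
    finally show "norm ((mollify_coeff i * (- 1 / (real i * c)) ^ n) *\<^sub>R smooth n ((real i * c) *\<^sub>R axis j 1) a) \<le>
        real (l choose i) * ((\<tau> / c) ^ n * (K * weight_integral * M) * norm a)"
      by (simp add: power_divide mult_ac)
  qed
  also have "\<dots> = (\<Sum>i=1..l. real (l choose i)) * ((\<tau> / c) ^ n * (K * weight_integral * M) * norm a)"
    by (rule sum_distrib_right[symmetric])
  also have "\<dots> \<le> 2 ^ l * ((\<tau> / c) ^ n * (K * weight_integral * M) * norm a)"
  proof (rule mult_right_mono)
    have "(\<Sum>i=1..l. real (l choose i)) \<le> (\<Sum>i\<le>l. real (l choose i))"
      by (rule sum_mono2) auto
    also have "\<dots> = 2 ^ l" by (metis choose_row_sum of_nat_numeral of_nat_power of_nat_sum)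
    finally show "(\<Sum>i=1..l. real (l choose i)) \<le> 2 ^ l" .
    show "0 \<le> (\<tau> / c) ^ n * (K * weight_integral * M) * norm a"
      using assms \<tau>_pos K_nonneg weight_integral_nonneg M_nonneg by simp
  qed
  finally show ?thesis by (simp add: mollify_bound_def mult_ac)
qed

lemma mollify_diff:
  "a \<in> continuous_vectors \<Longrightarrow> b \<in> continuous_vectors \<Longrightarrow> mollify n c j (a - b) = mollify n c j a - mollify n c j b"
  unfolding mollify_def by (simp add: smooth_diff scaleR_diff_right sum_subtractf)

lemma mollify_scaleR: "mollify n c j (r *\<^sub>R a) = r *\<^sub>R mollify n c j a"
  unfolding mollify_def by (simp add: smooth_scaleR scaleR_sum_right mult_ac)

lemma psi_mollify: "a \<in> continuous_vectors \<Longrightarrow> \<psi> u (mollify n c j a) = mollify n c j (\<psi> u a)"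
  unfolding mollify_def by (simp add: psi_sum psi_scaleR psi_smooth)

text \<open>Linearity and boundedness of averaging hold on continuous vectors, so the approximating
  vectors and the limit are all required to be continuous. This lets averages pass through the
  limits that define generators.\<close>

lemma mollify_tendsto:
  assumes "\<And>h. g h \<in> continuous_vectors" "b \<in> continuous_vectors" "c > 0" "(g \<longlongrightarrow> b) F"
  shows "((\<lambda>h. mollify n c j (g h)) \<longlongrightarrow> mollify n c j b) F"
proof (rule LIM_zero_cancel, rule Lim_null_comparison)
  show "\<forall>\<^sub>F h in F. norm (mollify n c j (g h) - mollify n c j b) \<le> mollify_bound * (\<tau> / c) ^ n * norm (g h - b)"
    using assms by (intro always_eventually allI) (simp add: mollify_diff[symmetric] norm_mollify_le continuous_vectors_diff)
  have "((\<lambda>h. norm (g h - b)) \<longlongrightarrow> 0) F"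
    using assms(4) by (intro tendsto_norm_zero LIM_zero)
  then show "((\<lambda>h. mollify_bound * (\<tau> / c) ^ n * norm (g h - b)) \<longlongrightarrow> 0) F"
    by (rule tendsto_mult_right_zero)
qed

lemma mollify_continuous:
  assumes "a \<in> continuous_vectors" "c > 0"
  shows "mollify n c j a \<in> continuous_vectors"
  unfolding continuous_vectors_def mem_Collect_eq
proof
  fix i
  have "((\<lambda>s. \<psi> (s *\<^sub>R axis i 1) a) \<longlongrightarrow> a) (at 0)" using assms by (simp add: continuous_vectors_def)
  then have "((\<lambda>s. mollify n c j (\<psi> (s *\<^sub>R axis i 1) a)) \<longlongrightarrow> mollify n c j a) (at 0)"
    using assms by (intro mollify_tendsto continuous_vectors_psi) auto
  then show "((\<lambda>s. \<psi> (s *\<^sub>R axis i 1) (mollify n c j a)) \<longlongrightarrow> mollify n c j a) (at 0)"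
    using assms by (simp add: psi_mollify)
qed

lemma mollify_derivative:
  assumes "a \<in> continuous_vectors" "c > 0"
  shows "(mollify n c j a, mollify (Suc n) c j a) \<in> generator \<psi> (axis j 1)"
  unfolding mollify_def
proof (rule generator_sum)
  fix i assume i: "i \<in> {1..l}"
  have "(smooth n ((real i * c) *\<^sub>R axis j 1) a, (- 1 / (real i * c)) *\<^sub>R smooth (Suc n) ((real i * c) *\<^sub>R axis j 1) a) \<in> generator \<psi> (axis j 1)"
    using i assms by (intro smooth_derivative) auto
  from generator_scaleR[OF this, of "mollify_coeff i * (- 1 / (real i * c)) ^ n"]
  show "((mollify_coeff i * (- 1 / (real i * c)) ^ n) *\<^sub>R smooth n ((real i * c) *\<^sub>R axis j 1) a,
     (mollify_coeff i * (- 1 / (real i * c)) ^ Suc n) *\<^sub>R smooth (Suc n) ((real i * c) *\<^sub>R axis j 1) a) \<in> generator \<psi> (axis j 1)"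
    by (simp only: scaleR_scaleR power_Suc mult_ac)
qed

text \<open>Averaging in one direction commutes with the generators of all directions, so it
  preserves derivatives already gained in other coordinates.\<close>

lemma mollify_generator:
  assumes "(a, b) \<in> generator \<psi> v" "a \<in> continuous_vectors" "b \<in> continuous_vectors" "c > 0"
  shows "(mollify n c j a, mollify n c j b) \<in> generator \<psi> v"
proof -
  have "((\<lambda>h. (\<psi> (h *\<^sub>R v) a - a) /\<^sub>R h) \<longlongrightarrow> b) (at 0)" using assms(1) by (simp add: generator_def)
  then have "((\<lambda>h. mollify n c j ((\<psi> (h *\<^sub>R v) a - a) /\<^sub>R h)) \<longlongrightarrow> mollify n c j b) (at 0)"
    using assms
    by (intro mollify_tendsto continuous_vectors_scaleR continuous_vectors_diff continuous_vectors_psi)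
  then show ?thesis using assms
    by (simp add: generator_def mollify_scaleR mollify_diff psi_mollify continuous_vectors_psi)
qed

definition jackson_bound :: real where
  "jackson_bound = M ^ l * integral UNIV (\<lambda>t. (1 + \<bar>t\<bar>) ^ l * \<bar>f 0 t\<bar>)"

lemma jackson_bound_nonneg: "0 \<le> jackson_bound"
  unfolding jackson_bound_def using M_nonneg
  by (intro mult_nonneg_nonneg integral_nonneg kernel_class_integrable(1)[OF kernel]) auto

text \<open>The kernel has mass 1, so \<open>a\<close> is itself an integral, and the error becomes
  an average of \<open>l\<close>-th differences with steps \<open>t * c\<close>. Dilation bounds
  these by \<open>(1 + \<bar>t\<bar>) ^ l\<close> times the modulus at \<open>c\<close>, and the
  decay of the kernel integrates the growth.\<close>

lemma mollify_approx:
  assumes a: "a \<in> continuous_vectors" and c: "c > 0"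
  shows "norm (a - mollify 0 c j a) \<le> jackson_bound * \<omega> l c a"
proof -
  let ?v = "axis j 1 :: real ^ 'd::{finite,linorder}"
  \<comment> \<open>The integral of a non-integrable function is 0 by convention, so the value 1
    already implies integrability.\<close>
  have f0: "f 0 integrable_on UNIV" using kernel_int by (metis not_integrable_integral zero_neq_one)
  have "((\<lambda>t. f 0 t *\<^sub>R a - (\<Sum>i=1..l. mollify_coeff i *\<^sub>R (f 0 t *\<^sub>R \<psi> (t *\<^sub>R ((real i * c) *\<^sub>R ?v)) a))) has_integral (1 *\<^sub>R a - mollify 0 c j a)) UNIV"
    unfolding mollify_def smooth_def
  proof (intro has_integral_diff)
    show "((\<lambda>t. f 0 t *\<^sub>R a) has_integral 1 *\<^sub>R a) UNIV"
      using has_integral_scaleR_left[OF integrable_integral[OF f0], of a] unfolding kernel_int .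
    show "((\<lambda>t. \<Sum>i=1..l. mollify_coeff i *\<^sub>R (f 0 t *\<^sub>R \<psi> (t *\<^sub>R ((real i * c) *\<^sub>R ?v)) a)) has_integral
       (\<Sum>i=1..l. (mollify_coeff i * (- 1 / (real i * c)) ^ 0) *\<^sub>R integral UNIV (\<lambda>t. f 0 t *\<^sub>R \<psi> (t *\<^sub>R ((real i * c) *\<^sub>R ?v)) a))) UNIV"
      unfolding power_0 mult_1_right
      by (intro has_integral_sum has_integral_cmul integrable_integral smooth_integrable a) auto
  qed
  moreover have "f 0 t *\<^sub>R a - (\<Sum>i=1..l. mollify_coeff i *\<^sub>R (f 0 t *\<^sub>R \<psi> (t *\<^sub>R ((real i * c) *\<^sub>R ?v)) a)) =
      ((-1) ^ l * f 0 t) *\<^sub>R difference \<psi> ((t * c) *\<^sub>R ?v) l a" for t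
  proof -
    have "(-1) ^ l *\<^sub>R difference \<psi> ((t * c) *\<^sub>R ?v) l a = (\<Sum>i\<le>l. ((-1) ^ i * real (l choose i)) *\<^sub>R \<psi> (real i *\<^sub>R ((t * c) *\<^sub>R ?v)) a)"
      unfolding difference_expand scaleR_sum_right
    proof (rule sum.cong)
      fix i assume "i \<in> {..l}"
      then have "(-1::real) ^ l = (-1) ^ (l - i) * (-1) ^ i" by (simp flip: power_add)
      then have "(-1::real) ^ l * (-1) ^ (l - i) = (-1) ^ i" by (simp flip: power_mult_distrib)
      then show "(-1) ^ l *\<^sub>R ((-1) ^ (l - i) * real (l choose i)) *\<^sub>R \<psi> (real i *\<^sub>R ((t * c) *\<^sub>R ?v)) a =
          ((-1) ^ i * real (l choose i)) *\<^sub>R \<psi> (real i *\<^sub>R ((t * c) *\<^sub>R ?v)) a"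
        by (simp add: mult.assoc[symmetric])
    qed simp
    also have "\<dots> = a + (\<Sum>i=1..l. ((-1) ^ i * real (l choose i)) *\<^sub>R \<psi> (real i *\<^sub>R ((t * c) *\<^sub>R ?v)) a)"
      by (simp add: atMost_atLeast0 sum.atLeast_Suc_atMost[of 0])
    finally have "f 0 t *\<^sub>R ((-1) ^ l *\<^sub>R difference \<psi> ((t * c) *\<^sub>R ?v) l a) =
      f 0 t *\<^sub>R a + (\<Sum>i=1..l. (f 0 t * ((-1) ^ i * real (l choose i))) *\<^sub>R \<psi> (real i *\<^sub>R ((t * c) *\<^sub>R ?v)) a)"
      by (simp add: scaleR_add_right scaleR_sum_right)
    then show ?thesis by (simp add: mollify_coeff_def sum_negf mult_ac)
  qed
  ultimately have I: "((\<lambda>t. ((-1) ^ l * f 0 t) *\<^sub>R difference \<psi> ((t * c) *\<^sub>R ?v) l a) has_integral (a - mollify 0 c j a)) UNIV"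
    by simp
  have g: "(\<lambda>t. M ^ l * \<omega> l c a * ((1 + \<bar>t\<bar>) ^ l * \<bar>f 0 t\<bar>)) integrable_on UNIV"
    using integrable_on_cmult_left[OF kernel_class_integrable(1)[OF kernel, of 0], of "M ^ l * \<omega> l c a"] by simp
  have "norm (integral UNIV (\<lambda>t. ((-1) ^ l * f 0 t) *\<^sub>R difference \<psi> ((t * c) *\<^sub>R ?v) l a)) \<le>
     integral UNIV (\<lambda>t. M ^ l * \<omega> l c a * ((1 + \<bar>t\<bar>) ^ l * \<bar>f 0 t\<bar>))"
  proof (rule integral_norm_bound_integral[OF has_integral_integrable[OF I] g])
    fix t :: real
    have "norm (difference \<psi> ((t * c) *\<^sub>R ?v) l a) \<le> \<omega> l (\<bar>t\<bar> * c) a"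
      using c by (intro norm_difference_le_modulus) (simp add: l1_norm_scaleR l1_norm_axis abs_mult)
    also have "\<dots> \<le> M ^ l * (1 + \<bar>t\<bar>) ^ l * \<omega> l c a"
      using c by (intro modulus_dilate) auto
    finally have "\<bar>f 0 t\<bar> * norm (difference \<psi> ((t * c) *\<^sub>R ?v) l a) \<le> \<bar>f 0 t\<bar> * (M ^ l * (1 + \<bar>t\<bar>) ^ l * \<omega> l c a)"
      by (rule mult_left_mono) simp
    then show "norm (((-1) ^ l * f 0 t) *\<^sub>R difference \<psi> ((t * c) *\<^sub>R ?v) l a) \<le> M ^ l * \<omega> l c a * ((1 + \<bar>t\<bar>) ^ l * \<bar>f 0 t\<bar>)"
      by (simp add: abs_mult mult_ac)
  qed
  then show ?thesis unfolding integral_unique[OF I] integral_mult_right jackson_bound_def by (simp only: mult_ac)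
qed

text \<open>\<open>D \<alpha>\<close> plays the role of \<open>\<delta>\<^sup>\<alpha>\<close> applied to the approximant \<open>D 0\<close>, for the coordinates in \<open>S\<close>.\<close>

definition approximant_family ::
  "'d::{finite,linorder} set \<Rightarrow> real \<Rightarrow> real \<Rightarrow> 'a \<Rightarrow> (('d \<Rightarrow> nat) \<Rightarrow> 'a) \<Rightarrow> bool" where
  "approximant_family S B c a D \<longleftrightarrow>
     (\<forall>\<alpha>. D \<alpha> \<in> continuous_vectors) \<and>
     (\<forall>\<alpha>. \<forall>j\<in>S. (D \<alpha>, D (\<alpha>(j := Suc (\<alpha> j)))) \<in> generator \<psi> (axis j 1)) \<and>
     (\<forall>\<alpha>. norm (D \<alpha>) \<le> B * (\<tau> / c) ^ (\<Sum>j\<in>S. \<alpha> j) * norm a) \<and>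
     norm (a - D (\<lambda>_. 0)) \<le> B * \<omega> l c a"

text \<open>\<open>B\<close> is fixed before \<open>c\<close> and \<open>a\<close>, the uniformity
  required for a Jackson inequality at all scales. For a further coordinate, the whole previous
  family is averaged in the new direction.\<close>

lemma smooth_approximant:
  assumes "finite S"
  shows "\<exists>B\<ge>0. \<forall>c>0. \<forall>a\<in>continuous_vectors. \<exists>D. approximant_family S B c a D"
  using assms
proof (induction S rule: finite_induct)
  case empty
  show ?case
  proof (intro exI[of _ 1] conjI allI impI ballI)
    fix c :: real and a assume "c > 0" "a \<in> continuous_vectors"
    then show "\<exists>D. approximant_family {} 1 c a D"
      by (intro exI[of _ "\<lambda>_. a"]) (simp add: approximant_family_def modulus_nonneg)
  qed simp
next
  case (insert k S)
  then obtain B where B: "B \<ge> 0" and ex: "\<And>c a. c > 0 \<Longrightarrow> a \<in> continuous_vectors \<Longrightarrow> \<exists>D. approximant_family S B c a D"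
    by blast
  \<comment> \<open>The old error passes through the new average at the cost of
    \<open>mollify_bound\<close>; the new average adds an error of its own,
    \<open>jackson_bound\<close>.\<close>
  define B' where "B' = mollify_bound * B + jackson_bound"
  have B': "B' \<ge> 0" "mollify_bound * B \<le> B'" using B mollify_bound_nonneg jackson_bound_nonneg by (auto simp: B'_def)
  show ?case
  proof (intro exI[of _ B'] conjI allI impI ballI B')
    fix c :: real and a assume c: "c > 0" and a: "a \<in> continuous_vectors"
    obtain D :: "('d::{finite,linorder} \<Rightarrow> nat) \<Rightarrow> 'a" where D: "\<And>\<alpha>. D \<alpha> \<in> continuous_vectors"
      "\<And>\<alpha> j. j \<in> S \<Longrightarrow> (D \<alpha>, D (\<alpha>(j := Suc (\<alpha> j)))) \<in> generator \<psi> (axis j 1)"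
      "\<And>\<alpha>. norm (D \<alpha>) \<le> B * (\<tau> / c) ^ (\<Sum>j\<in>S. \<alpha> j) * norm a"
      "norm (a - D (\<lambda>_. 0)) \<le> B * \<omega> l c a"
      using ex[OF c a] unfolding approximant_family_def by blast
    \<comment> \<open>The entry at \<open>k\<close> counts derivatives of the new average. It is
      reset to 0 inside \<open>D\<close>, since the old family describes derivatives in the
      directions of \<open>S\<close> only.\<close>
    define D' where "D' \<alpha> = mollify (\<alpha> k) c k (D (\<alpha>(k := 0)))" for \<alpha>
    have tc: "0 < \<tau> / c" using \<tau>_pos c by simp
    show "\<exists>D. approximant_family (insert k S) B' c a D"
      unfolding approximant_family_def
    proof (intro exI[of _ D'] conjI allI ballI)
      fix \<alpha>
      show "D' \<alpha> \<in> continuous_vectors" unfolding D'_def by (intro mollify_continuous D c)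
      show "(D' \<alpha>, D' (\<alpha>(j := Suc (\<alpha> j)))) \<in> generator \<psi> (axis j 1)" if "j \<in> insert k S" for j
      proof (cases "j = k")
        case True
        then show ?thesis using mollify_derivative[OF D(1)[of "\<alpha>(k := 0)"] c, of "\<alpha> k" k] by (simp add: D'_def)
      next
        case False
        then have j: "j \<in> S" using that by simp
        have "(D (\<alpha>(k := 0)), D ((\<alpha>(k := 0))(j := Suc ((\<alpha>(k := 0)) j)))) \<in> generator \<psi> (axis j 1)" by (rule D(2)[OF j])
        moreover have "(\<alpha>(k := 0))(j := Suc ((\<alpha>(k := 0)) j)) = (\<alpha>(j := Suc (\<alpha> j)))(k := 0)"
          using False by (auto simp: fun_eq_iff)
        ultimately show ?thesis
          using False by (simp add: D'_def mollify_generator D(1) c)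
      qed
      have "norm (D' \<alpha>) \<le> mollify_bound * (\<tau> / c) ^ \<alpha> k * norm (D (\<alpha>(k := 0)))"
        unfolding D'_def by (rule norm_mollify_le[OF D(1) c])
      also have "\<dots> \<le> mollify_bound * (\<tau> / c) ^ \<alpha> k * (B * (\<tau> / c) ^ (\<Sum>j\<in>S. \<alpha> j) * norm a)"
      proof (intro mult_left_mono)
        have "(\<Sum>j\<in>S. (\<alpha>(k := 0)) j) = (\<Sum>j\<in>S. \<alpha> j)" using insert.hyps by (intro sum.cong) auto
        then show "norm (D (\<alpha>(k := 0))) \<le> B * (\<tau> / c) ^ (\<Sum>j\<in>S. \<alpha> j) * norm a" using D(3)[of "\<alpha>(k := 0)"] by simp
      qed (use mollify_bound_nonneg tc in auto)
      also have "\<dots> = (mollify_bound * B) * ((\<tau> / c) ^ (\<Sum>j\<in>insert k S. \<alpha> j) * norm a)"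
        using insert.hyps by (simp add: power_add mult_ac)
      also have "\<dots> \<le> B' * ((\<tau> / c) ^ (\<Sum>j\<in>insert k S. \<alpha> j) * norm a)"
        using tc by (intro mult_right_mono B') auto
      finally show "norm (D' \<alpha>) \<le> B' * (\<tau> / c) ^ (\<Sum>j\<in>insert k S. \<alpha> j) * norm a" by (simp add: mult_ac)
    next
      let ?d = "D (\<lambda>_. 0)"
      have "(\<lambda>_. 0)(k := 0) = (\<lambda>_. 0 :: nat)" by auto
      then have "a - D' (\<lambda>_. 0) = (a - mollify 0 c k a) + mollify 0 c k (a - ?d)"
        by (simp add: D'_def mollify_diff a D(1))
      then have "norm (a - D' (\<lambda>_. 0)) \<le> norm (a - mollify 0 c k a) + norm (mollify 0 c k (a - ?d))"
        by (simp only: norm_triangle_ineq)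
      also have "norm (mollify 0 c k (a - ?d)) \<le> mollify_bound * norm (a - ?d)"
        using norm_mollify_le[OF continuous_vectors_diff[OF a D(1)] c, of 0] by simp
      also have "\<dots> \<le> mollify_bound * (B * \<omega> l c a)" using mollify_bound_nonneg D(4) by (intro mult_left_mono)
      finally show "norm (a - D' (\<lambda>_. 0)) \<le> B' * \<omega> l c a"
        using mollify_approx[OF a c, of k] by (simp add: B'_def algebra_simps)
    qed
  qed
qed

end

section \<open>Direct and inverse estimates\<close>

context bounded_group
begin

section \<open>Errors of best approximation\<close>

abbreviation "E \<equiv> approximation_error X"

lemma bdd_below_errors: "bdd_below ((\<lambda>x. norm (a - x)) ` X \<sigma>)"
  by (rule bdd_belowI2[of _ 0]) simp

lemma X_nonempty: "X \<sigma> \<noteq> {}"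
  using zero_in_X by blast

lemma error_le: "x \<in> X \<sigma> \<Longrightarrow> E \<sigma> a \<le> norm (a - x)"
  unfolding approximation_error_def by (rule cINF_lower[OF bdd_below_errors])

lemma error_nonneg: "0 \<le> E \<sigma> a"
  unfolding approximation_error_def by (rule cINF_greatest[OF X_nonempty]) simp

lemma error_le_norm: "E \<sigma> a \<le> norm a"
  using error_le[OF zero_in_X, of \<sigma> a] by simp

lemma error_zero: "E 0 a = norm a"
  by (simp add: approximation_error_def bandlimited_scheme_def)

lemma error_antimono: "0 \<le> \<sigma> \<Longrightarrow> \<sigma> \<le> \<sigma>' \<Longrightarrow> E \<sigma>' a \<le> E \<sigma> a"
  unfolding approximation_error_def
  by (rule cINF_superset_mono[OF X_nonempty bdd_below_errors X_mono]) auto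

lemma near_best:
  assumes "\<epsilon> > 0"
  obtains x where "x \<in> X \<sigma>" "norm (a - x) \<le> E \<sigma> a + \<epsilon>"
proof -
  have "(INF x\<in>X \<sigma>. norm (a - x)) < E \<sigma> a + \<epsilon>"
    using assms by (simp add: approximation_error_def)
  then show thesis
    unfolding cINF_less_iff[OF X_nonempty bdd_below_errors] using that less_imp_le by blast
qed

text \<open>The kernel width is tuned so that the derivatives of the averages grow at the rate
  \<open>2 * pi * \<sigma>\<close> prescribed for bandlimited elements.\<close>

theorem jackson:
  assumes l: "0 < l"
  obtains B where "0 < B" "\<And>\<sigma> a. 0 < \<sigma> \<Longrightarrow> a \<in> continuous_vectors \<Longrightarrow> E \<sigma> a \<le> B * \<omega> l (1 / \<sigma>) a"
proof -
  obtain K \<tau> f where k: "K \<ge> 0" "\<tau> > 0" "kernel_class K \<tau> (l + 2) f" "integral UNIV (f 0) = 1"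
    by (rule kernel_exists)
  interpret mollifier \<psi> M l K \<tau> f by unfold_locales (use k l in auto)
  obtain B where B: "B \<ge> 0" and ex: "\<And>c a. c > 0 \<Longrightarrow> a \<in> continuous_vectors \<Longrightarrow> \<exists>D. approximant_family UNIV B c a D"
    using smooth_approximant[of UNIV] by auto
  \<comment> \<open>With width \<open>c = ?k / \<sigma>\<close> the rescaled type
    \<open>\<tau> / c\<close> is exactly \<open>2 * pi * \<sigma>\<close>.\<close>
  let ?k = "\<tau> / (2 * pi)"
  \<comment> \<open>The extra factor pays for replacing the scale \<open>c\<close> by
    \<open>1 / \<sigma>\<close>; the summand 1 makes the constant positive even if
    \<open>B = 0\<close>.\<close>
  define B' where "B' = B * (M ^ l * (1 + ?k) ^ l) + 1"
  have B'0: "B' > 0" using B M_nonneg k by (simp add: B'_def add_nonneg_pos)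
  show thesis
  proof (rule that[OF B'0])
    fix \<sigma> :: real and a assume \<sigma>: "0 < \<sigma>" and a: "a \<in> continuous_vectors"
    define c where "c = ?k * (1 / \<sigma>)"
    have c: "c > 0" "\<tau> / c = 2 * pi * \<sigma>" using \<sigma> k by (auto simp: c_def)
    obtain D :: "('d::{finite,linorder} \<Rightarrow> nat) \<Rightarrow> 'a" where D:
      "\<And>\<alpha> j. (D \<alpha>, D (\<alpha>(j := Suc (\<alpha> j)))) \<in> generator \<psi> (axis j 1)"
      "\<And>\<alpha>. norm (D \<alpha>) \<le> B * (\<tau> / c) ^ (\<Sum>j\<in>UNIV. \<alpha> j) * norm a"
      "norm (a - D (\<lambda>_. 0)) \<le> B * \<omega> l c a"
      using ex[OF c(1) a] unfolding approximant_family_def by blast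
    have "bandlimited \<psi> \<sigma> (D (\<lambda>_. 0))"
      unfolding bandlimited_def
    proof (intro exI[of _ "B * norm a"] allI)
      fix \<alpha>
      have "norm (D \<alpha>) \<le> B * norm a * (2 * pi * \<sigma>) ^ (\<Sum>j\<in>UNIV. \<alpha> j)"
        using D(2)[of \<alpha>] unfolding c(2) by (simp only: mult_ac)
      then show "\<exists>b. (D (\<lambda>_. 0), b) \<in> multi_generator \<psi> \<alpha> \<and> norm b \<le> B * norm a * (2 * pi * \<sigma>) ^ (\<Sum>j\<in>UNIV. \<alpha> j)"
        using multi_generator_family[of D \<alpha>, OF D(1)] by blast
    qed
    then have "E \<sigma> a \<le> norm (a - D (\<lambda>_. 0))" using \<sigma> by (intro error_le) (simp add: in_X_iff)
    also have "\<dots> \<le> B * \<omega> l c a" by (rule D(3))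
    also have "\<dots> \<le> B * (M ^ l * (1 + ?k) ^ l * \<omega> l (1 / \<sigma>) a)"
      unfolding c_def using \<sigma> k by (intro mult_left_mono modulus_dilate B) auto
    also have "\<dots> \<le> B' * \<omega> l (1 / \<sigma>) a"
      using modulus_nonneg[of "1 / \<sigma>" l a] \<sigma> by (simp add: B'_def algebra_simps)
    finally show "E \<sigma> a \<le> B' * \<omega> l (1 / \<sigma>) a" .
  qed
qed

lemma modulus_zero: "0 \<le> h \<Longrightarrow> \<omega> l h 0 = 0"
  using modulus_le_norm[of h l 0] modulus_nonneg[of h l 0] by simp

lemma modulus_sum_le:
  assumes "0 \<le> h"
  shows "\<omega> l h (\<Sum>i\<in>I. x i) \<le> (\<Sum>i\<in>I. \<omega> l h (x i))"
proof (induction I rule: infinite_finite_induct)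
  case (insert i I)
  then show ?case using modulus_add_le[OF assms, of l "x i" "\<Sum>i\<in>I. x i"] by simp
qed (use assms in \<open>simp_all add: modulus_zero\<close>)

text \<open>Best approximants need not exist, so near-best ones with slack \<open>\<epsilon>\<close>
  are telescoped. Since \<open>n\<close> is fixed, the accumulated slack can be sent to 0 at the
  end. The term with \<open>norm a\<close> comes from the coarsest approximant
  \<open>x 0\<close>.\<close>

theorem inverse_estimate:
  obtains C where "0 < C" "\<And>n a. \<omega> l (1 / 2 ^ n) a \<le>
    C * ((1 / 2 ^ n) ^ l * norm a + (\<Sum>i\<le>n. (1 / 2 ^ (n - i)) ^ l * E (2 ^ i) a))"
proof -
  define b where "b = bernstein_const"
  have b0: "b \<ge> 0" by (simp add: b_def bernstein_const_nonneg)
  \<comment> \<open>The summands serve, in this order, the remainder \<open>a - x n\<close>, the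
    coarsest approximant \<open>x 0\<close>, and the increments. The latter lie in
    \<open>X (2 ^ Suc i)\<close>, hence \<open>2 * b\<close>, and their norm involves two errors,
    hence the leading 2.\<close>
  define C where "C = (M + 1) ^ l + b ^ l + 2 * (2 * b) ^ l"
  have C0: "C > 0" using M_nonneg b0 by (simp add: C_def add_pos_nonneg)
  show thesis
  proof (rule that[OF C0])
    fix n a
    define h where "h = (1 / 2 ^ n :: real)"
    have h: "h > 0" by (simp add: h_def)
    let ?\<theta> = "\<lambda>i. (1 / 2 ^ (n - i)) ^ l :: real"
    let ?S = "h ^ l * norm a + (\<Sum>i\<le>n. ?\<theta> i * E (2 ^ i) a)"
    \<comment> \<open>The Bernstein factor for frequency \<open>2 ^ i\<close> at step
      \<open>h\<close> depends on \<open>n - i\<close> alone, which produces a convolution.\<close>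
    have h2: "(2 ^ i * h) ^ l = ?\<theta> i" if "i \<le> n" for i
      using that by (simp add: h_def power_diff)
    have main: "\<omega> l h a \<le> C * ?S + C * (real n + 1) * \<epsilon>" if \<epsilon>: "\<epsilon> > 0" for \<epsilon>
    proof -
      have "\<exists>x. x \<in> X (2 ^ i) \<and> norm (a - x) \<le> E (2 ^ i) a + \<epsilon>" for i :: nat
        by (rule near_best[OF \<epsilon>]) blast
      then obtain x where x: "\<And>i::nat. x i \<in> X (2 ^ i)" "\<And>i. norm (a - x i) \<le> E (2 ^ i) a + \<epsilon>"
        by metis
      have tel: "x n = x 0 + (\<Sum>i<n. x (Suc i) - x i)"
        by (simp add: sum_lessThan_telescope)
      have t1: "\<omega> l h (a - x n) \<le> (M + 1) ^ l * (\<Sum>i\<le>n. ?\<theta> i * (E (2 ^ i) a + \<epsilon>))"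
      proof -
        have "\<omega> l h (a - x n) \<le> (M + 1) ^ l * norm (a - x n)" using h by (intro modulus_le_norm) auto
        also have "\<dots> \<le> (M + 1) ^ l * (?\<theta> n * (E (2 ^ n) a + \<epsilon>))"
          using x(2)[of n] M_nonneg by (intro mult_left_mono) auto
        also have "?\<theta> n * (E (2 ^ n) a + \<epsilon>) \<le> (\<Sum>i\<le>n. ?\<theta> i * (E (2 ^ i) a + \<epsilon>))"
          using \<epsilon> error_nonneg by (intro member_le_sum[of n "{..n}" "\<lambda>i. ?\<theta> i * (E (2 ^ i) a + \<epsilon>)"]) (auto intro!: mult_nonneg_nonneg add_nonneg_nonneg)
        finally show ?thesis using M_nonneg by (simp add: mult_left_mono)
      qed
      have t2: "\<omega> l h (x 0) \<le> b ^ l * (h ^ l * norm a + (\<Sum>i\<le>n. ?\<theta> i * (E (2 ^ i) a + \<epsilon>)))"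
      proof -
        have "\<omega> l h (x 0) \<le> (b * 2 ^ 0 * h) ^ l * norm (x 0)"
          unfolding b_def using h by (intro X_modulus x) auto
        also have "norm (x 0) \<le> norm a + norm (a - x 0)" using norm_triangle_sub[of "x 0" a] by (simp add: norm_minus_commute)
        also have "\<dots> \<le> norm a + (E (2 ^ 0) a + \<epsilon>)" by (intro add_left_mono x)
        also have "(b * 2 ^ 0 * h) ^ l * (norm a + (E (2 ^ 0) a + \<epsilon>)) = b ^ l * (h ^ l * norm a + ?\<theta> 0 * (E (2 ^ 0) a + \<epsilon>))"
        proof -
          have "(b * 2 ^ 0 * h) ^ l = b ^ l * h ^ l" "?\<theta> 0 = h ^ l"
            by (simp_all only: power_mult_distrib power_0 mult_1_right h_def diff_zero)
          then show ?thesis by (simp only: distrib_left mult.assoc)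
        qed
        also have "\<dots> \<le> b ^ l * (h ^ l * norm a + (\<Sum>i\<le>n. ?\<theta> i * (E (2 ^ i) a + \<epsilon>)))"
          using \<epsilon> error_nonneg b0 by (intro mult_left_mono add_left_mono member_le_sum[of 0 "{..n}" "\<lambda>i. ?\<theta> i * (E (2 ^ i) a + \<epsilon>)"]) (auto intro!: mult_nonneg_nonneg add_nonneg_nonneg)
        finally show ?thesis using b0 h by (simp add: mult_left_mono)
      qed
      have t3: "(\<Sum>i<n. \<omega> l h (x (Suc i) - x i)) \<le> 2 * (2 * b) ^ l * (\<Sum>i\<le>n. ?\<theta> i * (E (2 ^ i) a + \<epsilon>))"
      proof -
        have "(\<Sum>i<n. \<omega> l h (x (Suc i) - x i)) \<le> (\<Sum>i<n. 2 * (2 * b) ^ l * (?\<theta> i * (E (2 ^ i) a + \<epsilon>)))"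
        proof (rule sum_mono)
          fix i assume i: "i \<in> {..<n}"
          have "x i \<in> X (2 ^ Suc i)" using X_mono[of "2 ^ i" "2 ^ Suc i"] x(1)[of i] by auto
          then have "\<omega> l h (x (Suc i) - x i) \<le> (b * 2 ^ Suc i * h) ^ l * norm (x (Suc i) - x i)"
            unfolding b_def using h by (intro X_modulus X_diff x) auto
          also have "\<dots> = ((2 * b) ^ l * ?\<theta> i) * norm (x (Suc i) - x i)"
            unfolding h2[symmetric, OF less_imp_le[OF i[unfolded lessThan_iff]]] by (simp add: power_mult_distrib mult_ac)
          also have "\<dots> \<le> ((2 * b) ^ l * ?\<theta> i) * (2 * (E (2 ^ i) a + \<epsilon>))"
          proof (rule mult_left_mono)
            have "norm (x (Suc i) - x i) = norm ((a - x i) - (a - x (Suc i)))" by simp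
            also have "\<dots> \<le> norm (a - x i) + norm (a - x (Suc i))" by (rule norm_triangle_ineq4)
            also have "\<dots> \<le> (E (2 ^ i) a + \<epsilon>) + (E (2 ^ Suc i) a + \<epsilon>)" by (intro add_mono x)
            also have "E (2 ^ Suc i) a \<le> E (2 ^ i) a" by (intro error_antimono) auto
            finally show "norm (x (Suc i) - x i) \<le> 2 * (E (2 ^ i) a + \<epsilon>)" by simp
          qed (use b0 in auto)
          finally show "\<omega> l h (x (Suc i) - x i) \<le> 2 * (2 * b) ^ l * (?\<theta> i * (E (2 ^ i) a + \<epsilon>))"
            by (simp only: mult_ac)
        qed
        also have "\<dots> = 2 * (2 * b) ^ l * (\<Sum>i<n. ?\<theta> i * (E (2 ^ i) a + \<epsilon>))" by (simp add: sum_distrib_left)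
        also have "\<dots> \<le> 2 * (2 * b) ^ l * (\<Sum>i\<le>n. ?\<theta> i * (E (2 ^ i) a + \<epsilon>))"
          using b0 \<epsilon> error_nonneg
          by (intro mult_left_mono sum_mono2) (auto intro!: mult_nonneg_nonneg add_nonneg_nonneg)
        finally show ?thesis .
      qed
      have "\<omega> l h a = \<omega> l h ((a - x n) + (x 0 + (\<Sum>i<n. x (Suc i) - x i)))" unfolding tel[symmetric] by simp
      also have "\<dots> \<le> \<omega> l h (a - x n) + (\<omega> l h (x 0) + (\<Sum>i<n. \<omega> l h (x (Suc i) - x i)))"
        using h by (intro order_trans[OF modulus_add_le] add_left_mono order_trans[OF modulus_add_le] modulus_sum_le) auto
      also have "\<dots> \<le> C * (h ^ l * norm a + (\<Sum>i\<le>n. ?\<theta> i * (E (2 ^ i) a + \<epsilon>)))"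
      proof -
        have "0 \<le> h ^ l * norm a" using h by simp
        then have "0 \<le> (M + 1) ^ l * (h ^ l * norm a)" "0 \<le> 2 * (2 * b) ^ l * (h ^ l * norm a)" using M_nonneg b0 by auto
        with t1 t2 t3 show ?thesis unfolding C_def distrib_left distrib_right by linarith
      qed
      also have "(\<Sum>i\<le>n. ?\<theta> i * (E (2 ^ i) a + \<epsilon>)) \<le> (\<Sum>i\<le>n. ?\<theta> i * E (2 ^ i) a + \<epsilon>)"
      proof (rule sum_mono)
        fix i
        have "?\<theta> i \<le> 1" by (intro power_le_one) auto
        then have "?\<theta> i * \<epsilon> \<le> 1 * \<epsilon>" using \<epsilon> by (intro mult_right_mono) auto
        then show "?\<theta> i * (E (2 ^ i) a + \<epsilon>) \<le> ?\<theta> i * E (2 ^ i) a + \<epsilon>" by (simp add: distrib_left)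
      qed
      also have "(\<Sum>i\<le>n. ?\<theta> i * E (2 ^ i) a + \<epsilon>) = (\<Sum>i\<le>n. ?\<theta> i * E (2 ^ i) a) + (real n + 1) * \<epsilon>"
        by (simp add: sum.distrib algebra_simps)
      finally show ?thesis using C0 by (simp add: mult_left_mono algebra_simps)
    qed
    have "\<omega> l h a \<le> C * ?S + e" if "e > 0" for e
    proof -
      \<comment> \<open>The slack collected over the \<open>n + 1\<close> scales then adds up to
        \<open>e\<close>.\<close>
      define \<delta> where "\<delta> = e / (C * (real n + 1))"
      have "C * (real n + 1) > 0" using C0 by simp
      then have "\<delta> > 0" "C * (real n + 1) * \<delta> = e" using that by (auto simp: \<delta>_def)
      with main[of \<delta>] show ?thesis by simp
    qed
    then have "\<omega> l h a \<le> C * ?S" by (rule field_le_epsilon)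
    then show "\<omega> l (1 / 2 ^ n) a \<le> C * ((1 / 2 ^ n) ^ l * norm a + (\<Sum>i\<le>n. ?\<theta> i * E (2 ^ i) a))"
      by (simp only: h_def)
  qed
qed

section \<open>Equivalence of the norms\<close>

text \<open>Merging \<open>norm a\<close> into the entry at 0 turns the right side of the inverse
  estimate into a single convolution.\<close>

definition dyadic_error :: "real \<Rightarrow> 'a \<Rightarrow> nat \<Rightarrow> real" where
  "dyadic_error r a i = 2 powr (real i * r) * E (2 ^ i) a + (if i = 0 then norm a else 0)"

text \<open>The weight \<open>2 powr (n * r)\<close> is split into its shares for
  \<open>n - i\<close> and \<open>i\<close>. The first meets the Bernstein factor and gives the
  ratio \<open>2 powr (r - l)\<close>, which is below 1 in the application because
  \<open>l > r\<close>.\<close>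

lemma modulus_geometric:
  assumes "0 < r"
  obtains C where "0 < C" "\<And>n a. 2 powr (real n * r) * \<omega> l (1 / 2 ^ n) a \<le>
    C * (\<Sum>i\<le>n. (2 powr (r - real l)) ^ (n - i) * dyadic_error r a i)"
proof -
  obtain C where C: "0 < C" "\<And>n a. \<omega> l (1 / 2 ^ n) a \<le>
    C * ((1 / 2 ^ n) ^ l * norm a + (\<Sum>i\<le>n. (1 / 2 ^ (n - i)) ^ l * E (2 ^ i) a))"
    by (rule inverse_estimate[of l]) blast
  let ?\<theta> = "2 powr (r - real l)"
  have th: "2 powr (real n * r) * (1 / 2 ^ (n - i)) ^ l = ?\<theta> ^ (n - i) * 2 powr (real i * r)" if "i \<le> n" for n i
  proof -
    have "(1 / 2 ^ (n - i)) ^ l = 2 powr (- (real (n - i) * real l))"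
      by (simp add: powr_minus powr_realpow[symmetric] powr_powr divide_inverse power_inverse flip: power_mult)
    moreover have "?\<theta> ^ (n - i) = 2 powr ((r - real l) * real (n - i))"
      by (simp add: powr_realpow[symmetric] powr_powr)
    ultimately show ?thesis
      using that by (simp add: powr_add[symmetric] of_nat_diff algebra_simps)
  qed
  show thesis
  proof (rule that[OF C(1)])
    fix n a
    have "2 powr (real n * r) * \<omega> l (1 / 2 ^ n) a \<le> 2 powr (real n * r) * (C * ((1 / 2 ^ n) ^ l * norm a + (\<Sum>i\<le>n. (1 / 2 ^ (n - i)) ^ l * E (2 ^ i) a)))"
      by (intro mult_left_mono C) auto
    also have "\<dots> = C * ((2 powr (real n * r) * (1 / 2 ^ (n - 0)) ^ l) * norm a + (\<Sum>i\<le>n. (2 powr (real n * r) * (1 / 2 ^ (n - i)) ^ l) * E (2 ^ i) a))"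
      by (simp add: distrib_left sum_distrib_left mult_ac)
    also have "\<dots> = C * (?\<theta> ^ n * norm a + (\<Sum>i\<le>n. (?\<theta> ^ (n - i) * 2 powr (real i * r)) * E (2 ^ i) a))"
      using th by (simp add: th[of 0 n, simplified])
    also have "?\<theta> ^ n * norm a = (\<Sum>i\<le>n. ?\<theta> ^ (n - i) * (if i = 0 then norm a else 0))"
      by (simp add: if_distrib cong: if_cong)
    finally show "2 powr (real n * r) * \<omega> l (1 / 2 ^ n) a \<le>
      C * (\<Sum>i\<le>n. ?\<theta> ^ (n - i) * dyadic_error r a i)"
      by (simp add: dyadic_error_def sum.distrib[symmetric] distrib_left mult.assoc add.commute)
  qed
qed

section \<open>The two norm estimates for finite exponents\<close>

definition besov_integral :: "nat \<Rightarrow> real \<Rightarrow> real \<Rightarrow> 'a \<Rightarrow> ennreal" where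
  "besov_integral l r q a = (\<integral>\<^sup>+h\<in>{0<..}. ennreal ((h powr (- r) * \<omega> l h a) powr q / h) \<partial>lborel)"

definition error_term :: "real \<Rightarrow> real \<Rightarrow> 'a \<Rightarrow> nat \<Rightarrow> real" where
  "error_term r q a k = E (real k) a powr q * real (k + 1) powr (r * q) * (1 / real (k + 1))"

lemma error_term_nonneg: "0 \<le> error_term r q a k"
  by (simp add: error_term_def)

text \<open>The scheme starts with \<open>X 0 = {0}\<close>, so the approximation norm contains the
  norm of \<open>a\<close> as its term at 0.\<close>

lemma error_term_0: "error_term r q a 0 = norm a powr q"
  by (simp add: error_term_def error_zero)

text \<open>If the modulus stayed above some \<open>\<epsilon>\<close> for all positive
  \<open>h\<close>, the Besov integral would dominate a multiple of a tail of the harmonic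
  series.\<close>

lemma continuous_if_besov_integral_finite:
  assumes r: "0 < r" and q: "1 \<le> q" and fin: "besov_integral (Suc k) r q a < \<infinity>"
  shows "a \<in> continuous_vectors"
proof (rule continuous_vectorsI)
  fix \<epsilon> :: real assume \<epsilon>: "\<epsilon> > 0"
  show "\<exists>h>0. \<omega> (Suc k) h a \<le> \<epsilon>"
  proof (rule ccontr)
    assume "\<not> ?thesis"
    then have big: "\<omega> (Suc k) h a > \<epsilon>" if "h > 0" for h using that by force
    have "(\<Sum>m. ennreal (\<epsilon> powr q * inverse (real (m + 2)))) \<le>
      (\<Sum>m. ennreal ((real (m + 1) powr r * \<omega> (Suc k) (1 / real (m + 2)) a) powr q / real (m + 2)))"
    proof (intro suminf_le ennreal_leI summableI)
      fix m
      have "1 * \<epsilon> \<le> real (m + 1) powr r * \<omega> (Suc k) (1 / real (m + 2)) a"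
        using r \<epsilon> big[of "1 / real (m + 2)"] by (intro mult_mono ge_one_powr_ge_zero) auto
      then have "\<epsilon> powr q \<le> (real (m + 1) powr r * \<omega> (Suc k) (1 / real (m + 2)) a) powr q"
        using q \<epsilon> by (intro powr_mono2) auto
      then show "\<epsilon> powr q * inverse (real (m + 2)) \<le> (real (m + 1) powr r * \<omega> (Suc k) (1 / real (m + 2)) a) powr q / real (m + 2)"
        by (simp add: divide_inverse mult_right_mono)
    qed
    also have "\<dots> \<le> besov_integral (Suc k) r q a"
      unfolding besov_integral_def using r q
      by (intro harmonic_nn_integral_lower modulus_nonneg modulus_mono) auto
    also have "\<dots> < \<infinity>" by (rule fin)
    finally have "summable (\<lambda>m. \<epsilon> powr q * inverse (real (m + 2)))"
      by (intro summable_suminf_not_top) auto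
    then have "summable (\<lambda>m. inverse (real (m + 2)))"
      using \<epsilon> by (subst (asm) summable_cmult_iff) auto
    then have "summable (\<lambda>m. inverse (real m))" by (subst (asm) summable_iff_shift)
    then show False using not_summable_harmonic[where 'a = real] by simp
  qed
qed

text \<open>The Jackson estimate at frequency \<open>m + 1\<close> is matched with the interval
  ending at \<open>1 / (m + 1)\<close>. The minorant there sees the modulus at
  \<open>1 / (m + 2)\<close>, so one dilation by 2 is required; the term at 0 contributes the norm
  of \<open>a\<close>.\<close>

lemma direct_finite:
  assumes r: "0 < r" and q: "1 \<le> q"
  obtains C where "0 < C" "\<And>a. besov_integral (Suc k) r q a < \<infinity> \<Longrightarrow>
    (\<Sum>n. ennreal (error_term r q a n)) \<le> ennreal (norm a powr q) + ennreal C * besov_integral (Suc k) r q a"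
proof -
  let ?l = "Suc k"
  obtain B where B: "0 < B" "\<And>\<sigma> a. 0 < \<sigma> \<Longrightarrow> a \<in> continuous_vectors \<Longrightarrow> E \<sigma> a \<le> B * \<omega> ?l (1 / \<sigma>) a"
    by (rule jackson[of ?l]) auto
  \<comment> \<open>\<open>(2 * M) ^ ?l\<close> is the price of the dilation by 2, and
    \<open>2 powr (r * q)\<close> that of \<open>m + 2 \<le> 2 * (m + 1)\<close> in the
    weight.\<close>
  define C where "C = (B * (2 * M) ^ ?l) powr q * 2 powr (r * q)"
  have C0: "C > 0" using B M_pos by (simp add: C_def)
  show thesis
  proof (rule that[OF C0])
    fix a assume fin: "besov_integral ?l r q a < \<infinity>"
    have a: "a \<in> continuous_vectors" by (rule continuous_if_besov_integral_finite[OF r q fin])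
    let ?w = "\<lambda>m. (real (m + 1) powr r * \<omega> ?l (1 / real (m + 2)) a) powr q / real (m + 2)"
    have tm: "error_term r q a (Suc m) \<le> C * ?w m" for m
    proof -
      have w0: "0 \<le> \<omega> ?l (1 / real (m + 2)) a" by (intro modulus_nonneg) auto
      have "E (real (Suc m)) a \<le> B * \<omega> ?l (1 / real (Suc m)) a" by (intro B a) auto
      also have "\<omega> ?l (1 / real (Suc m)) a \<le> \<omega> ?l (real 2 * (1 / real (m + 2))) a"
        by (intro modulus_mono) (auto simp: field_simps)
      also have "\<omega> ?l (real 2 * (1 / real (m + 2))) a \<le> (real 2 * M) ^ ?l * \<omega> ?l (1 / real (m + 2)) a"
        by (intro modulus_multiple) auto
      finally have "E (real (Suc m)) a \<le> (B * (2 * M) ^ ?l) * \<omega> ?l (1 / real (m + 2)) a"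
        using B(1) by (simp add: mult_left_mono mult.assoc)
      then have "E (real (Suc m)) a powr q \<le> ((B * (2 * M) ^ ?l) * \<omega> ?l (1 / real (m + 2)) a) powr q"
        using q error_nonneg by (intro powr_mono2) auto
      also have "\<dots> = (B * (2 * M) ^ ?l) powr q * \<omega> ?l (1 / real (m + 2)) a powr q" by (rule powr_mult)
      finally have e1: "E (real (Suc m)) a powr q \<le> (B * (2 * M) ^ ?l) powr q * \<omega> ?l (1 / real (m + 2)) a powr q" .
      have "real (Suc m + 1) powr (r * q) \<le> (2 * real (m + 1)) powr (r * q)"
        using r q by (intro powr_mono2) auto
      then have e2: "real (Suc m + 1) powr (r * q) \<le> 2 powr (r * q) * real (m + 1) powr (r * q)"
        by (simp only: powr_mult)
      have "error_term r q a (Suc m) \<le> ((B * (2 * M) ^ ?l) powr q * \<omega> ?l (1 / real (m + 2)) a powr q) * (2 powr (r * q) * real (m + 1) powr (r * q)) * (1 / real (m + 2))"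
        unfolding error_term_def using e1 e2 by (intro mult_mono) auto
      also have "\<dots> = C * ?w m" by (simp add: C_def powr_mult powr_powr)
      finally show ?thesis .
    qed
    have wI: "(\<Sum>m. ennreal (?w m)) \<le> besov_integral ?l r q a"
      unfolding besov_integral_def using r q
      by (intro harmonic_nn_integral_lower modulus_nonneg modulus_mono) auto
    show "(\<Sum>n. ennreal (error_term r q a n)) \<le> ennreal (norm a powr q) + ennreal C * besov_integral ?l r q a"
    proof (rule suminf_le_const[OF summableI])
      fix N
      have "(\<Sum>n<N. ennreal (error_term r q a n)) \<le> (\<Sum>n<Suc N. ennreal (error_term r q a n))"
        by (rule sum_mono2) auto
      also have "\<dots> = ennreal (norm a powr q) + (\<Sum>m<N. ennreal (error_term r q a (Suc m)))"
        by (subst sum.lessThan_Suc_shift) (simp add: error_term_0)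
      also have "(\<Sum>m<N. ennreal (error_term r q a (Suc m))) \<le> (\<Sum>m<N. ennreal C * ennreal (?w m))"
        using tm C0 by (intro sum_mono) (simp add: ennreal_leI ennreal_mult[symmetric])
      also have "\<dots> = ennreal C * (\<Sum>m<N. ennreal (?w m))" by (rule sum_distrib_left[symmetric])
      also have "(\<Sum>m<N. ennreal (?w m)) \<le> (\<Sum>m. ennreal (?w m))" by (rule sum_le_suminf) auto
      also note wI
      finally show "(\<Sum>n<N. ennreal (error_term r q a n)) \<le> ennreal (norm a powr q) + ennreal C * besov_integral ?l r q a"
        by (simp add: add_left_mono mult_left_mono)
    qed
  qed
qed

text \<open>For \<open>h \<le> 1\<close> the dyadic sum is handled by the convolution bound, the
  Hardy inequality and condensation. For \<open>h > 1\<close> the modulus is bounded by a multiple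
  of the norm, and the resulting geometric series is a multiple of the error term at 0.\<close>

lemma inverse_finite:
  assumes r: "0 < r" "r < real l" and q: "1 \<le> q"
  obtains C where "0 < C" "\<And>a. besov_integral l r q a \<le> ennreal C * (\<Sum>n. ennreal (error_term r q a n))"
proof -
  obtain C where C: "0 < C" "\<And>n a. 2 powr (real n * r) * \<omega> l (1 / 2 ^ n) a \<le>
    C * (\<Sum>i\<le>n. (2 powr (r - real l)) ^ (n - i) * dyadic_error r a i)"
    by (rule modulus_geometric[OF r(1), of l]) blast
  define \<theta> where "\<theta> = 2 powr (r - real l)"
  have \<theta>: "0 < \<theta>" "\<theta> < 1"
  proof -
    have "2 powr (r - real l) < 2 powr 0" using r by (intro powr_less_mono) auto
    then show "\<theta> < 1" by (simp add: \<theta>_def)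
  qed (simp add: \<theta>_def)
  define H where "H = (1 - \<theta>) powr (1 - q) / (1 - \<theta>)"
  have H0: "0 < H" using \<theta> by (simp add: H_def)
  \<comment> \<open>\<open>2 powr q\<close> covers the entry at 0, where
    \<open>E 1 a + norm a\<close> is at most \<open>2 * norm a\<close>; the second summand is the
    condensation constant.\<close>
  define G where "G = 2 powr q + 2 * 2 powr (r * q)"
  have G0: "0 < G" by (simp add: G_def add_pos_pos)
  define C1 where "C1 = (2 powr r * C) powr q * (H * G)"
  \<comment> \<open>The ratio of the geometric series over the blocks beyond
    \<open>h = 1\<close>.\<close>
  define \<rho> where "\<rho> = 2 powr (- (r * q))"
  have \<rho>: "0 < \<rho>" "\<rho> < 1"
  proof -
    have "2 powr (- (r * q)) < 2 powr 0" using r q by (intro powr_less_mono) auto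
    then show "\<rho> < 1" by (simp add: \<rho>_def)
  qed (simp add: \<rho>_def)
  define C2 where "C2 = ((M + 1) ^ l) powr q / (1 - \<rho>)"
  have C12: "0 < C1" "0 < C2" using C H0 G0 M_nonneg \<rho> by (auto simp: C1_def C2_def add_nonneg_pos)
  show thesis
  proof (rule that[of "C1 + C2"])
    fix a
    let ?u = "\<lambda>n. (2 powr r * (2 powr (real n * r) * \<omega> l (1 / 2 ^ n) a)) powr q"
    let ?S = "\<Sum>n. ennreal (error_term r q a n)"
    let ?B = "dyadic_error r a"
    have B0: "0 \<le> ?B i" for i using error_nonneg by (auto simp: dyadic_error_def intro!: add_nonneg_nonneg)
    have "besov_integral l r q a \<le> (\<Sum>n. ennreal (?u n)) +
      (\<Sum>n. ennreal ((2 powr (- (real n * r)) * ((M + 1) ^ l * norm a)) powr q))"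
      unfolding besov_integral_def using r q
      by (intro dyadic_nn_integral_upper modulus_nonneg modulus_mono modulus_le_norm) auto
    also have "(\<Sum>n. ennreal (?u n)) \<le> ennreal C1 * ?S"
    proof (rule suminf_le_const[OF summableI])
      fix N
      let ?A = "\<lambda>n. \<Sum>i\<le>n. \<theta> ^ (n - i) * ?B i"
      have "(\<Sum>n<N. ?u n) \<le> (\<Sum>n<N. (2 powr r * C) powr q * ?A n powr q)"
      proof (rule sum_mono)
        fix n
        have "2 powr r * (2 powr (real n * r) * \<omega> l (1 / 2 ^ n) a) \<le> 2 powr r * (C * ?A n)"
          unfolding \<theta>_def by (intro mult_left_mono C) auto
        then have "?u n \<le> (2 powr r * (C * ?A n)) powr q"
          using q by (intro powr_mono2) (auto intro!: mult_nonneg_nonneg modulus_nonneg)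
        also have "2 powr r * (C * ?A n) = (2 powr r * C) * ?A n" by (rule mult.assoc[symmetric])
        also have "((2 powr r * C) * ?A n) powr q = (2 powr r * C) powr q * ?A n powr q" by (rule powr_mult)
        finally show "?u n \<le> (2 powr r * C) powr q * ?A n powr q" .
      qed
      also have "\<dots> = (2 powr r * C) powr q * (\<Sum>n<N. ?A n powr q)" by (rule sum_distrib_left[symmetric])
      also have "(\<Sum>n<N. ?A n powr q) \<le> H * (\<Sum>n<N. ?B n powr q)"
        unfolding H_def by (rule hardy_geometric[OF q \<theta> B0])
      also have "(\<Sum>n<N. ?B n powr q) \<le> G * (\<Sum>k<2 ^ N. error_term r q a k)"
      proof (cases N)
        case (Suc N')
        have d: "(\<Sum>n=1..N'. (2 powr (real n * r) * E (real (2 ^ n)) a) powr q) \<le> 2 * 2 powr (r * q) * (\<Sum>k=1..<2 ^ N'. error_term r q a k)"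
          unfolding error_term_def using r q
          by (intro dyadic_condensation[of "\<lambda>k. E (real k) a"] error_nonneg error_antimono) auto
        have t0: "?B 0 powr q \<le> 2 powr q * error_term r q a 0"
        proof -
          have "?B 0 \<le> 2 * norm a" using error_le_norm[of 1 a] by (simp add: dyadic_error_def)
          then have "?B 0 powr q \<le> (2 * norm a) powr q" using q B0[of 0] by (intro powr_mono2) auto
          then show ?thesis unfolding error_term_0 by (simp only: powr_mult)
        qed
        have "(\<Sum>n<N. ?B n powr q) = ?B 0 powr q + (\<Sum>n=1..N'. ?B n powr q)"
          unfolding Suc by (simp add: lessThan_Suc_atMost atMost_atLeast0 sum.atLeast_Suc_atMost[of 0] del: sum.lessThan_Suc)
        also have "(\<Sum>n=1..N'. ?B n powr q) = (\<Sum>n=1..N'. (2 powr (real n * r) * E (real (2 ^ n)) a) powr q)"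
          by (rule sum.cong) (auto simp: dyadic_error_def)
        also have "?B 0 powr q + \<dots> \<le> 2 powr q * error_term r q a 0 + 2 * 2 powr (r * q) * (\<Sum>k=1..<2 ^ N'. error_term r q a k)"
          by (rule add_mono[OF t0 d])
        also have "\<dots> \<le> G * error_term r q a 0 + G * (\<Sum>k=1..<2 ^ N'. error_term r q a k)"
          by (intro add_mono mult_right_mono sum_nonneg error_term_nonneg) (auto simp: G_def)
        also have "\<dots> = G * (error_term r q a 0 + (\<Sum>k=1..<2 ^ N'. error_term r q a k))" by (simp add: distrib_left)
        also have "error_term r q a 0 + (\<Sum>k=1..<2 ^ N'. error_term r q a k) = (\<Sum>k<2 ^ N'. error_term r q a k)"
          by (simp add: lessThan_atLeast0 sum.atLeast_Suc_lessThan[of 0])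
        also have "\<dots> \<le> (\<Sum>k<2 ^ N. error_term r q a k)"
          unfolding Suc by (rule sum_mono2) (auto intro: error_term_nonneg)
        finally show ?thesis using G0 by (simp add: mult_left_mono)
      qed (use G0 error_term_nonneg in \<open>auto simp: lessThan_Suc\<close>)
      finally have "(\<Sum>n<N. ?u n) \<le> C1 * (\<Sum>k<2 ^ N. error_term r q a k)"
        using H0 by (simp add: C1_def mult_left_mono mult.assoc)
      then have "(\<Sum>n<N. ennreal (?u n)) \<le> ennreal (C1 * (\<Sum>k<2 ^ N. error_term r q a k))"
        by (simp add: sum_ennreal ennreal_leI)
      also have "\<dots> = ennreal C1 * (\<Sum>k<2 ^ N. ennreal (error_term r q a k))"
        using C12 by (simp add: ennreal_mult sum_nonneg error_term_nonneg sum_ennreal)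
      also have "\<dots> \<le> ennreal C1 * ?S"
        by (intro mult_left_mono sum_le_suminf) auto
      finally show "(\<Sum>n<N. ennreal (?u n)) \<le> ennreal C1 * ?S" .
    qed
    also have "(\<Sum>n. ennreal ((2 powr (- (real n * r)) * ((M + 1) ^ l * norm a)) powr q)) \<le> ennreal C2 * ?S"
    proof -
      have e: "(2 powr (- (real n * r)) * ((M + 1) ^ l * norm a)) powr q = \<rho> ^ n * (((M + 1) ^ l) powr q * norm a powr q)" for n
      proof -
        have "\<rho> ^ n = 2 powr (- (real n * r) * q)"
          unfolding \<rho>_def by (subst powr_realpow[symmetric]) (simp_all add: powr_powr mult_ac)
        then show ?thesis by (simp add: powr_mult powr_powr)
      qed
      have "(\<lambda>n. \<rho> ^ n * (((M + 1) ^ l) powr q * norm a powr q)) sums (1 / (1 - \<rho>) * (((M + 1) ^ l) powr q * norm a powr q))"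
        using \<rho> by (intro sums_mult2 geometric_sums) auto
      then have "(\<Sum>n. ennreal (\<rho> ^ n * (((M + 1) ^ l) powr q * norm a powr q))) = ennreal (1 / (1 - \<rho>) * (((M + 1) ^ l) powr q * norm a powr q))"
        using \<rho> by (intro suminf_ennreal_eq) auto
      also have "\<dots> = ennreal C2 * ennreal (error_term r q a 0)"
        using C12 unfolding error_term_0 by (subst ennreal_mult[symmetric]) (auto simp: C2_def)
      also have "\<dots> \<le> ennreal C2 * ?S"
        by (intro mult_left_mono ennreal_nth_le_suminf[of "\<lambda>n. ennreal (error_term r q a n)" 0]) auto
      finally show ?thesis unfolding e .
    qed
    finally show "besov_integral l r q a \<le> ennreal (C1 + C2) * ?S"
      using C12 by (simp add: add_mono distrib_right)
  qed (use C12 in simp)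
qed

text \<open>An infinite Besov integral makes the first bound trivial, so the direct estimate is
  called only where continuity of the orbit is at hand. The term at 0 lets the second bound recover
  \<open>norm a\<close>.\<close>

lemma norm_equivalence_finite:
  assumes r: "0 < r" and q: "1 \<le> q"
  defines "l \<equiv> nat \<lfloor>r\<rfloor> + 1"
  defines "N \<equiv> \<lambda>a. ennreal (norm a) + ennreal_root q (besov_integral l r q a)"
    and "N' \<equiv> \<lambda>a. ennreal_root q (\<Sum>n. ennreal (error_term r q a n))"
  obtains C C' where "0 < C" "0 < C'" "\<And>a. N' a \<le> ennreal C * N a" "\<And>a. N a \<le> ennreal C' * N' a"
proof -
  have l: "l = Suc (nat \<lfloor>r\<rfloor>)" "r < real l" using r by (auto simp: l_def) linarith
  obtain C where C: "0 < C" "\<And>a. besov_integral l r q a < \<infinity> \<Longrightarrow>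
    (\<Sum>n. ennreal (error_term r q a n)) \<le> ennreal (norm a powr q) + ennreal C * besov_integral l r q a"
    unfolding l(1) by (rule direct_finite[OF r q]) blast
  obtain C' where C': "0 < C'" "\<And>a. besov_integral l r q a \<le> ennreal C' * (\<Sum>n. ennreal (error_term r q a n))"
    by (rule inverse_finite[OF r l(2) q]) blast
  define D where "D = 2 * (1 + C powr (1 / q))"
  define D' where "D' = 1 + C' powr (1 / q)"
  show thesis
  proof (rule that[of D D'])
    show "0 < D" "0 < D'" by (simp_all add: D_def D'_def add_pos_nonneg)
    then have Dt: "ennreal D * top = top" by (simp add: ennreal_mult_top)
    fix a
    show "N' a \<le> ennreal D * N a"
    proof (cases "besov_integral l r q a < \<infinity>")
      case True
      have "N' a \<le> ennreal_root q (ennreal (norm a powr q) + ennreal C * besov_integral l r q a)"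
        unfolding N'_def using q by (intro ennreal_root_mono C(2) True) auto
      also have "\<dots> \<le> 2 * (ennreal_root q (ennreal (norm a powr q)) + ennreal_root q (ennreal C * besov_integral l r q a))"
        by (rule ennreal_root_add[OF q])
      also have "\<dots> = 2 * (ennreal (norm a) + ennreal (C powr (1 / q)) * ennreal_root q (besov_integral l r q a))"
        using q C by (simp add: ennreal_root_powr ennreal_root_cmult)
      also have "\<dots> \<le> 2 * (ennreal (1 + C powr (1 / q)) * ennreal (norm a) + ennreal (1 + C powr (1 / q)) * ennreal_root q (besov_integral l r q a))"
      proof (intro mult_left_mono add_mono mult_right_mono)
        show "ennreal (norm a) \<le> ennreal (1 + C powr (1 / q)) * ennreal (norm a)"
          using mult_right_mono[of 1 "1 + C powr (1 / q)" "norm a"]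
          by (subst ennreal_mult[symmetric]) (auto intro!: ennreal_leI)
      qed (auto intro!: ennreal_leI)
      also have "\<dots> = ennreal D * N a"
      proof -
        have "ennreal D = 2 * ennreal (1 + C powr (1 / q))" unfolding D_def by (subst ennreal_mult) auto
        then show ?thesis by (simp only: N_def distrib_left mult.assoc)
      qed
      finally show ?thesis .
    next
      case False
      then have "besov_integral l r q a = top" by (simp add: not_less top_unique)
      then show ?thesis using Dt by (simp add: N_def)
    qed
    have "ennreal (norm a) = ennreal_root q (ennreal (error_term r q a 0))"
      using q by (simp add: error_term_0 ennreal_root_powr)
    also have "\<dots> \<le> N' a"
      unfolding N'_def using q
      by (intro ennreal_root_mono ennreal_nth_le_suminf[of "\<lambda>n. ennreal (error_term r q a n)" 0]) auto
    finally have n: "ennreal (norm a) \<le> N' a" .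
    have "ennreal_root q (besov_integral l r q a) \<le> ennreal_root q (ennreal C' * (\<Sum>n. ennreal (error_term r q a n)))"
      using q by (intro ennreal_root_mono C') auto
    also have "\<dots> = ennreal (C' powr (1 / q)) * N' a"
      unfolding N'_def by (rule ennreal_root_cmult[OF C'(1)])
    finally have "N a \<le> N' a + ennreal (C' powr (1 / q)) * N' a"
      unfolding N_def by (rule add_mono[OF n])
    also have "\<dots> = ennreal D' * N' a" by (simp add: D'_def distrib_right)
    finally show "N a \<le> ennreal D' * N' a" .
  qed
qed

text \<open>A finite Besov norm \<open>s\<close> bounds the modulus by \<open>s * h powr r\<close>,
  which yields continuity directly. In the converse direction \<open>dyadic_error\<close> is at most
  \<open>2 * s\<close>, so a geometric sum takes the place of the Hardy inequality.\<close>

lemma norm_equivalence_sup: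
  assumes r: "0 < r"
  defines "l \<equiv> nat \<lfloor>r\<rfloor> + 1"
  defines "N \<equiv> \<lambda>a. ennreal (norm a) + (SUP h\<in>{0<..}. ennreal (h powr (- r) * \<omega> l h a))"
    and "N' \<equiv> \<lambda>a. (SUP k. ennreal (E (real k) a * real (k + 1) powr r))"
  obtains C C' where "0 < C" "0 < C'" "\<And>a. N' a \<le> ennreal C * N a" "\<And>a. N a \<le> ennreal C' * N' a"
proof -
  have l: "l = Suc (nat \<lfloor>r\<rfloor>)" "r < real l" "0 < l" using r by (auto simp: l_def) linarith
  obtain B where B: "0 < B" "\<And>\<sigma> a. 0 < \<sigma> \<Longrightarrow> a \<in> continuous_vectors \<Longrightarrow> E \<sigma> a \<le> B * \<omega> l (1 / \<sigma>) a"
    by (rule jackson[OF l(3)]) blast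
  obtain C where C: "0 < C" "\<And>n a. 2 powr (real n * r) * \<omega> l (1 / 2 ^ n) a \<le>
    C * (\<Sum>i\<le>n. (2 powr (r - real l)) ^ (n - i) * dyadic_error r a i)"
    by (rule modulus_geometric[OF r(1), of l]) blast
  define D where "D = 1 + B * 2 powr r"
  have D0: "0 < D" using B by (simp add: D_def add_pos_nonneg)
  define \<theta> where "\<theta> = 2 powr (r - real l)"
  have \<theta>: "0 < \<theta>" "\<theta> < 1"
  proof -
    have "2 powr (r - real l) < 2 powr 0" using l by (intro powr_less_mono) auto
    then show "\<theta> < 1" by (simp add: \<theta>_def)
  qed (simp add: \<theta>_def)
  define D1 where "D1 = 2 powr r * (C * (2 / (1 - \<theta>))) + (M + 1) ^ l"
  have D1: "0 \<le> 2 powr r * (C * (2 / (1 - \<theta>)))" "0 \<le> (M + 1) ^ l" using C \<theta> M_nonneg by auto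
  then have D10: "0 \<le> D1" by (simp add: D1_def)
  show thesis
  proof (rule that[of D "1 + D1"])
    show "0 < D" "0 < 1 + D1" using D0 D10 by auto
    fix a
    show "N' a \<le> ennreal D * N a"
    proof (cases "N a" rule: ennreal_cases)
      case top
      then show ?thesis using D0 by (simp add: ennreal_mult_top)
    next
      case (real s)
      have s1: "norm a \<le> s"
      proof -
        have "ennreal (norm a) \<le> N a" by (simp add: N_def)
        then show ?thesis using real by simp
      qed
      have s2: "h powr (- r) * \<omega> l h a \<le> s" if "0 < h" for h
      proof -
        have "ennreal (h powr (- r) * \<omega> l h a) \<le> (SUP h\<in>{0<..}. ennreal (h powr (- r) * \<omega> l h a))"
          using that by (intro SUP_upper) auto
        also have "\<dots> \<le> N a" by (simp add: N_def)
        finally show ?thesis using real by simp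
      qed
      have cv: "a \<in> continuous_vectors"
      proof (rule continuous_vectorsI[of "nat \<lfloor>r\<rfloor>"])
        fix \<epsilon> :: real assume \<epsilon>: "\<epsilon> > 0"
        \<comment> \<open>Chosen so that \<open>?h powr r = \<epsilon> / (s + 1)\<close>; the added
          1 keeps the denominator positive when \<open>s = 0\<close>.\<close>
        let ?h = "(\<epsilon> / (s + 1)) powr (1 / r)"
        have h: "?h > 0" using \<epsilon> real by auto
        have "\<omega> l ?h a = ?h powr r * (?h powr (- r) * \<omega> l ?h a)"
          using h by (simp add: powr_minus)
        also have "\<dots> \<le> ?h powr r * s" by (intro mult_left_mono s2 h) simp
        also have "?h powr r = \<epsilon> / (s + 1)" using r \<epsilon> real by (simp add: powr_powr)
        also have "\<epsilon> / (s + 1) * s \<le> \<epsilon>" using \<epsilon> real by (simp add: field_simps)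
        finally show "\<exists>h>0. \<omega> (Suc (nat \<lfloor>r\<rfloor>)) h a \<le> \<epsilon>" using h unfolding l(1) by blast
      qed
      have "E (real k) a * real (k + 1) powr r \<le> D * s" for k
      proof (cases k)
        case 0
        have "1 * norm a \<le> D * s" using s1 B by (intro mult_mono) (auto simp: D_def)
        then show ?thesis using 0 by (simp add: error_zero)
      next
        case (Suc m)
        \<comment> \<open>For \<open>k \<ge> 1\<close> one has \<open>k + 1 \<le> 2 * k\<close>,
          which aligns the weight with the scale \<open>1 / k\<close> of the Jackson
          estimate.\<close>
        have "E (real k) a * real (k + 1) powr r \<le> (B * \<omega> l (1 / real k) a) * (2 * real k) powr r"
          using Suc r B(1) by (intro mult_mono B cv powr_mono2) (auto intro!: mult_nonneg_nonneg modulus_nonneg)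
        also have "\<dots> = (B * 2 powr r) * ((1 / real k) powr (- r) * \<omega> l (1 / real k) a)"
          by (simp add: powr_mult powr_divide powr_minus)
        also have "\<dots> \<le> (B * 2 powr r) * s" using B(1) Suc by (intro mult_left_mono s2) auto
        also have "\<dots> \<le> D * s" using real by (intro mult_right_mono) (auto simp: D_def)
        finally show ?thesis .
      qed
      then have "N' a \<le> ennreal (D * s)" unfolding N'_def by (intro SUP_least ennreal_leI)
      then show ?thesis using real D0 by (simp add: ennreal_mult)
    qed
    show "N a \<le> ennreal (1 + D1) * N' a"
    proof (cases "N' a" rule: ennreal_cases)
      case top
      then show ?thesis using D10 by (simp add: ennreal_mult_top)
    next
      case (real s)
      have s: "E (real k) a * real (k + 1) powr r \<le> s" for k
      proof -
        have "ennreal (E (real k) a * real (k + 1) powr r) \<le> N' a" unfolding N'_def by (intro SUP_upper) auto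
        then show ?thesis using real by simp
      qed
      have n: "norm a \<le> s" using s[of 0] by (simp add: error_zero)
      have B2: "dyadic_error r a i \<le> 2 * s" for i
      proof -
        have "2 powr (real i * r) = real (2 ^ i) powr r" by (simp add: powr_powr[symmetric] powr_realpow)
        also have "\<dots> \<le> real (2 ^ i + 1) powr r" using r by (intro powr_mono2) auto
        finally have "2 powr (real i * r) * E (2 ^ i) a \<le> real (2 ^ i + 1) powr r * E (real (2 ^ i)) a"
          using error_nonneg by (simp add: mult_right_mono)
        also have "\<dots> \<le> s" using s[of "2 ^ i"] by (simp add: mult.commute)
        finally show ?thesis using n real by (auto simp: dyadic_error_def)
      qed
      have A: "2 powr (real n * r) * \<omega> l (1 / 2 ^ n) a \<le> C * (2 / (1 - \<theta>)) * s" for n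
      proof -
        have "(\<Sum>i\<le>n. \<theta> ^ (n - i) * dyadic_error r a i) \<le> (\<Sum>i\<le>n. \<theta> ^ (n - i) * (2 * s))"
          using \<theta> by (intro sum_mono mult_left_mono B2) auto
        also have "\<dots> = (\<Sum>i\<le>n. \<theta> ^ (n - i)) * (2 * s)" by (rule sum_distrib_right[symmetric])
        also have "(\<Sum>i\<le>n. \<theta> ^ (n - i)) = (\<Sum>i<Suc n. \<theta> ^ i)"
          using sum.nat_diff_reindex[of "\<lambda>i. \<theta> ^ i" "Suc n"] by (simp add: lessThan_Suc_atMost)
        also have "\<dots> \<le> 1 / (1 - \<theta>)" using \<theta> by (simp add: sum_gp_strict divide_right_mono del: sum.lessThan_Suc power_Suc)
        finally have "(\<Sum>i\<le>n. \<theta> ^ (n - i) * dyadic_error r a i) \<le> 1 / (1 - \<theta>) * (2 * s)"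
          using real by (simp add: mult_right_mono)
        then have "C * (\<Sum>i\<le>n. \<theta> ^ (n - i) * dyadic_error r a i) \<le> C * (1 / (1 - \<theta>) * (2 * s))"
          using C(1) by (intro mult_left_mono) auto
        then show ?thesis using C(2)[of n a] by (simp add: \<theta>_def[symmetric])
      qed
      have "h powr (- r) * \<omega> l h a \<le> D1 * s" if h: "0 < h" for h
      proof (cases "h \<le> 1")
        case True
        obtain n where n: "1 / 2 ^ Suc n < h" "h \<le> 1 / 2 ^ n" using dyadic_below_one[OF h True] .
        have "h powr (- r) \<le> (1 / 2 ^ Suc n) powr (- r)" using r n by (intro powr_mono2') auto
        also have "(1 / 2 ^ Suc n) powr (- r) = 2 powr r * 2 powr (real n * r)"
        proof -
          have "(1 / 2 ^ Suc n) powr (- r) = (2 powr (real (Suc n))) powr r"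
            by (simp add: powr_divide powr_minus powr_realpow del: power_Suc of_nat_Suc)
          also have "\<dots> = 2 powr (real (Suc n) * r)" by (rule powr_powr)
          finally show ?thesis by (simp add: powr_add[symmetric] algebra_simps)
        qed
        finally have "h powr (- r) * \<omega> l h a \<le> (2 powr r * 2 powr (real n * r)) * \<omega> l (1 / 2 ^ n) a"
          using n h by (intro mult_mono modulus_mono modulus_nonneg) auto
        also have "\<dots> = 2 powr r * (2 powr (real n * r) * \<omega> l (1 / 2 ^ n) a)" by (rule mult.assoc)
        also have "\<dots> \<le> 2 powr r * (C * (2 / (1 - \<theta>)) * s)" by (intro mult_left_mono A) auto
        also have "\<dots> = (2 powr r * (C * (2 / (1 - \<theta>)))) * s" by (simp only: mult.assoc)
        also have "\<dots> \<le> D1 * s" using real D1 by (intro mult_right_mono) (auto simp: D1_def)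
        finally show ?thesis .
      next
        case False
        have "h powr (- r) \<le> h powr 0" using False r by (intro powr_mono) auto
        then have "h powr (- r) * \<omega> l h a \<le> 1 * ((M + 1) ^ l * norm a)"
          using h by (intro mult_mono modulus_le_norm) (auto intro: modulus_nonneg)
        also have "\<dots> \<le> (M + 1) ^ l * s" using n D1 by (simp add: mult_left_mono)
        also have "\<dots> \<le> D1 * s" using real D1 by (intro mult_right_mono) (auto simp: D1_def)
        finally show ?thesis .
      qed
      then have "(SUP h\<in>{0<..}. ennreal (h powr (- r) * \<omega> l h a)) \<le> ennreal (D1 * s)"
        by (intro SUP_least ennreal_leI) auto
      then have "N a \<le> ennreal s + ennreal (D1 * s)"
        unfolding N_def using n by (intro add_mono ennreal_leI)
      also have "\<dots> = ennreal ((1 + D1) * s)" using real D10 by (simp add: distrib_right)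
      finally show ?thesis using real D10 by (simp add: ennreal_mult)
    qed
  qed
qed

lemma norm_equivalence:
  assumes r: "0 < r" and p: "1 \<le> p"
  obtains C C' where "0 < C" "0 < C'"
    "\<And>a. approximation_norm X p r a \<le> ennreal C * besov_norm \<psi> p r a"
    "\<And>a. besov_norm \<psi> p r a \<le> ennreal C' * approximation_norm X p r a"
proof (cases "p = \<infinity>")
  case True
  show thesis
  proof (rule norm_equivalence_sup[OF r])
    fix C C' :: real
    assume "0 < C" "0 < C'"
      "\<And>a. (SUP k. ennreal (E (real k) a * real (k + 1) powr r)) \<le>
        ennreal C * (ennreal (norm a) + (SUP h\<in>{0<..}. ennreal (h powr (- r) * \<omega> (nat \<lfloor>r\<rfloor> + 1) h a)))"
      "\<And>a. ennreal (norm a) + (SUP h\<in>{0<..}. ennreal (h powr (- r) * \<omega> (nat \<lfloor>r\<rfloor> + 1) h a)) \<le>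
        ennreal C' * (SUP k. ennreal (E (real k) a * real (k + 1) powr r))"
    then show thesis
      by (intro that[of C C']) (simp_all only: besov_norm_def approximation_norm_def Let_def True if_True refl)
  qed
next
  case False
  then have q: "1 \<le> enn2real p" using p enn2real_mono[of 1 p] by (simp add: less_top)
  show thesis
  proof (rule norm_equivalence_finite[OF r q])
    fix C C' :: real
    assume "0 < C" "0 < C'"
      "\<And>a. ennreal_root (enn2real p) (\<Sum>n. ennreal (error_term r (enn2real p) a n)) \<le>
        ennreal C * (ennreal (norm a) + ennreal_root (enn2real p) (besov_integral (nat \<lfloor>r\<rfloor> + 1) r (enn2real p) a))"
      "\<And>a. ennreal (norm a) + ennreal_root (enn2real p) (besov_integral (nat \<lfloor>r\<rfloor> + 1) r (enn2real p) a) \<le>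
        ennreal C' * ennreal_root (enn2real p) (\<Sum>n. ennreal (error_term r (enn2real p) a n))"
    then show thesis
      by (intro that[of C C'])
        (simp_all only: besov_norm_def approximation_norm_def Let_def False if_False besov_integral_def error_term_def)
  qed
qed

end

text \<open>That \<open>\<psi> 0\<close> is the identity follows from the group law:
  \<open>\<psi> 0\<close> is idempotent and, as an automorphism, injective. Passing to
  \<open>max 1 M\<close> provides a bound that is at least 1.\<close>

lemma bounded_group_if_uniformly_bounded:
  assumes "automorphism_group \<psi>" "uniformly_bounded_group \<psi>"
  obtains M where "bounded_group \<psi> M"
proof -
  have lin: "bounded_linear (\<psi> t)" and bij: "bij (\<psi> t)" for t
    using assms(1) by (auto simp: automorphism_group_def banach_algebra_automorphism_def)
  have grp: "\<psi> s (\<psi> t a) = \<psi> (s + t) a" for s t a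
    using assms(1) by (auto simp: automorphism_group_def fun_eq_iff)
  have zero: "\<psi> 0 a = a" for a
    using grp[of 0 0 a] bij[of 0] by (auto dest!: bij_is_inj injD)
  obtain M where M: "\<And>t. onorm (\<psi> t) \<le> M"
    using assms(2) by (auto simp: uniformly_bounded_group_def bdd_above_def)
  have "norm (\<psi> t a) \<le> max 1 M * norm a" for t a
    using onorm[OF lin, of t a] M[of t] by (meson max.coboundedI2 mult_right_mono norm_ge_zero order_trans)
  then show thesis
    by (intro that[of "max 1 M"] bounded_group.intro lin grp zero) auto
qed

theorem theorem3p11:
  fixes \<psi> :: "real ^ 'd::{finite,linorder} \<Rightarrow> 'a::complex_banach_algebra \<Rightarrow> 'a"
    and r :: real and p :: ennreal
  assumes "automorphism_group \<psi>"
    and "uniformly_bounded_group \<psi>"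
    and "r > 0"
    and "1 \<le> p"
  shows "besov_space \<psi> p r = approximation_space (bandlimited_scheme \<psi>) p r \<and>
         equivalent_norms_on (besov_space \<psi> p r)
           (besov_norm \<psi> p r) (approximation_norm (bandlimited_scheme \<psi>) p r)"
proof -
  obtain M where "bounded_group \<psi> M"
    by (rule bounded_group_if_uniformly_bounded[OF assms(1,2)])
  then interpret bounded_group \<psi> M .
  obtain C C' where C: "0 < C" "0 < C'"
    "\<And>a. approximation_norm X p r a \<le> ennreal C * besov_norm \<psi> p r a"
    "\<And>a. besov_norm \<psi> p r a \<le> ennreal C' * approximation_norm X p r a"
    by (rule norm_equivalence[OF assms(3,4)]) blast
  have "besov_space \<psi> p r = approximation_space X p r"
  proof (intro equalityI subsetI)
    fix a assume "a \<in> besov_space \<psi> p r"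
    then have "ennreal C * besov_norm \<psi> p r a < \<infinity>" by (simp add: besov_space_def ennreal_mult_less_top)
    then show "a \<in> approximation_space X p r"
      using C(3)[of a] by (simp add: approximation_space_def order_le_less_trans)
  next
    fix a assume "a \<in> approximation_space X p r"
    then have "ennreal C' * approximation_norm X p r a < \<infinity>" by (simp add: approximation_space_def ennreal_mult_less_top)
    then show "a \<in> besov_space \<psi> p r"
      using C(4)[of a] by (simp add: besov_space_def order_le_less_trans)
  qed
  moreover have "ennreal (1 / C') * besov_norm \<psi> p r a \<le> approximation_norm X p r a" for a
  proof -
    have "ennreal (1 / C') * besov_norm \<psi> p r a \<le> ennreal (1 / C') * (ennreal C' * approximation_norm X p r a)"
      by (intro mult_left_mono C) auto
    also have "\<dots> = approximation_norm X p r a"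
      using C(2) by (simp add: mult.assoc[symmetric] ennreal_mult[symmetric])
    finally show ?thesis .
  qed
  ultimately show ?thesis
    unfolding equivalent_norms_on_def using C(1-3)
    by (intro conjI exI[of _ "1 / C'"] exI[of _ C]) auto
qed

end
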